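(* Let $|q|<1$ and $|X|>|t|^{-1/2}|q|^{1/2}$. Let $\Psi(X,\Lambda)$ be the function $$\Psi(X,\Lambda)=\sum_{n=-\infty}^{\infty} q^{n^2/4}\,t^{|n|/2}\,\frac{E_n(X)\,E_n^*(\Lambda)}{\langle E_nE_n^*\mu_\circ\rangle},$$ which is equivalently $\frac{\theta(X)\theta(\Lambda)}{\theta(t^{1/2})}G(X,\Lambda)$ for the global nonsymmetric function $G$ of type $A_1$, and let $$\Phi(X,\Lambda)=\sum_{n=0}^{\infty} q^{n^2/4}\,t^{n/2}\,\frac{P_n(X)\,P_n(\Lambda)}{\langle P_nP_n\mu_\circ\rangle}.$$ Put $$\sigma(\Lambda)=\prod_{j=0}^\infty\frac{1-tq^j\Lambda^2}{1-q^j\Lambda^2}=1+\sum_{j=1}^{\infty}\Lambda^{2j}\prod_{s=1}^j\frac{1-tq^{s-1}}{1-q^s}$$ (the series for $|\Lambda|<1$), $$\Xi_-(X,\Lambda)=\frac{1-t}{1-t\Lambda^{-2}}+\sum_{j=1}^\infty\frac{1-tq^j}{1-t\Lambda^{-2}}\Bigl(\frac qt\Bigr)^jX^{-2j}\prod_{s=1}^j\frac{(1-tq^{s-1})(1-tq^{s-1}\Lambda^2)}{(1-q^s)(1-q^s\Lambda^2)},$$ $$\Xi_+(X,\Lambda)=1+\sum_{j=1}^\infty\frac{1-tq^j\Lambda^2}{1-t\Lambda^2}\Bigl(\frac qt\Bigr)^jX^{-2j}\prod_{s=1}^j\frac{(1-tq^{s-1})(1-tq^{s-1}\Lambda^2)}{(1-q^s)(1-q^s\Lambda^2)}.$$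 Then, as meromorphic functions of $\Lambda$ (i.e. for $\Lambda$ away from singularities), $$\Psi(X,\Lambda)=\langle\mu\rangle\Bigl(\sigma(\Lambda^{-1})\,\theta(X\Lambda t^{1/2})\,\Xi_-(X,\Lambda)+\sigma(\Lambda)\,\theta(X\Lambda^{-1}t^{1/2})\,\Xi_+(X,\Lambda^{-1})\Bigr),$$ and $$\Phi(X,\Lambda)=\langle\mu\rangle\,\sigma(\Lambda^{-1})\,\frac{\theta(X\Lambda t^{1/2})}{1+t}\sum_{j=0}^\infty\Bigl(\frac qt\Bigr)^jX^{-2j}\prod_{s=1}^j\frac{(1-tq^{s-1})(1-tq^{s-1}\Lambda^2)}{(1-q^s)(1-q^s\Lambda^2)}$$ $$\qquad+\ \langle\mu\rangle\,\sigma(\Lambda)\,\frac{\theta(X\Lambda^{-1}t^{1/2})}{1+t}\sum_{j=0}^\infty\Bigl(\frac qt\Bigr)^jX^{-2j}\prod_{s=1}^j\frac{(1-tq^{s-1})(1-tq^{s-1}\Lambda^{-2})}{(1-q^s)(1-q^s\Lambda^{-2})}.$$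
   Context: Root system $A_1$. The parameters $q,t$ are nonzero complex numbers with fixed square roots $q^{1/2},t^{1/2}$ (and $q^{1/4}$); $t$ is generic, so that all polynomials $E_n$ below exist and the norms in the denominators are nonzero. Theta function: $\theta(X)=\sum_{n=-\infty}^\infty q^{n^2/4}X^n$. Operators on Laurent polynomials in $X$: $s(X^n)=X^{-n}$, $\Gamma(X^n)=q^{n/2}X^n$ ($n\in\mathbb Z$), $$T=t^{1/2}s+\frac{t^{1/2}-t^{-1/2}}{X^2-1}(s-1),\qquad Y=s\,\Gamma\,T .$$ Nonsymmetric Macdonald polynomials $E_n$ ($n\in\mathbb Z$): the unique eigenvectors $Y(E_n)=q^{-n_\#}E_n$, where $t=q^k$, $n_\#=\frac{n+k}{2}$ for $n>0$ and $n_\#=\frac{n-k}{2}$ for $n\le0$ (so the eigenvalue is $q^{-n/2}t^{-1/2}$ for $n>0$ and $q^{-n/2}t^{1/2}$ for $n\le 0$), normalized by $E_n=X^n+$ lower terms, where lower terms are linear combinations of $X^m$ with $|m|<|n|$ and, additionally, of $X^{|n|}$ when $n<0$. In particular $E_0=1$, $E_1=X$. Symmetric (Rogers) polynomials: $P_n=E_{-n}+\frac{t-tq^n}{1-tq^n}E_n$ for $n\ge0$ (so $P_0=1$). Conjugation: $X^*=X^{-1}$, $(q^{1/2})^*=q^{-1/2}$, $(t^{1/2})^*=t^{-1/2}$, extended multiplicatively and additively to (Laurent polynomials and series with) coefficients in $q^{1/2},t^{1/2}$; $E_n^*$ is the image of $E_n$, and $E_n^*(\Lambda)$ is $E_n^*$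 with $X$ replaced by $\Lambda$. Constant term: $\langle f\rangle$ is the coefficient of $X^0$ in a Laurent series or polynomial $f$ in $X$. The $\mu$-function (expanded as a Laurent series in $X$ with coefficients power series in $q$, i.e. in nonnegative powers of $X^2$ and $qX^{-2}$): $$\mu(X;q,t)=\prod_{j=0}^\infty\frac{(1-q^jX^2)(1-q^{j+1}X^{-2})}{(1-tq^jX^2)(1-tq^{j+1}X^{-2})},\qquad \langle\mu\rangle=\prod_{j=1}^\infty\frac{(1-tq^j)^2}{(1-t^2q^j)(1-q^j)},$$ $\mu_\circ=\mu/\langle\mu\rangle=1+\frac{t-1}{1-qt}(X^2+qX^{-2})+\cdots$; the coefficients of $\mu_\circ$ are rational functions of $q,t$, so $\langle E_nE_n^*\mu_\circ\rangle$ and $\langle P_nP_n\mu_\circ\rangle$ are rational functions of $q,t$. The global nonsymmetric function is $G(X,\Lambda)=\frac{\theta(t^{1/2})}{\theta(X)\theta(\Lambda)}\Psi(X,\Lambda)$, away from the zeros of $\theta(X)\theta(\Lambda)$. *)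

theory Defs
  imports
    "HOL-Analysis.Analysis"
    "HOL-Library.Poly_Mapping"
    "HOL-Computational_Algebra.Computational_Algebra"
begin

text \<open>
  Throughout, \<open>r\<close> stands for the fixed root \<open>q^(1/4)\<close> and \<open>u\<close> for the fixed root \<open>t^(1/2)\<close>, so
  \<open>q = r^4\<close>, \<open>q^(1/2) = r^2\<close> and \<open>t = u^2\<close>.  Definitions involving fractional powers take \<open>r\<close> and
  \<open>u\<close> as parameters, the others take \<open>q\<close> and \<open>t\<close>.
\<close>

definition theta :: "complex \<Rightarrow> complex \<Rightarrow> complex" where
  "theta r x = (\<Sum>\<^sub>\<infinity>n::int. r powi (n ^ 2) * x powi n)"


subsection \<open>Laurent polynomials and the operators $T$, $Y$\<close>

text \<open>
  The ring of Laurent polynomials is the group algebra of the integers; multiplication in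
  \<open>\<Rightarrow>\<^sub>0\<close> is convolution.
\<close>

type_synonym lpoly = "int \<Rightarrow>\<^sub>0 complex"

abbreviation lmono :: "int \<Rightarrow> lpoly" where
  "lmono n \<equiv> Poly_Mapping.single n 1"

definition lscale :: "complex \<Rightarrow> lpoly \<Rightarrow> lpoly" where
  "lscale c f = Poly_Mapping.single 0 c * f"

definition lextend :: "(int \<Rightarrow> lpoly) \<Rightarrow> lpoly \<Rightarrow> lpoly" where
  "lextend b f = (\<Sum>n\<in>Poly_Mapping.keys f. lscale (Poly_Mapping.lookup f n) (b n))"

definition leval :: "lpoly \<Rightarrow> complex \<Rightarrow> complex" where
  "leval f x = (\<Sum>n\<in>Poly_Mapping.keys f. Poly_Mapping.lookup f n * x powi n)"

definition op_s :: "lpoly \<Rightarrow> lpoly" where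
  "op_s = lextend (\<lambda>n. lmono (- n))"

definition op_Gamma :: "complex \<Rightarrow> lpoly \<Rightarrow> lpoly" where
  "op_Gamma r = lextend (\<lambda>n. lscale (r powi (2 * n)) (lmono n))"

text \<open>The quotient \<open>(s f - f) / (X\<^sup>2 - 1)\<close>; the division is exact and Laurent polynomials form a domain.\<close>

definition divided_diff :: "lpoly \<Rightarrow> lpoly" where
  "divided_diff f = (THE g. (lmono 2 - 1) * g = op_s f - f)"

definition op_T :: "complex \<Rightarrow> lpoly \<Rightarrow> lpoly" where
  "op_T u f = lscale u (op_s f) + lscale (u - inverse u) (divided_diff f)"

definition op_Y :: "complex \<Rightarrow> complex \<Rightarrow> lpoly \<Rightarrow> lpoly" where
  "op_Y r u f = op_s (op_Gamma r (op_T u f))"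


subsection \<open>Nonsymmetric Macdonald polynomials and Rogers polynomials\<close>

definition E_eigenvalue :: "complex \<Rightarrow> complex \<Rightarrow> int \<Rightarrow> complex" where
  "E_eigenvalue r u n = (if n > 0 then r powi (- 2 * n) * inverse u else r powi (- 2 * n) * u)"

definition is_E :: "complex \<Rightarrow> complex \<Rightarrow> int \<Rightarrow> lpoly \<Rightarrow> bool" where
  "is_E r u n f \<longleftrightarrow>
     op_Y r u f = lscale (E_eigenvalue r u n) f \<and>
     Poly_Mapping.lookup f n = 1 \<and>
     (\<forall>m\<in>Poly_Mapping.keys f. m = n \<or> \<bar>m\<bar> < \<bar>n\<bar> \<or> (n < 0 \<and> m = \<bar>n\<bar>))"

definition E_poly :: "complex \<Rightarrow> complex \<Rightarrow> int \<Rightarrow> lpoly" where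
  "E_poly r u n = (THE f. is_E r u n f)"

text \<open>
  The conjugate \<open>E_n\<^sup>*\<close>.  The conjugation inverts \<open>X\<close>, \<open>q^(1/2)\<close> and \<open>t^(1/2)\<close>; for numerical
  parameters its effect on the coefficients (rational functions of the parameters) is to evaluate
  them at the inverted parameters.  It is not complex conjugation.
\<close>

definition E_star :: "complex \<Rightarrow> complex \<Rightarrow> int \<Rightarrow> lpoly" where
  "E_star r u n = op_s (E_poly (inverse r) (inverse u) n)"

definition P_poly :: "complex \<Rightarrow> complex \<Rightarrow> nat \<Rightarrow> lpoly" where
  "P_poly r u n = (let q = r ^ 4; t = u ^ 2 in
     E_poly r u (- int n) + lscale ((t - t * q ^ n) / (1 - t * q ^ n)) (E_poly r u (int n)))"


subsection \<open>The function $\mu$ and the norms\<close>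

text \<open>
  For fixed numerical \<open>t\<close>, the expansion of \<open>\<mu>\<close> lives in \<open>complex fls fps\<close>: power series in a formal
  \<open>q\<close> (the outer variable \<open>fps_X\<close>) whose coefficients are formal Laurent series in \<open>X\<close>.  Since
  division in \<open>complex fls\<close> expands in positive powers of \<open>X\<close>, the quotients below are expanded in
  nonnegative powers of \<open>X\<^sup>2\<close> and \<open>q X\<^sup>-\<^sup>2\<close>, and the infinite product converges \<open>q\<close>-adically.
\<close>

definition mu_q :: "complex fls fps" where
  "mu_q = fps_X"

definition mu_X :: "int \<Rightarrow> complex fls fps" where
  "mu_X k = fps_const (fls_X_intpow k)"

definition mu_C :: "complex \<Rightarrow> complex fls fps" where
  "mu_C c = fps_const (fls_const c)"

definition mu_factor :: "complex \<Rightarrow> nat \<Rightarrow> complex fls fps" where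
  "mu_factor t j =
     ((1 - mu_q ^ j * mu_X 2) * (1 - mu_q ^ (j + 1) * mu_X (- 2))) /
     ((1 - mu_C t * mu_q ^ j * mu_X 2) * (1 - mu_C t * mu_q ^ (j + 1) * mu_X (- 2)))"

definition mu :: "complex \<Rightarrow> complex fls fps" where
  "mu t = prodinf (mu_factor t)"

text \<open>Coefficient of \<open>X^m\<close> in \<open>\<mu>\<close> and in \<open>\<mu>\<^sub>\<circ> = \<mu> / \<langle>\<mu>\<rangle>\<close>, as power series in \<open>q\<close>.\<close>

definition mu_coeff :: "complex \<Rightarrow> int \<Rightarrow> complex fps" where
  "mu_coeff t m = Abs_fps (\<lambda>N. fls_nth (fps_nth (mu t) N) m)"

definition mu0_series :: "complex \<Rightarrow> int \<Rightarrow> complex fps" where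
  "mu0_series t m = mu_coeff t m / mu_coeff t 0"

text \<open>Value at \<open>z\<close> of the rational function, regular at \<open>z\<close>, whose power series expansion is \<open>F\<close>.
  (The series \<open>F\<close> itself need not converge at \<open>z\<close>.)\<close>

definition rat_value :: "complex fps \<Rightarrow> complex \<Rightarrow> complex" where
  "rat_value F z = (THE v. \<exists>a b :: complex poly.
     poly b z \<noteq> 0 \<and> fps_of_poly b * F = fps_of_poly a \<and> v = poly a z / poly b z)"

definition mu0_coeff :: "complex \<Rightarrow> complex \<Rightarrow> int \<Rightarrow> complex" where
  "mu0_coeff q t m = rat_value (mu0_series t m) q"

text \<open>The constant term \<open>\<langle>f \<mu>\<^sub>\<circ>\<rangle>\<close> for a Laurent polynomial \<open>f\<close>.\<close>

definition ct_mu0 :: "complex \<Rightarrow> complex \<Rightarrow> lpoly \<Rightarrow> complex" where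
  "ct_mu0 q t f = (\<Sum>m\<in>Poly_Mapping.keys f. Poly_Mapping.lookup f m * mu0_coeff q t (- m))"

definition E_norm :: "complex \<Rightarrow> complex \<Rightarrow> int \<Rightarrow> complex" where
  "E_norm r u n = ct_mu0 (r ^ 4) (u ^ 2) (E_poly r u n * E_star r u n)"

definition P_norm :: "complex \<Rightarrow> complex \<Rightarrow> nat \<Rightarrow> complex" where
  "P_norm r u n = ct_mu0 (r ^ 4) (u ^ 2) (P_poly r u n * P_poly r u n)"

definition mu_ct :: "complex \<Rightarrow> complex \<Rightarrow> complex" where
  "mu_ct q t = prodinf (\<lambda>j. (1 - t * q ^ Suc j) ^ 2 / ((1 - t ^ 2 * q ^ Suc j) * (1 - q ^ Suc j)))"

text \<open>Genericity: all \<open>E_n\<close> and \<open>E_n\<^sup>*\<close> exist (and are unique), and all norms are nonzero.\<close>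

definition generic :: "complex \<Rightarrow> complex \<Rightarrow> bool" where
  "generic r u \<longleftrightarrow>
     (\<forall>n. \<exists>!f. is_E r u n f) \<and>
     (\<forall>n. \<exists>!f. is_E (inverse r) (inverse u) n f) \<and>
     (\<forall>n. E_norm r u n \<noteq> 0) \<and>
     (\<forall>n. P_norm r u n \<noteq> 0)"


subsection \<open>The functions $\Psi$, $\Phi$, $G$\<close>

definition Psi_term :: "complex \<Rightarrow> complex \<Rightarrow> complex \<Rightarrow> complex \<Rightarrow> int \<Rightarrow> complex" where
  "Psi_term r u X L n =
     r powi (n ^ 2) * u powi \<bar>n\<bar> * (leval (E_poly r u n) X * leval (E_star r u n) L) / E_norm r u n"

definition Psi :: "complex \<Rightarrow> complex \<Rightarrow> complex \<Rightarrow> complex \<Rightarrow> complex" where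
  "Psi r u X L = (\<Sum>\<^sub>\<infinity>n::int. Psi_term r u X L n)"

definition Phi_term :: "complex \<Rightarrow> complex \<Rightarrow> complex \<Rightarrow> complex \<Rightarrow> nat \<Rightarrow> complex" where
  "Phi_term r u X L n =
     r ^ (n ^ 2) * u ^ n * (leval (P_poly r u n) X * leval (P_poly r u n) L) / P_norm r u n"

definition Phi :: "complex \<Rightarrow> complex \<Rightarrow> complex \<Rightarrow> complex \<Rightarrow> complex" where
  "Phi r u X L = suminf (Phi_term r u X L)"

definition G_global :: "complex \<Rightarrow> complex \<Rightarrow> complex \<Rightarrow> complex \<Rightarrow> complex" where
  "G_global r u X L = theta r u / (theta r X * theta r L) * Psi r u X L"


subsection \<open>The functions $\sigma$, $\Xi_-$, $\Xi_+$\<close>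

definition sigma_fn :: "complex \<Rightarrow> complex \<Rightarrow> complex \<Rightarrow> complex" where
  "sigma_fn q t L = prodinf (\<lambda>j. (1 - t * q ^ j * L ^ 2) / (1 - q ^ j * L ^ 2))"

definition hyp_prod :: "complex \<Rightarrow> complex \<Rightarrow> complex \<Rightarrow> nat \<Rightarrow> complex" where
  "hyp_prod q t L j = (\<Prod>s=1..j.
     ((1 - t * q ^ (s - 1)) * (1 - t * q ^ (s - 1) * L ^ 2)) / ((1 - q ^ s) * (1 - q ^ s * L ^ 2)))"

text \<open>The series start at \<open>j = 1\<close>, hence the shift \<open>j = Suc i\<close>.\<close>

definition Xi_minus :: "complex \<Rightarrow> complex \<Rightarrow> complex \<Rightarrow> complex \<Rightarrow> complex" where
  "Xi_minus q t X L =
     (1 - t) / (1 - t * L powi (- 2)) +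
     suminf (\<lambda>i. let j = Suc i in
        (1 - t * q ^ j) / (1 - t * L powi (- 2)) * (q / t) ^ j * X powi (- 2 * int j) * hyp_prod q t L j)"

definition Xi_plus :: "complex \<Rightarrow> complex \<Rightarrow> complex \<Rightarrow> complex \<Rightarrow> complex" where
  "Xi_plus q t X L =
     1 +
     suminf (\<lambda>i. let j = Suc i in
        (1 - t * q ^ j * L ^ 2) / (1 - t * L ^ 2) * (q / t) ^ j * X powi (- 2 * int j) * hyp_prod q t L j)"

end

theory Submission
  imports Defs "HOL-Complex_Analysis.Complex_Analysis"
begin

text \<open>
  Comparing coefficients in the eigenvalue equation for \<open>Y\<close> gives the \<open>E\<^sub>n\<close> in closed form, as
  convolutions of q-binomial coefficients.  The coefficients of \<open>\<mu>\<^sub>\<circ>\<close> satisfy a first-order recurrence,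
  and creative telescoping of the moments of \<open>E\<^sub>n\<close> yields the norms.

  Expand \<open>\<Phi>\<close> in powers of \<open>X\<close>.  By the Pieri rule the coefficients solve a second-order q-difference
  equation in the exponent \<open>m\<close>, and so do the coefficients \<open>\<Lambda>\<^sup>m \<Sum>\<^sub>j ...\<close> and \<open>\<Lambda>\<^sup>-\<^sup>m \<Sum>\<^sub>j ...\<close> of the two terms on
  the right.  For \<open>|\<Lambda>| = 1\<close> a solution that tends to zero as \<open>m\<close> tends to infinity vanishes, so the
  identity follows from the asymptotics of both sides; it extends to all \<open>\<Lambda>\<close> by analytic continuation.

  The formula for \<open>\<Psi>\<close> is a consequence:
  \<open>(1 - t \<Lambda>\<^sup>-\<^sup>2) \<Psi>(X, \<Lambda>) = (1 + t) (\<Phi>(X, \<Lambda>) - q^(1/4) t^(1/2) X\<^sup>-\<^sup>1 \<Lambda>\<^sup>-\<^sup>1 \<Phi>(q^(-1/2) X, \<Lambda>))\<close>.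
  The bracket sums used for this divide by \<open>1 - t\<close>; for \<open>t = 1\<close> simply \<open>E\<^sub>n = X\<^sup>n\<close>.
\<close>

subsection \<open>Laurent polynomials\<close>

text \<open>The uniqueness argument lives on |\<Lambda>| = 1 because, as q^m tends to zero, the
  q-difference equation degenerates to g(m-2) + g(m) = (\<Lambda> + 1/\<Lambda>) g(m-1) with
  solutions \<Lambda>^m and \<Lambda>^-m; off the circle one of them decays and could be added
  unnoticed.

  On the circle the Rogers polynomials oscillate, and the q-binomial series with argument x =
  \<Lambda>^-2 is taken on the boundary of its disc of convergence. The difference of the polynomial
  at n and \<Lambda>^-1 times the one at n - 1 isolates a single exponential and has a genuine
  limit, governed by (t x; q)\<infinity> / (q x; q)\<infinity>. The constant in the formula is the
  product of the limits met on the way.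

  The infinite products in \<Lambda> have zeros, so the comparison is made after multiplication by
  products that leave both sides holomorphic on the punctured plane; the quotients \<sigma> appear
  only after the continuation.

  For \<Psi>, the factor 1 - t \<Lambda>^-2 symmetrizes E_n in \<Lambda>, while the shift X ->
  q^(-1/2) X separates the two nonsymmetric constituents of a Rogers polynomial in X.\<close>

abbreviation "lkp \<equiv> Poly_Mapping.lookup"

lemma lookup_single_mult:
  fixes f :: lpoly
  shows "lkp (Poly_Mapping.single k c * f) n = c * lkp f (n - k)"
proof -
  have eq: "(n = l + q) = (q = n - l)" for l q :: int by auto
  have "lkp (Poly_Mapping.single k c * f) n = Sum_any (\<lambda>l. (c when k = l) * lkp f (n - l))"
    by (simp add: lookup_mult lookup_single eq)
  also have "\<dots> = Sum_any (\<lambda>l. c * lkp f (n - l) when l = k)"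
    by (rule Sum_any.cong) (auto simp: when_def)
  finally show ?thesis by simp
qed

lemma lookup_lscale [simp]: "lkp (lscale c f) n = c * lkp f n"
  by (simp add: lscale_def lookup_single_mult)

lemma lookup_lmono_mult: "lkp (lmono k * f) n = lkp f (n - k)"
  by (simp add: lookup_single_mult)

lemma lscale_mult_right: "f * lscale c g = lscale c (f * g)"
  by (simp add: lscale_def mult.left_commute)

lemma lscale_add: "lscale c (f + g) = lscale c f + lscale c g"
  by (simp add: lscale_def distrib_left)

lemma lookup_lextend: "lkp (lextend b f) n = (\<Sum>m\<in>Poly_Mapping.keys f. lkp f m * lkp (b m) n)"
  by (simp add: lextend_def lookup_sum)

lemma lookup_op_s [simp]: "lkp (op_s f) n = lkp f (- n)"
proof -
  have "lkp (op_s f) n = (\<Sum>m\<in>Poly_Mapping.keys f. if m = - n then lkp f m else 0)"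
    unfolding op_s_def lookup_lextend by (intro sum.cong) (auto simp: lookup_single when_def)
  also have "\<dots> = lkp f (- n)" by (simp add: in_keys_iff)
  finally show ?thesis .
qed

lemma lookup_op_Gamma [simp]: "lkp (op_Gamma r f) n = r powi (2 * n) * lkp f n"
proof -
  have "lkp (op_Gamma r f) n = (\<Sum>m\<in>Poly_Mapping.keys f. if m = n then r powi (2 * n) * lkp f n else 0)"
    unfolding op_Gamma_def lookup_lextend by (intro sum.cong) (auto simp: lookup_single when_def)
  also have "\<dots> = r powi (2 * n) * lkp f n" by (simp add: in_keys_iff)
  finally show ?thesis .
qed

lemma op_s_add: "op_s (f + g) = op_s f + op_s g"
  by (rule poly_mapping_eqI) (simp add: lookup_add)

lemma lmono_mult: "lmono a * lmono b = lmono (a + b)"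
  by (simp add: mult_single)

lemma lmono_numeral_power: "lmono 2 ^ n = lmono (2 * int n)"
  by (induction n) (simp_all add: lmono_mult algebra_simps)

lemma lpoly_eq_sum_single: "(f :: lpoly) = (\<Sum>m\<in>Poly_Mapping.keys f. Poly_Mapping.single m (lkp f m))"
  by (rule poly_mapping_eqI) (simp add: lookup_sum lookup_single when_def in_keys_iff)

text \<open>With y = X^2 the difference X^-n - X^n is -X^-n (y^n - 1), and y - 1 divides y^n - 1. A
  negative exponent only changes the sign of the coefficient.\<close>

lemma divided_diff_dvd_single:
  "lmono 2 - 1 dvd Poly_Mapping.single (- k) (c::complex) - Poly_Mapping.single k c"
proof -
  have pos: "lmono 2 - 1 dvd Poly_Mapping.single (- int n) (c::complex) - Poly_Mapping.single (int n) c" for n c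
  proof -
    have "lmono 2 - 1 dvd lmono 2 ^ n - (1 :: lpoly)"
    proof (induction n)
      case (Suc n)
      have "lmono 2 ^ Suc n - 1 = lmono 2 * (lmono 2 ^ n - 1) + (lmono 2 - 1 :: lpoly)"
        by (simp add: algebra_simps)
      then show ?case using Suc by (simp only: dvd_add dvd_mult dvd_refl)
    qed simp
    moreover have "Poly_Mapping.single (- int n) c - Poly_Mapping.single (int n) c =
       - Poly_Mapping.single (- int n) c * (lmono 2 ^ n - 1)"
      by (simp add: lmono_numeral_power mult_single algebra_simps)
    ultimately show ?thesis by (simp add: dvd_mult)
  qed
  show ?thesis
  proof (cases "k \<ge> 0")
    case True
    then show ?thesis using pos[of "nat k" c] by simp
  next
    case False
    then show ?thesis using pos[of "nat (- k)" "- c"] by (simp add: single_uminus)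
  qed
qed

lemma divided_diff_dvd: "lmono 2 - 1 dvd op_s f - f"
proof -
  have "op_s f - f = (\<Sum>m\<in>Poly_Mapping.keys f. Poly_Mapping.single (- m) (lkp f m) - Poly_Mapping.single m (lkp f m))"
  proof -
    have "op_s f = (\<Sum>m\<in>Poly_Mapping.keys f. Poly_Mapping.single (- m) (lkp f m))"
      by (simp add: op_s_def lextend_def lscale_def mult_single)
    then show ?thesis using lpoly_eq_sum_single[of f] by (simp add: sum_subtractf)
  qed
  then show ?thesis by (simp add: dvd_sum divided_diff_dvd_single)
qed

lemma lmono2_minus_1_nonzero: "lmono 2 - 1 \<noteq> (0 :: lpoly)"
proof
  assume "lmono 2 - 1 = (0 :: lpoly)"
  then have "lkp (lmono 2 - 1) 2 = lkp (0 :: lpoly) 2" by simp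
  then show False by (simp add: lookup_minus lookup_one when_def)
qed

lemma divided_diff_mult: "(lmono 2 - 1) * divided_diff f = op_s f - f"
proof -
  obtain g where g: "op_s f - f = (lmono 2 - 1) * g" using divided_diff_dvd by (auto simp: dvd_def)
  show ?thesis unfolding divided_diff_def
    by (rule theI[of _ g]) (use g lmono2_minus_1_nonzero in auto)
qed

lemma divided_diff_add: "divided_diff (f + g) = divided_diff f + divided_diff g"
proof -
  have "(lmono 2 - 1) * divided_diff (f + g) = (lmono 2 - 1) * (divided_diff f + divided_diff g)"
    by (simp only: divided_diff_mult distrib_left op_s_add) simp
  then show ?thesis using lmono2_minus_1_nonzero by simp
qed

lemma op_Y_add: "op_Y r u (f + g) = op_Y r u f + op_Y r u g"
proof -
  have "op_T u (f + g) = op_T u f + op_T u g"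
    by (simp add: op_T_def op_s_add divided_diff_add lscale_add)
  moreover have "op_Gamma r (f + g) = op_Gamma r f + op_Gamma r g" for f g
    by (rule poly_mapping_eqI) (simp add: lookup_add algebra_simps)
  ultimately show ?thesis by (simp add: op_Y_def op_s_add)
qed

text \<open>As s is an involution, Y f = lam f amounts to T f = lam \<Gamma>^-1 s f. Multiplication
  by X^2 - 1 removes the divided difference, so the operator equation becomes one relation between
  coefficients at 2 - k, -k and k.\<close>

lemma op_Y_eigenI:
  assumes r: "r \<noteq> 0"
    and eq: "\<And>k. u * (lkp f (2 - k) - lkp f (- k)) + (u - inverse u) * (lkp f (- k) - lkp f k) =
      lam * (r powi (4 - 2 * k) * lkp f (2 - k) - r powi (- 2 * k) * lkp f (- k))"
  shows "op_Y r u f = lscale lam f"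
proof -
  define g where "g = op_Gamma (inverse r) (op_s f)"
  have g: "lkp g k = r powi (- 2 * k) * lkp f (- k)" for k
    by (simp add: g_def power_int_minus power_int_inverse)
  have lk: "lkp ((lmono 2 - 1) * h) k = lkp h (k - 2) - lkp h k" for h k
    by (simp add: left_diff_distrib lookup_minus lookup_single_mult)
  have "(lmono 2 - 1) * op_T u f = (lmono 2 - 1) * lscale lam g"
  proof (rule poly_mapping_eqI)
    fix k
    have "lkp ((lmono 2 - 1) * op_T u f) k =
      u * (lkp f (2 - k) - lkp f (- k)) + (u - inverse u) * lkp ((lmono 2 - 1) * divided_diff f) k"
      by (simp only: lk) (simp add: op_T_def lookup_add algebra_simps)
    also have "\<dots> = lam * (r powi (4 - 2 * k) * lkp f (2 - k) - r powi (- 2 * k) * lkp f (- k))"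
      unfolding eq[symmetric] by (simp add: divided_diff_mult lookup_minus)
    also have "\<dots> = lkp ((lmono 2 - 1) * lscale lam g) k"
      by (simp only: lk) (simp add: g algebra_simps)
    finally show "lkp ((lmono 2 - 1) * op_T u f) k = lkp ((lmono 2 - 1) * lscale lam g) k" .
  qed
  then have T: "op_T u f = lscale lam g" using lmono2_minus_1_nonzero by simp
  show ?thesis unfolding op_Y_def T
    by (rule poly_mapping_eqI) (simp add: g power_int_minus r)
qed


subsection \<open>Closed forms of the polynomials $E_n$\<close>

definition qpoch :: "complex \<Rightarrow> complex \<Rightarrow> nat \<Rightarrow> complex" where
  "qpoch q c n = (\<Prod>l<n. 1 - c * q ^ l)"

lemma qpoch_0 [simp]: "qpoch q c 0 = 1"
  by (simp add: qpoch_def)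

lemma qpoch_Suc: "qpoch q c (Suc n) = qpoch q c n * (1 - c * q ^ n)"
  by (simp add: qpoch_def)

lemma qpoch_Suc_shift: "qpoch q c (Suc n) = (1 - c) * qpoch q (c * q) n"
  by (simp add: qpoch_def prod.lessThan_Suc_shift mult.assoc del: prod.lessThan_Suc)

lemma qpoch_nonzero: "(\<And>l. l < n \<Longrightarrow> c * q ^ l \<noteq> 1) \<Longrightarrow> qpoch q c n \<noteq> 0"
  by (auto simp: qpoch_def)

text \<open>Extended by zero, so that the recurrences in \<open>i\<close> hold for all integers.\<close>

definition wq :: "complex \<Rightarrow> complex \<Rightarrow> int \<Rightarrow> complex" where
  "wq q c i = (if i < 0 then 0 else qpoch q c (nat i) / qpoch q q (nat i))"

lemma wq_neg [simp]: "i < 0 \<Longrightarrow> wq q c i = 0"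
  by (simp add: wq_def)

lemma wq_0 [simp]: "wq q c 0 = 1"
  by (simp add: wq_def)

lemma wq_of_nat: "wq q c (int n) = qpoch q c n / qpoch q q n"
  by (simp add: wq_def)

lemma int_cases_neg:
  obtains "(i :: int) < 0" | "i = 0" | n where "i = int (Suc n)"
  using that(1,2) that(3)[of "nat i - 1"] by linarith

lemma wq_rec:
  assumes "\<And>k. k > 0 \<Longrightarrow> q ^ k \<noteq> 1"
  shows "(1 - q powi i) * wq q c i = (1 - c * q powi (i - 1)) * wq q c (i - 1)"
proof (cases i rule: int_cases_neg)
  case (3 n)
  have "qpoch q q (Suc n) \<noteq> 0" using assms by (intro qpoch_nonzero) (simp flip: power_Suc)
  moreover have "q powi int (Suc n) = q * q ^ n" "int (Suc n) - 1 = int n" by (simp_all add: power_int_def nat_add_distrib)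
  ultimately show ?thesis unfolding 3 by (simp only: wq_of_nat) (simp add: qpoch_Suc field_simps)
qed auto

text \<open>In the generating function (c x; q)\<infinity> / (x; q)\<infinity> of
  \<open>wq q c\<close> the first factor 1 - c x of the numerator is split off.\<close>

lemma wq_lower:
  assumes "\<And>k. k > 0 \<Longrightarrow> q ^ k \<noteq> 1"
  shows "wq q c i = wq q (c * q) i - c * wq q (c * q) (i - 1)"
proof (cases i rule: int_cases_neg)
  case (3 n)
  have "qpoch q q (Suc n) \<noteq> 0" using assms by (intro qpoch_nonzero) (simp flip: power_Suc)
  then have "qpoch q q n \<noteq> 0" "1 - q * q ^ n \<noteq> 0" by (simp_all add: qpoch_Suc)
  moreover have "int (Suc n) - 1 = int n" by simp
  ultimately show ?thesis unfolding 3
    unfolding wq_of_nat qpoch_Suc_shift[of q c] by (simp only: wq_of_nat qpoch_Suc) (simp add: field_simps)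
qed auto

text \<open>The weight q^i replaces x by q x in the generating function (c x; q)\<infinity> / (x;
  q)\<infinity>, and the result is 1 - x times (c q x; q)\<infinity> / (x; q)\<infinity>.\<close>

lemma wq_upper:
  assumes "\<And>k. k > 0 \<Longrightarrow> q ^ k \<noteq> 1"
  shows "q powi i * wq q c i = wq q (c * q) i - wq q (c * q) (i - 1)"
proof (cases i rule: int_cases_neg)
  case (3 n)
  have "qpoch q q (Suc n) \<noteq> 0" using assms by (intro qpoch_nonzero) (simp flip: power_Suc)
  then have "qpoch q q n \<noteq> 0" "1 - q * q ^ n \<noteq> 0" by (simp_all add: qpoch_Suc)
  moreover have "q powi int (Suc n) = q * q ^ n" "int (Suc n) - 1 = int n" by (simp_all add: power_int_def nat_add_distrib)
  ultimately show ?thesis unfolding 3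
    unfolding wq_of_nat qpoch_Suc_shift[of q c] by (simp only: wq_of_nat qpoch_Suc) (simp add: field_simps)
qed auto

lemma wq_shift: "(1 - c) * wq q (c * q) i = (1 - c * q powi i) * wq q c i"
proof (cases "i < 0")
  case False
  then obtain n where "i = int n" by (metis nonneg_int_cases not_le)
  then show ?thesis using qpoch_Suc_shift[of q c n] by (simp add: wq_of_nat qpoch_Suc mult.commute)
qed simp

text \<open>Only the exponents -n, -n+2, ..., n occur in the polynomials of index n or -n, so the
  coefficients are indexed by 0..n; convolution formulas become visible in this indexing.\<close>

definition lpb :: "int \<Rightarrow> (int \<Rightarrow> complex) \<Rightarrow> lpoly" where
  "lpb n h = (\<Sum>i\<in>{0..n}. Poly_Mapping.single (2 * i - n) (h i))"

lemma lookup_lpb: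
  assumes "\<And>i. i < 0 \<or> i > n \<Longrightarrow> h i = 0"
  shows "lkp (lpb n h) k = (if even (k + n) then h ((k + n) div 2) else 0)"
proof (cases "even (k + n)")
  case True
  then obtain i where i: "k = 2 * i - n" by (metis evenE add_diff_cancel_right')
  have "lkp (lpb n h) k = (\<Sum>l\<in>{0..n}. if l = i then h i else 0)"
    unfolding lpb_def lookup_sum by (intro sum.cong) (auto simp: lookup_single i when_def)
  also have "\<dots> = h i" using assms[of i] by (auto simp: not_le)
  finally show ?thesis by (simp add: i)
next
  case False
  then have "2 * x - n \<noteq> k" for x by presburger
  then show ?thesis using False unfolding lpb_def lookup_sum
    by (auto simp: lookup_single when_def intro!: sum.neutral)
qed

lemma keys_lpb: "Poly_Mapping.keys (lpb n h) \<subseteq> (\<lambda>i. 2 * i - n) ` {0..n}"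
  unfolding lpb_def by (rule order.trans[OF keys_sum]) (auto split: if_splits)

lemma keys_lscale: "Poly_Mapping.keys (lscale c f) \<subseteq> Poly_Mapping.keys f"
  by (auto simp: in_keys_iff)

lemma qpoch_inverse:
  assumes "q \<noteq> 0" "c \<noteq> 0"
  shows "qpoch (inverse q) (inverse c) n = (\<Prod>l<n. - inverse (c * q ^ l)) * qpoch q c n"
  unfolding qpoch_def prod.distrib[symmetric]
  by (rule prod.cong) (use assms in \<open>auto simp: field_simps\<close>)

text \<open>Each factor 1 - 1/(c q^l) equals -(1 - c q^l) / (c q^l). In the quotient by the same
  expression with c = q the powers of q cancel and (q/c)^n is left.\<close>

lemma wq_inverse:
  assumes "q \<noteq> 0" "c \<noteq> 0"
  shows "wq (inverse q) (inverse c) (int n) = (q / c) ^ n * wq q c (int n)"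
proof -
  have nz: "(\<Prod>l<n. - inverse (q * q ^ l)) \<noteq> 0" using assms by auto
  have "(\<Prod>l<n. - inverse (c * q ^ l)) = (\<Prod>l<n. (q / c) * (- inverse (q * q ^ l)))"
    by (rule prod.cong) (use assms in \<open>auto simp: field_simps\<close>)
  also have "\<dots> = (q / c) ^ n * (\<Prod>l<n. - inverse (q * q ^ l))" by (simp only: prod.distrib) simp
  finally show ?thesis using nz
    by (simp only: wq_of_nat qpoch_inverse[OF assms] qpoch_inverse[OF assms(1) assms(1)]) (simp add: divide_simps)
qed

text \<open>The modulus of q is left free, so that the locale can be instantiated at 1/q and 1/t as
  well, the parameters that define the conjugate polynomials.\<close>

locale macdonald_params =
  fixes r u q t :: complex
  assumes q_eq: "q = r ^ 4" and t_eq: "t = u ^ 2"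
    and q_nonzero: "q \<noteq> 0" and t_nonzero: "t \<noteq> 0"
    and q_power: "k > 0 \<Longrightarrow> q ^ k \<noteq> 1"
    and tq_power: "k > 0 \<Longrightarrow> t * q ^ k \<noteq> 1"
begin

abbreviation "w \<equiv> wq q t"
abbreviation "p \<equiv> wq q (t * q)"

lemma r_nonzero: "r \<noteq> 0" using q_nonzero q_eq by auto
lemma u_nonzero: "u \<noteq> 0" using t_nonzero t_eq by auto

lemma r_powi: "r powi (4 * n) = q powi n"
  unfolding q_eq by (simp add: power_int_power)

lemma q_powi_add: "q powi (m + n) = q powi m * q powi n"
  using q_nonzero by (simp add: power_int_add)

lemma qq_nonzero: "qpoch q q n \<noteq> 0"
  by (rule qpoch_nonzero) (metis power_Suc q_power zero_less_Suc)

lemma tqq_nonzero: "qpoch q (t * q) n \<noteq> 0"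
  by (rule qpoch_nonzero) (metis mult.assoc power_Suc tq_power zero_less_Suc)

lemma p_nonzero: "n \<ge> 0 \<Longrightarrow> p n \<noteq> 0"
  by (simp add: wq_def qq_nonzero tqq_nonzero)

lemmas w_rec = wq_rec[of q _ t, OF q_power]
lemmas p_rec = wq_rec[of q _ "t * q", OF q_power]
lemmas w_lower = wq_lower[of q t, OF q_power]
lemmas w_upper = wq_upper[of q _ t, OF q_power]
lemmas p_w = wq_shift[of t q]

definition a_poly :: "int \<Rightarrow> lpoly" where
  "a_poly n = lpb n (\<lambda>i. w i * p (n - i))"

text \<open>Indexed by its degree, so that the polynomial with leading term \<open>X ^ n\<close> is \<open>b_poly n\<close>.\<close>

definition b_poly :: "int \<Rightarrow> lpoly" where
  "b_poly n = lpb n (\<lambda>i. q powi (n - i) * w (n - i) * p (i - 1))"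

lemma wq_inverse1: "i \<ge> 0 \<Longrightarrow> wq (inverse q) (inverse t) i = (q / t) powi i * w i"
  using wq_inverse[OF q_nonzero t_nonzero, of "nat i"] by (simp add: power_int_def)

lemma wq_inverse2: "i \<ge> 0 \<Longrightarrow> wq (inverse q) (inverse t * inverse q) i = t powi (- i) * p i"
  using wq_inverse[OF q_nonzero, of "t * q" "nat i"] t_nonzero q_nonzero
  by (simp add: power_int_def power_inverse inverse_eq_divide)

lemma lookup_a_poly: "lkp (a_poly n) k = (if even (k + n) then w ((k + n) div 2) * p (n - (k + n) div 2) else 0)"
  unfolding a_poly_def by (subst lookup_lpb) auto

lemma lookup_b_poly: "lkp (b_poly n) k =
    (if even (k + n) then q powi (n - (k + n) div 2) * w (n - (k + n) div 2) * p ((k + n) div 2 - 1) else 0)"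
  unfolding b_poly_def by (subst lookup_lpb) auto

text \<open>With k = 2i - n and j = n - i, the three coefficients that the eigenvalue equation
  couples at X^k are products of one value of w and one of p. The relation between them follows from
  \<open>w_rec\<close>, \<open>w_lower\<close> and \<open>p_w\<close>.\<close>

lemma is_E_neg:
  assumes n: "n \<ge> 0"
  shows "is_E r u (- n) (lscale (1 / p n) (a_poly n))"
proof -
  let ?f = "lscale (1 / p n) (a_poly n)"
  have "op_Y r u ?f = lscale (r powi (2 * n) * u) ?f"
  proof (rule op_Y_eigenI[OF r_nonzero])
    fix k
    show "u * (lkp ?f (2 - k) - lkp ?f (- k)) + (u - inverse u) * (lkp ?f (- k) - lkp ?f k) =
      r powi (2 * n) * u * (r powi (4 - 2 * k) * lkp ?f (2 - k) - r powi (- 2 * k) * lkp ?f (- k))"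
    proof (cases "even (k + n)")
      case True
      then obtain i where i: "k = 2 * i - n" by (metis evenE add_diff_cancel_right')
      define j where "j = n - i"
      have k: "(k + n) div 2 = i" "(2 - k + n) div 2 = j + 1" "(- k + n) div 2 = j"
        "n - i = j" "n - (j + 1) = i - 1" "n - j = i" by (auto simp: i j_def)
      have ev: "even (2 - k + n)" "even (- k + n)" "even (k + n)" using True by auto
      have e: "r powi (2 * n) * r powi (4 - 2 * k) = q powi (j + 1)" "r powi (2 * n) * r powi (- 2 * k) = q powi j"
        by (simp_all add: r_nonzero flip: power_int_add r_powi) (simp_all add: i j_def algebra_simps)
      let ?A = "w (j + 1) * p (i - 1)" and ?B = "w j * p i" and ?C = "w i * p j"
      have R1: "(1 - q powi (j + 1)) * w (j + 1) = (1 - t * q powi j) * w j" using w_rec[of "j + 1"] by simp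
      have "t * (1 - q powi (j + 1)) * ?A = t * (1 - t * q powi j) * w j * p (i - 1)"
        using R1 by (metis mult.assoc)
      moreover have "(1 - t) * ?C = (1 - t * q powi j) * w j * w i"
        using p_w[of j] by (metis mult.assoc mult.commute)
      moreover have "w j * w i = w j * p i - t * (w j * p (i - 1))" using w_lower[of i] by algebra
      ultimately have "t * (?A - ?B) + (t - 1) * (?B - ?C) = t * (q powi (j + 1) * ?A - q powi j * ?B)"
        by algebra
      \<comment> \<open>Multiplication by u turns u - 1/u into t - 1, so that only t = u^2 is left
        and the identity just proved applies.\<close>
      moreover have "u * inverse u = 1" using u_nonzero by simp
      ultimately have "u * (u * (?A - ?B) + (u - inverse u) * (?B - ?C)) = u * (u * (q powi (j + 1) * ?A - q powi j * ?B))"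
        using t_eq by algebra
      then have *: "u * (?A - ?B) + (u - inverse u) * (?B - ?C) = u * (q powi (j + 1) * ?A - q powi j * ?B)"
        using u_nonzero by simp
      have l: "lkp ?f (2 - k) = ?A / p n" "lkp ?f (- k) = ?B / p n" "lkp ?f k = ?C / p n"
        using ev by (simp_all only: lookup_lscale lookup_a_poly k if_True) simp_all
      have "u * (lkp ?f (2 - k) - lkp ?f (- k)) + (u - inverse u) * (lkp ?f (- k) - lkp ?f k) =
         (u * (?A - ?B) + (u - inverse u) * (?B - ?C)) / p n"
        unfolding l by (simp add: diff_divide_distrib add_divide_distrib right_diff_distrib)
      also have "\<dots> = (u * ((r powi (2 * n) * r powi (4 - 2 * k)) * ?A - (r powi (2 * n) * r powi (- 2 * k)) * ?B)) / p n"
        unfolding * e ..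
      also have "\<dots> = r powi (2 * n) * u * (r powi (4 - 2 * k) * lkp ?f (2 - k) - r powi (- 2 * k) * lkp ?f (- k))"
        unfolding l by (simp add: diff_divide_distrib right_diff_distrib mult_ac)
      finally show ?thesis .
    next
      case False
      then show ?thesis by (simp add: lookup_a_poly)
    qed
  qed
  moreover have "Poly_Mapping.keys ?f \<subseteq> (\<lambda>i. 2 * i - n) ` {0..n}"
    using keys_lscale keys_lpb unfolding a_poly_def by blast
  moreover have "lkp ?f (- n) = 1" using p_nonzero[OF n] by (simp add: lookup_a_poly)
  ultimately show ?thesis using n unfolding is_E_def E_eigenvalue_def
    by (fastforce simp: subset_iff)
qed

text \<open>The coefficient relation is of the same kind as for negative indices, with
  \<open>w_upper\<close> in the place of \<open>w_lower\<close>. The factor p (i - 1) is zero at i =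
  0; this removes the exponent -n, which the leading term condition forbids for positive n.\<close>

lemma is_E_pos:
  assumes n: "n > 0"
  shows "is_E r u n (lscale (1 / p (n - 1)) (b_poly n))"
proof -
  let ?f = "lscale (1 / p (n - 1)) (b_poly n)"
  have "op_Y r u ?f = lscale (r powi (- 2 * n) * inverse u) ?f"
  proof (rule op_Y_eigenI[OF r_nonzero])
    fix k
    show "u * (lkp ?f (2 - k) - lkp ?f (- k)) + (u - inverse u) * (lkp ?f (- k) - lkp ?f k) =
      r powi (- 2 * n) * inverse u * (r powi (4 - 2 * k) * lkp ?f (2 - k) - r powi (- 2 * k) * lkp ?f (- k))"
    proof (cases "even (k + n)")
      case True
      then obtain i where i: "k = 2 * i - n" by (metis evenE add_diff_cancel_right')
      define j where "j = n - i"
      have k: "(k + n) div 2 = i" "(2 - k + n) div 2 = j + 1" "(- k + n) div 2 = j"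
        "n - i = j" "n - (j + 1) = i - 1" "n - j = i" by (auto simp: i j_def)
      have ev: "even (2 - k + n)" "even (- k + n)" "even (k + n)" using True by auto
      have e: "r powi (- 2 * n) * r powi (4 - 2 * k) = q powi (1 - i)" "r powi (- 2 * n) * r powi (- 2 * k) = q powi (- i)"
        by (simp_all add: r_nonzero flip: power_int_add r_powi) (simp_all add: i algebra_simps)
      let ?A = "q powi (i - 1) * w (i - 1) * p j" and ?B = "q powi i * w i * p (j - 1)" and ?C = "q powi j * w j * p (i - 1)"
      have qi: "q powi (1 - i) * q powi (i - 1) = 1" "q powi (- i) * q powi i = 1"
        using q_nonzero by (simp_all flip: power_int_add)
      have R1: "(1 - q powi i) * w i = (1 - t * q powi (i - 1)) * w (i - 1)" by (rule w_rec)
      have "(1 - q powi i) * w i * p (j - 1) = (1 - t * q powi (i - 1)) * w (i - 1) * p (j - 1)"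
        by (simp only: R1)
      moreover have "(1 - t) * ?C = (1 - t * q powi (i - 1)) * w (i - 1) * (p j - p (j - 1))"
        using p_w[of "i - 1"] w_upper[of j] by (metis mult.assoc mult.commute)
      ultimately have "t * (?A - ?B) + (t - 1) * (?B - ?C) = w (i - 1) * p j - w i * p (j - 1)"
        by algebra
      also have "\<dots> = q powi (1 - i) * ?A - q powi (- i) * ?B"
        using qi by (simp only: mult.assoc[symmetric]) simp
      finally have eq: "t * (?A - ?B) + (t - 1) * (?B - ?C) = q powi (1 - i) * ?A - q powi (- i) * ?B" .
      have "u * inverse u = 1" using u_nonzero by simp
      then have "u * (u * (?A - ?B) + (u - inverse u) * (?B - ?C)) =
          u * (inverse u * (q powi (1 - i) * ?A - q powi (- i) * ?B))"
        using eq t_eq by algebra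
      then have *: "u * (?A - ?B) + (u - inverse u) * (?B - ?C) = inverse u * (q powi (1 - i) * ?A - q powi (- i) * ?B)"
        using u_nonzero by simp
      have l: "lkp ?f (2 - k) = ?A / p (n - 1)" "lkp ?f (- k) = ?B / p (n - 1)" "lkp ?f k = ?C / p (n - 1)"
        using ev by (simp_all only: lookup_lscale lookup_b_poly k if_True) simp_all
      have "u * (lkp ?f (2 - k) - lkp ?f (- k)) + (u - inverse u) * (lkp ?f (- k) - lkp ?f k) =
         (u * (?A - ?B) + (u - inverse u) * (?B - ?C)) / p (n - 1)"
        unfolding l by (simp add: diff_divide_distrib add_divide_distrib right_diff_distrib)
      also have "\<dots> = (inverse u * ((r powi (- 2 * n) * r powi (4 - 2 * k)) * ?A - (r powi (- 2 * n) * r powi (- 2 * k)) * ?B)) / p (n - 1)"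
        unfolding * e ..
      also have "\<dots> = r powi (- 2 * n) * inverse u * (r powi (4 - 2 * k) * lkp ?f (2 - k) - r powi (- 2 * k) * lkp ?f (- k))"
        unfolding l by (simp add: diff_divide_distrib right_diff_distrib mult_ac)
      finally show ?thesis .
    next
      case False
      then show ?thesis by (simp add: lookup_b_poly)
    qed
  qed
  moreover have "Poly_Mapping.keys ?f \<subseteq> (\<lambda>i. 2 * i - n) ` {1..n}"
  proof -
    have sub: "Poly_Mapping.keys ?f \<subseteq> (\<lambda>i. 2 * i - n) ` {0..n}"
      using keys_lscale keys_lpb unfolding b_poly_def by blast
    have "- n \<notin> Poly_Mapping.keys ?f" by (simp add: in_keys_iff lookup_b_poly)
    then have "Poly_Mapping.keys ?f \<subseteq> (\<lambda>i. 2 * i - n) ` {0..n} - {- n}" using sub by blast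
    also have "\<dots> \<subseteq> (\<lambda>i. 2 * i - n) ` ({0..n} - {0})" by auto
    also have "{0..n} - {0} = {1..n}" by auto
    finally show ?thesis .
  qed
  moreover have "lkp ?f n = 1" using p_nonzero[of "n - 1"] n by (simp add: lookup_b_poly)
  ultimately show ?thesis using n unfolding is_E_def E_eigenvalue_def
    by (fastforce simp: subset_iff)
qed

end

lemma macdonald_params_inverse:
  assumes "macdonald_params r u q t"
  shows "macdonald_params (inverse r) (inverse u) (inverse q) (inverse t)"
proof -
  interpret macdonald_params r u q t by fact
  show ?thesis
  proof
    fix k :: nat assume k: "k > 0"
    show "inverse q ^ k \<noteq> 1" using q_power[OF k] by (metis inverse_eq_1_iff power_inverse)
    show "inverse t * inverse q ^ k \<noteq> 1"
      using tq_power[OF k] by (metis inverse_eq_1_iff inverse_mult_distrib power_inverse)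
  qed (simp_all add: q_eq t_eq power_inverse r_nonzero u_nonzero)
qed

text \<open>If t q^k = 1, the eigenvalues belonging to k and -k coincide. Then the sum of E_(-k) and
  E_k has all defining properties of E_(-k), against the uniqueness contained in
  \<open>generic\<close>.\<close>

lemma generic_imp_params:
  assumes gen: "generic r u" and q: "q = r ^ 4" "q \<noteq> 0" "norm q < 1" and t: "t = u ^ 2" "t \<noteq> 0"
  shows "macdonald_params r u q t"
proof
  show "q ^ k \<noteq> 1" if "k > 0" for k
    using that q(3) by (metis less_irrefl norm_one norm_power power_less_one_iff norm_ge_zero zero_less_iff_neq_zero)
  show "t * q ^ k \<noteq> 1" if k: "k > 0" for k
  proof
    assume tq: "t * q ^ k = 1"
    have u: "u \<noteq> 0" and r: "r \<noteq> 0" using q t by auto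
    have ex: "\<exists>!f. is_E r u n f" for n using gen by (simp add: generic_def)
    obtain f where f: "is_E r u (int k) f" using ex by blast
    obtain g where g: "is_E r u (- int k) g" using ex by blast
    \<comment> \<open>The quotient of the two eigenvalues r^(2k) u and r^(-2k) / u is t q^k.\<close>
    have "u * u * (r powi (2 * int k) * r powi (2 * int k)) = 1"
    proof -
      have "r powi (2 * int k) * r powi (2 * int k) = r powi int (4 * k)"
        using r by (simp flip: power_int_add)
      also have "\<dots> = q ^ k" unfolding power_int_of_nat q by (simp add: power_mult)
      finally show ?thesis using tq by (simp add: t power2_eq_square)
    qed
    then have "r powi (2 * int k) * u = r powi (- 2 * int k) * inverse u"
      using u r by (simp add: power_int_minus field_simps)
    then have lam: "E_eigenvalue r u (- int k) = E_eigenvalue r u (int k)"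
      using k by (simp add: E_eigenvalue_def)
    have keys: "m = int k \<or> \<bar>m\<bar> < int k" if "m \<in> Poly_Mapping.keys f" for m
      using f that by (auto simp: is_E_def)
    then have fk: "lkp f (- int k) = 0" using k by (force simp: in_keys_iff)
    have "is_E r u (- int k) (g + f)"
      unfolding is_E_def
    proof (intro conjI ballI)
      show "op_Y r u (g + f) = lscale (E_eigenvalue r u (- int k)) (g + f)"
        using f g lam by (simp add: is_E_def op_Y_add lscale_add)
      show "lkp (g + f) (- int k) = 1" using g fk by (simp add: is_E_def lookup_add)
      fix m assume "m \<in> Poly_Mapping.keys (g + f)"
      then have "m \<in> Poly_Mapping.keys g \<or> m \<in> Poly_Mapping.keys f" using keys_add[of g f] by auto
      then show "m = - int k \<or> \<bar>m\<bar> < \<bar>- int k\<bar> \<or> - int k < 0 \<and> m = \<bar>- int k\<bar>"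
        using g keys[of m] k by (fastforce simp: is_E_def)
    qed
    then have "g + f = g" using g ex by blast
    then have "f = 0" by simp
    then show False using f by (simp add: is_E_def)
  qed
qed (use assms in auto)

section \<open>The polynomials E_n and their conjugates\<close>

locale generic_params = macdonald_params +
  assumes gen: "generic r u"
begin

lemma E_poly_eqI: "is_E r u n f \<Longrightarrow> E_poly r u n = f"
  using gen unfolding E_poly_def generic_def by (intro the1_equality) simp_all

lemma E_poly_inverse_eqI: "is_E (inverse r) (inverse u) n f \<Longrightarrow> E_poly (inverse r) (inverse u) n = f"
  using gen unfolding E_poly_def generic_def by (intro the1_equality) simp_all

lemma E_poly_neg: "n \<ge> 0 \<Longrightarrow> E_poly r u (- n) = lscale (1 / p n) (a_poly n)"
  by (intro E_poly_eqI is_E_neg)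

lemma E_poly_pos: "n > 0 \<Longrightarrow> E_poly r u n = lscale (1 / p (n - 1)) (b_poly n)"
  by (intro E_poly_eqI is_E_pos)

text \<open>Up to the factor \<open>X\<close>, conjugation interchanges the indices \<open>- n\<close> and \<open>n + 1\<close>.\<close>

lemma E_star_neg:
  assumes n: "n \<ge> 0"
  shows "E_star r u (- n) = lmono (- 1) * E_poly r u (n + 1)"
proof -
  interpret inv: macdonald_params "inverse r" "inverse u" "inverse q" "inverse t"
    by (rule macdonald_params_inverse) unfold_locales
  show ?thesis
    unfolding E_star_def E_poly_inverse_eqI[OF inv.is_E_neg[OF n]]
  proof (rule poly_mapping_eqI)
    fix k
    show "lkp (op_s (lscale (1 / inv.p n) (inv.a_poly n))) k = lkp (lmono (- 1) * E_poly r u (n + 1)) k"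
    proof (cases "even (k + n)")
      case True
      then obtain i where i: "k = 2 * i - n" by (metis evenE add_diff_cancel_right')
      define j where "j = n - i"
      have k: "(- k + n) div 2 = j" "n - j = i" "(k + 1 + (n + 1)) div 2 = i + 1"
        "n + 1 - (i + 1) = j" "i + 1 - 1 = i" "n + 1 - 1 = n" "k - - 1 = k + 1"
        by (auto simp: i j_def)
      have ev: "even (- k + n)" "even (k + 1 + (n + 1))" using True by auto
      \<comment> \<open>Inverting the parameters multiplies w j by (q/t)^j, p i by t^-i and p n by
        t^-n. Since n = i + j, the powers of t cancel and exactly the weight q^j of
        \<open>b_poly\<close> remains.\<close>
      have "inv.w j * inv.p i / inv.p n = q powi j * w j * p i / p n"
      proof (cases "0 \<le> i \<and> 0 \<le> j")
        case True
        have n: "n = i + j" by (simp add: j_def)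
        have "inv.w j = (q / t) powi j * w j" "inv.p i = t powi (- i) * p i" "inv.p n = t powi (- n) * p n"
          using True n by (simp_all add: wq_inverse1 wq_inverse2)
        moreover have "(q / t) powi j = q powi j * t powi (- j)" "t powi (- n) = t powi (- i) * t powi (- j)"
          using t_nonzero power_int_add[of t "- i" "- j"]
          by (simp_all add: n power_int_divide_distrib power_int_minus_divide)
        ultimately show ?thesis using t_nonzero by simp
      qed auto
      then show ?thesis
        unfolding E_poly_pos[of "n + 1", OF order.strict_trans2[OF zero_less_one], OF add_increasing[OF n order.refl]]
          lookup_lmono_mult lookup_op_s lookup_lscale inv.lookup_a_poly lookup_b_poly k if_P[OF ev(1)] if_P[OF ev(2)]
        by simp
    next
      case False
      then have "odd (- k + n)" "odd (k + 1 + (n + 1))" by auto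
      then show ?thesis
        unfolding E_poly_pos[of "n + 1", OF order.strict_trans2[OF zero_less_one], OF add_increasing[OF n order.refl]]
          lookup_lmono_mult lookup_op_s lookup_lscale inv.lookup_a_poly lookup_b_poly
        by simp
    qed
  qed
qed

lemma E_star_pos:
  assumes n: "n \<ge> 0"
  shows "E_star r u (n + 1) = lmono (- 1) * E_poly r u (- n)"
proof -
  interpret inv: macdonald_params "inverse r" "inverse u" "inverse q" "inverse t"
    by (rule macdonald_params_inverse) unfold_locales
  have n1: "n + 1 > 0" using n by simp
  show ?thesis
    unfolding E_star_def E_poly_inverse_eqI[OF inv.is_E_pos[OF n1]]
  proof (rule poly_mapping_eqI)
    fix k
    show "lkp (op_s (lscale (1 / inv.p (n + 1 - 1)) (inv.b_poly (n + 1)))) k = lkp (lmono (- 1) * E_poly r u (- n)) k"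
    proof (cases "even (k + 1 + n)")
      case True
      then obtain i where i: "k + 1 = 2 * i - n" by (metis evenE add_diff_cancel_right')
      define j where "j = n - i"
      have k: "(- k + (n + 1)) div 2 = j + 1" "n + 1 - (j + 1) = i" "j + 1 - 1 = j" "(k + 1 + n) div 2 = i"
        "n - i = j" "n + 1 - 1 = n" "k - - 1 = k + 1"
        using i by (auto simp: j_def)
      have ev: "even (- k + (n + 1))" "even (k + 1 + n)" using True by auto
      have "inverse q powi i * inv.w i * inv.p j / inv.p n = w i * p j / p n"
      proof (cases "0 \<le> i \<and> 0 \<le> j")
        case True
        have n: "n = i + j" by (simp add: j_def)
        have "inv.w i = (q / t) powi i * w i" "inv.p j = t powi (- j) * p j" "inv.p n = t powi (- n) * p n"
          using True n by (simp_all add: wq_inverse1 wq_inverse2)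
        moreover have "(q / t) powi i = q powi i * t powi (- i)" "t powi (- n) = t powi (- i) * t powi (- j)"
          using t_nonzero power_int_add[of t "- i" "- j"]
          by (simp_all add: n power_int_divide_distrib power_int_minus_divide)
        ultimately show ?thesis using t_nonzero q_nonzero by (simp add: power_int_inverse)
      qed auto
      then show ?thesis
        unfolding E_poly_neg[OF n]
          lookup_lmono_mult lookup_op_s lookup_lscale inv.lookup_b_poly lookup_a_poly k if_P[OF ev(1)] if_P[OF ev(2)]
        by simp
    next
      case False
      then have "odd (- k + (n + 1))" "odd (k + 1 + n)" by auto
      then show ?thesis
        unfolding E_poly_neg[OF n]
          lookup_lmono_mult lookup_op_s lookup_lscale inv.lookup_b_poly lookup_a_poly
        by simp
    qed
  qed
qed

end

section \<open>Evaluation of Laurent polynomials\<close>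

lemma leval_eq_sum:
  assumes "finite K" "Poly_Mapping.keys f \<subseteq> K"
  shows "leval f x = (\<Sum>m\<in>K. lkp f m * x powi m)"
  unfolding leval_def by (rule sum.mono_neutral_left) (use assms in \<open>auto simp: in_keys_iff\<close>)

lemma leval_add: "leval (f + g) x = leval f x + leval g x"
proof -
  let ?K = "Poly_Mapping.keys f \<union> Poly_Mapping.keys g"
  show ?thesis
    by (subst (1 2 3) leval_eq_sum[of ?K]) (auto simp: keys_add lookup_add algebra_simps sum.distrib)
qed

lemma leval_lscale: "leval (lscale c f) x = c * leval f x"
  by (subst (1 2) leval_eq_sum[of "Poly_Mapping.keys f"]) (auto simp: keys_lscale sum_distrib_left mult.assoc)

lemma leval_sum_single: "finite A \<Longrightarrow> leval (\<Sum>i\<in>A. Poly_Mapping.single (e i) (h i)) x = (\<Sum>i\<in>A. h i * x powi e i)"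
proof (induction rule: finite_induct)
  case empty
  then show ?case by (simp add: leval_def)
next
  case (insert i A)
  have "leval (Poly_Mapping.single (e i) (h i)) x = h i * x powi e i"
    by (subst leval_eq_sum[of "{e i}"]) auto
  then show ?case using insert by (simp add: leval_add)
qed

lemma leval_lpb: "leval (lpb n h) x = (\<Sum>i\<in>{0..n}. h i * x powi (2 * i - n))"
  unfolding lpb_def by (rule leval_sum_single) simp

lemma leval_lmono_mult:
  assumes "x \<noteq> 0"
  shows "leval (lmono k * f) x = x powi k * leval f x"
proof -
  have "lmono k * f = (\<Sum>m\<in>Poly_Mapping.keys f. Poly_Mapping.single (k + m) (lkp f m))"
    by (subst lpoly_eq_sum_single[of f]) (simp add: sum_distrib_left mult_single)
  then show ?thesis using assms
    by (simp only: leval_sum_single finite_keys)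
      (simp add: leval_def sum_distrib_left power_int_add mult_ac)
qed

subsection \<open>The coefficients of $\mu$\<close>

text \<open>The infinite product is formed in power series in q over Laurent series in X; constant
  terms need the other order, a power series in q for each fixed exponent of X.\<close>

definition mu_slice :: "int \<Rightarrow> complex fls fps \<Rightarrow> complex fps" where
  "mu_slice m f = Abs_fps (\<lambda>N. fls_nth (fps_nth f N) m)"

lemma mu_slice_nth [simp]: "fps_nth (mu_slice m f) N = fls_nth (fps_nth f N) m"
  by (simp add: mu_slice_def)

lemma mu_slice_diff: "mu_slice m (f - g) = mu_slice m f - mu_slice m g"
  by (rule fps_ext) simp

lemma mu_slice_eqI: "(\<And>m. mu_slice m f = mu_slice m g) \<Longrightarrow> f = g"
  by (metis fps_ext fls_eqI mu_slice_nth)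

lemma mu_slice_q_power: "mu_slice m (mu_q ^ j * f) = fps_X ^ j * mu_slice m f"
  by (rule fps_ext) (simp add: mu_q_def fps_X_power_mult_nth)

lemma mu_slice_C: "mu_slice m (mu_C c * f) = fps_const c * mu_slice m f"
  by (rule fps_ext) (simp add: mu_C_def)

lemma mu_slice_X: "mu_slice m (mu_X k * f) = mu_slice (m - k) f"
  by (rule fps_ext) (simp add: mu_X_def fls_X_intpow_times_conv_shift)

text \<open>The coefficients of the q-binomial series \<open>(x; q)\<^sub>\<infinity> / (t x; q)\<^sub>\<infinity>\<close>.\<close>

definition mu_a :: "complex \<Rightarrow> nat \<Rightarrow> complex fps" where
  "mu_a t k = (\<Prod>s<k. (fps_const t - fps_X ^ s) * inverse (1 - fps_X ^ Suc s))"

lemma mu_a_0 [simp]: "mu_a t 0 = 1"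
  by (simp add: mu_a_def)

lemma mu_a_rec: "mu_a t (Suc k) * (1 - fps_X ^ Suc k) = mu_a t k * (fps_const t - fps_X ^ k)"
proof -
  have "inverse (1 - fps_X ^ Suc k) * (1 - fps_X ^ Suc k :: complex fps) = 1"
    by (rule inverse_mult_eq_1) simp
  then show ?thesis by (simp add: mu_a_def mult.assoc del: power_Suc)
qed

text \<open>For \<open>e = 2\<close> this is the expansion of the factors of \<open>\<mu>\<close> with index at least \<open>j\<close> that contain
  \<open>X\<^sup>2\<close>, for \<open>e = -2\<close> that of the factors with \<open>q ^ j X\<^sup>-\<^sup>2\<close>.\<close>

definition mu_half :: "complex \<Rightarrow> int \<Rightarrow> nat \<Rightarrow> complex fls fps" where
  "mu_half t e j = Abs_fps (\<lambda>N. Abs_fls (\<lambda>m. if e dvd m \<and> m div e \<ge> 0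
     then fps_nth (fps_X ^ (j * nat (m div e)) * mu_a t (nat (m div e))) N else 0))"

text \<open>For e = -2 the condition j > 0 makes the coefficient of each q^N a Laurent series:
  X^(-2k) carries at least q^k, so no exponent below -2N occurs. Without this bound
  \<open>Abs_fls\<close> would not return the given coefficients.\<close>

lemma mu_slice_half:
  assumes "e = 2 \<or> (e = -2 \<and> j > 0)"
  shows "mu_slice m (mu_half t e j) =
    (if e dvd m \<and> m div e \<ge> 0 then fps_X ^ (j * nat (m div e)) * mu_a t (nat (m div e)) else 0)"
proof (rule fps_ext)
  fix N
  have "fls_nth (Abs_fls (\<lambda>m. if e dvd m \<and> m div e \<ge> 0
     then fps_nth (fps_X ^ (j * nat (m div e)) * mu_a t (nat (m div e))) N else 0)) m =
     (if e dvd m \<and> m div e \<ge> 0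
     then fps_nth (fps_X ^ (j * nat (m div e)) * mu_a t (nat (m div e))) N else 0)"
  proof (rule nth_Abs_fls_lower_bound[of "- 2 * int N"], intro allI impI)
    fix n :: int assume n: "n < - 2 * int N"
    show "(if e dvd n \<and> n div e \<ge> 0
     then fps_nth (fps_X ^ (j * nat (n div e)) * mu_a t (nat (n div e))) N else 0) = 0"
    proof (cases "e = 2")
      case True
      then have "\<not> n div e \<ge> 0" using n by auto
      then show ?thesis by simp
    next
      case False
      then have e: "e = -2" "j > 0" using assms by auto
      have "fps_nth (fps_X ^ (j * nat (n div e)) * mu_a t (nat (n div e))) N = 0" if "e dvd n"
      proof -
        obtain k where "n = e * k" using \<open>e dvd n\<close> by (rule dvdE)
        then have k: "n = -2 * k" using e by simp
        then have "N < nat (n div e)" using n e by simp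
        also have "\<dots> \<le> j * nat (n div e)" using e(2) by simp
        finally show ?thesis by (simp add: fps_X_power_mult_nth)
      qed
      then show ?thesis by simp
    qed
  qed
  then show "fps_nth (mu_slice m (mu_half t e j)) N =
    fps_nth (if e dvd m \<and> m div e \<ge> 0 then fps_X ^ (j * nat (m div e)) * mu_a t (nat (m div e)) else 0) N"
    by (simp add: mu_half_def)
qed

text \<open>This is the functional equation (1 - t y) F(y) = (1 - y) F(q y) of F(y) = (y;
  q)\<infinity> / (t y; q)\<infinity>, read at y = q^j X^e. Coefficientwise it is
  \<open>mu_a_rec\<close>.\<close>

lemma mu_half_shift:
  assumes e: "e = 2 \<or> (e = -2 \<and> j > 0)"
  shows "(1 - mu_C t * mu_q ^ j * mu_X e) * mu_half t e j = (1 - mu_q ^ j * mu_X e) * mu_half t e (Suc j)"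
proof (rule mu_slice_eqI)
  fix m
  have e': "e = 2 \<or> (e = -2 \<and> Suc j > 0)" and e0: "e \<noteq> 0" using e by auto
  have eq: "mu_slice m (mu_half t e j) - fps_const t * (fps_X ^ j * mu_slice (m - e) (mu_half t e j)) =
     mu_slice m (mu_half t e (Suc j)) - fps_X ^ j * mu_slice (m - e) (mu_half t e (Suc j))"
  proof (cases "e dvd m \<and> m div e \<ge> 0")
    case False
    have "\<not> (e dvd (m - e) \<and> (m - e) div e \<ge> 0)"
    proof
      assume *: "e dvd (m - e) \<and> (m - e) div e \<ge> 0"
      then have "e dvd m" using dvd_add[of e "m - e" e] by simp
      then obtain k where k: "m = e * k" by (rule dvdE)
      then have "m - e = e * (k - 1)" by (simp add: algebra_simps)
      then have "k - 1 \<ge> 0" "m div e = k" using * k e0 by simp_all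
      then show False using False \<open>e dvd m\<close> by auto
    qed
    then show ?thesis using False by (simp only: mu_slice_half[OF e] mu_slice_half[OF e'] if_False) simp
  next
    case True
    then obtain k where m: "m = e * int k" using e0 by (metis dvdE nonneg_int_cases nonzero_mult_div_cancel_left)
    show ?thesis
    proof (cases k)
      case 0
      have "m - e = e * (- 1)" using m 0 by simp
      then have "(m - e) div e = - 1" using e0 nonzero_mult_div_cancel_left[of e "- 1"] by simp
      then show ?thesis using m 0 by (simp add: mu_slice_half[OF e] mu_slice_half[OF e'])
    next
      case (Suc l)
      have me: "m - e = e * int l" by (simp add: m Suc algebra_simps)
      have "mu_a t (Suc l) - fps_const t * mu_a t l = fps_X ^ Suc l * mu_a t (Suc l) - fps_X ^ l * mu_a t l"
        using mu_a_rec[of t l] by (simp add: algebra_simps)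
      then have "fps_X ^ (j * Suc l) * (mu_a t (Suc l) - fps_const t * mu_a t l) =
          fps_X ^ (j * Suc l) * (fps_X ^ Suc l * mu_a t (Suc l) - fps_X ^ l * mu_a t l)" by simp
      then show ?thesis unfolding mu_slice_half[OF e] mu_slice_half[OF e'] me unfolding m using e0
        by (simp add: Suc nat_add_distrib algebra_simps power_add)
    qed
  qed
  have C: "mu_slice m ((1 - mu_C t * mu_q ^ j * mu_X e) * f) =
    mu_slice m f - fps_const t * (fps_X ^ j * mu_slice (m - e) f)" for f
    by (simp only: left_diff_distrib mu_slice_diff mult.assoc mu_slice_C mu_slice_q_power mu_slice_X) simp
  have D: "mu_slice m ((1 - mu_q ^ j * mu_X e) * f) = mu_slice m f - fps_X ^ j * mu_slice (m - e) f" for f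
    by (simp only: left_diff_distrib mu_slice_diff mult.assoc mu_slice_q_power mu_slice_X) simp
  show "mu_slice m ((1 - mu_C t * mu_q ^ j * mu_X e) * mu_half t e j) =
     mu_slice m ((1 - mu_q ^ j * mu_X e) * mu_half t e (Suc j))"
    unfolding C D by (rule eq)
qed

text \<open>The expected value of the product of all factors of index at least j, written down by
  its expansion before any convergence is known.\<close>

definition mu_tail :: "complex \<Rightarrow> nat \<Rightarrow> complex fls fps" where
  "mu_tail t j = mu_half t 2 j * mu_half t (-2) (Suc j)"

lemma mu_factor_tail: "mu_factor t j * mu_tail t (Suc j) = mu_tail t j"
proof -
  define D where "D = (1 - mu_C t * mu_q ^ j * mu_X 2) * (1 - mu_C t * mu_q ^ (j + 1) * mu_X (- 2))"
  define N where "N = (1 - mu_q ^ j * mu_X 2) * (1 - mu_q ^ (j + 1) * mu_X (- 2))"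
  \<comment> \<open>Formal Laurent series form a field, so a nonzero coefficient of q^0 is enough to
    make the denominator D a unit.\<close>
  have "fls_nth (fps_nth D 0) 0 = 1"
    by (cases j) (simp_all add: D_def mu_C_def mu_q_def mu_X_def fps_mult_nth_0 mult.assoc)
  then have D0: "fps_nth D 0 \<noteq> 0" by auto
  then have "mu_factor t j * D = N"
    unfolding mu_factor_def D_def[symmetric] N_def[symmetric]
    by (simp add: fps_divide_unit mult.assoc inverse_mult_eq_1)
  then have "D * (mu_factor t j * mu_tail t (Suc j)) = N * mu_tail t (Suc j)"
    by (simp add: mult_ac)
  also have "\<dots> = ((1 - mu_q ^ j * mu_X 2) * mu_half t 2 (Suc j)) *
      ((1 - mu_q ^ Suc j * mu_X (-2)) * mu_half t (-2) (Suc (Suc j)))"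
    by (simp add: N_def mu_tail_def mult_ac)
  also have "\<dots> = ((1 - mu_C t * mu_q ^ j * mu_X 2) * mu_half t 2 j) *
      ((1 - mu_C t * mu_q ^ Suc j * mu_X (-2)) * mu_half t (-2) (Suc j))"
    by (simp only: mu_half_shift[of "2"] mu_half_shift[of "-2" "Suc j"] simp_thms zero_less_Suc)
  also have "\<dots> = D * mu_tail t j"
    by (simp add: D_def mu_tail_def mult_ac)
  finally show ?thesis using D0 by auto
qed

text \<open>The power X^(e k) comes with q^(j k), so modulo q^j only the constant 1 is left.\<close>

lemma mu_half_nth:
  assumes e: "e = 2 \<or> (e = -2 \<and> j > 0)" and N: "N < j"
  shows "fps_nth (mu_half t e j) N = (if N = 0 then 1 else 0)"
proof (rule fls_eqI)
  fix m
  have "fls_nth (fps_nth (mu_half t e j) N) m = fps_nth (mu_slice m (mu_half t e j)) N" by simp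
  also have "\<dots> = (if m = 0 \<and> N = 0 then 1 else 0)"
  proof (cases "e dvd m \<and> m div e \<ge> 0")
    case True
    then obtain k where m: "m = e * int k" using e by (metis dvdE nonneg_int_cases nonzero_mult_div_cancel_left zero_neq_numeral neg_equal_0_iff_equal)
    have "nat (m div e) = k" using m e by auto
    show ?thesis
    proof (cases k)
      case 0
      then show ?thesis using m by (simp add: mu_slice_half[OF e])
    next
      case (Suc l)
      then have "m \<noteq> 0" "N < j * k" using m e N by auto
      then show ?thesis using True \<open>nat (m div e) = k\<close>
        by (simp add: mu_slice_half[OF e] fps_X_power_mult_nth)
    qed
  next
    case False
    then have "m \<noteq> 0" by auto
    then show ?thesis using False by (subst mu_slice_half[OF e], subst if_not_P[OF False]) simp
  qed
  finally show "fls_nth (fps_nth (mu_half t e j) N) m = fls_nth (if N = 0 then 1 else 0) m"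
    by simp
qed

lemma mu_tail_nth:
  assumes "N < j"
  shows "fps_nth (mu_tail t j) N = (if N = 0 then 1 else 0)"
proof -
  have "fps_nth (mu_tail t j) N = (\<Sum>i=0..N. (if i = 0 then 1 else 0) * (if N - i = 0 then 1 else 0))"
    unfolding mu_tail_def fps_mult_nth
    by (rule sum.cong) (use assms in \<open>auto simp: mu_half_nth\<close>)
  also have "\<dots> = (if N = 0 then 1 else 0)" by (auto simp: sum.atLeast_Suc_atMost)
  finally show ?thesis .
qed

lemma mu_tail_prod: "(\<Prod>i<j. mu_factor t i) * mu_tail t j = mu_tail t 0"
  by (induction j) (simp_all add: mult.assoc mu_factor_tail)

lemma mu_slice_0_tail_nth_0: "fps_nth (mu_slice 0 (mu_tail t 0)) 0 = 1"
proof -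
  have "fls_nth (fps_nth (mu_half t 2 0) 0) 0 = fps_nth (mu_slice 0 (mu_half t 2 0)) 0" by simp
  also have "\<dots> = 1" by (subst mu_slice_half) auto
  finally show ?thesis by (simp add: mu_tail_def mu_half_nth fps_mult_nth_0)
qed

text \<open>The factor left over after n + 1 steps is 1 modulo q^(n+1), so every coefficient of the
  partial products becomes stationary. The limit must also be shown nonzero, as
  \<open>has_prod\<close> demands.\<close>

lemma mu_eq_tail: "mu t = mu_tail t 0"
proof -
  have nz: "mu_tail t 0 \<noteq> 0" using mu_slice_0_tail_nth_0[of t] by auto
  have "(\<lambda>n. \<Prod>i\<le>n. mu_factor t i) \<longlonglongrightarrow> mu_tail t 0"
  proof (rule tendsto_fpsI)
    fix N
    have "fps_nth (\<Prod>i\<le>n. mu_factor t i) N = fps_nth (mu_tail t 0) N" if "n \<ge> N" for n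
    proof -
      have "fps_nth (mu_tail t 0) N = fps_nth ((\<Prod>i<Suc n. mu_factor t i) * mu_tail t (Suc n)) N"
        by (simp only: mu_tail_prod)
      also have "\<dots> = (\<Sum>i=0..N. fps_nth (\<Prod>i<Suc n. mu_factor t i) i * fps_nth (mu_tail t (Suc n)) (N - i))"
        by (rule fps_mult_nth)
      also have "\<dots> = (\<Sum>i=0..N. if i = N then fps_nth (\<Prod>i<Suc n. mu_factor t i) i else 0)"
        by (rule sum.cong) (use that in \<open>auto simp: mu_tail_nth\<close>)
      also have "\<dots> = fps_nth (\<Prod>i<Suc n. mu_factor t i) N" by simp
      finally show ?thesis by (simp only: lessThan_Suc_atMost)
    qed
    then show "\<forall>\<^sub>F n in sequentially. fps_nth (\<Prod>i\<le>n. mu_factor t i) N = fps_nth (mu_tail t 0) N"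
      by (auto simp: eventually_sequentially)
  qed
  then have "mu_factor t has_prod mu_tail t 0" using nz by (simp add: has_prod_def raw_has_prod_def)
  then show ?thesis unfolding mu_def by (rule has_prod_unique[symmetric])
qed

text \<open>A finite part of the convolution of the expansions in X^2 and in q X^-2, taken at
  X^(2m). The full sum over k converges only q-adically; the cut at M leaves the coefficients up to
  q^M exact and allows ordinary telescoping.\<close>

definition mu_trunc :: "complex \<Rightarrow> int \<Rightarrow> nat \<Rightarrow> complex fps" where
  "mu_trunc t m M = (\<Sum>k\<le>M. (if m + int k \<ge> 0 then mu_a t (nat (m + int k)) else 0) * (fps_X ^ k * mu_a t k))"

lemma mu_coeff_nth:
  assumes "N \<le> M"
  shows "fps_nth (mu_coeff t (2 * m)) N = fps_nth (mu_trunc t m M) N"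
proof -
  let ?b = "\<lambda>k. fps_X ^ k * mu_a t k"
  have half: "fps_nth (mu_half t (-2) 1) l = (\<Sum>k\<le>M. fls_const (fps_nth (?b k) l) * fls_X_intpow (- 2 * int k))" if "l \<le> M" for l
  proof (rule fls_eqI)
    fix n
    have "fls_nth (fps_nth (mu_half t (-2) 1) l) n = fps_nth (mu_slice n (mu_half t (-2) 1)) l" by simp
    also have "\<dots> = (if even n \<and> n \<le> 0 then fps_nth (?b (nat (n div -2))) l else 0)"
      by (subst mu_slice_half) auto
    also have "\<dots> = (\<Sum>k\<le>M. fps_nth (?b k) l * (if n = - 2 * int k then 1 else 0))"
    proof (cases "even n \<and> n \<le> 0")
      case True
      define k where "k = nat (n div -2)"
      have n: "n = - 2 * int k" unfolding k_def using True by auto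
      have "(\<Sum>i\<le>M. fps_nth (?b i) l * (if n = - 2 * int i then 1 else 0)) = (\<Sum>i\<le>M. if i = k then fps_nth (?b i) l else 0)"
        by (rule sum.cong) (auto simp: n)
      also have "\<dots> = fps_nth (?b k) l" using that by (auto simp: fps_X_power_mult_nth)
      finally show ?thesis using True by (simp add: k_def)
    next
      case False
      have *: "n \<noteq> - (2 * int i)" for i using False by auto
      show ?thesis by (subst if_not_P[OF False]) (simp add: *)
    qed
    finally show "fls_nth (fps_nth (mu_half t (-2) 1) l) n = fls_nth (\<Sum>k\<le>M. fls_const (fps_nth (?b k) l) * fls_X_intpow (- 2 * int k)) n"
      by (simp add: fls_nth_sum eq_neg_iff_add_eq_0 if_distrib cong: if_cong)
  qed
  have sl: "mu_slice (2 * (m + int k)) (mu_half t 2 0) = (if m + int k \<ge> 0 then mu_a t (nat (m + int k)) else 0)" for k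
    by (subst mu_slice_half) auto
  have "fps_nth (mu_coeff t (2 * m)) N = fls_nth (\<Sum>i=0..N. fps_nth (mu_half t 2 0) i * fps_nth (mu_half t (-2) 1) (N - i)) (2 * m)"
    by (simp add: mu_coeff_def mu_eq_tail mu_tail_def fps_mult_nth)
  also have "\<dots> = (\<Sum>i=0..N. \<Sum>k\<le>M. fps_nth (?b k) (N - i) * fls_nth (fps_nth (mu_half t 2 0) i) (2 * (m + int k)))"
    unfolding fls_nth_sum
  proof (rule sum.cong[OF refl])
    fix i assume "i \<in> {0..N}"
    have "fps_nth (mu_half t 2 0) i * fps_nth (mu_half t (-2) 1) (N - i) =
      (\<Sum>k\<le>M. fls_const (fps_nth (?b k) (N - i)) * (fls_X_intpow (- 2 * int k) * fps_nth (mu_half t 2 0) i))"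
      using assms by (subst half) (simp_all add: sum_distrib_left mult_ac)
    moreover have "fls_shift (2 * int k) 1 * f = fls_shift (2 * int k) f" for k and f :: "complex fls"
      using fls_X_intpow_times_conv_shift(1)[of "- 2 * int k" f] by simp
    ultimately show "fls_nth (fps_nth (mu_half t 2 0) i * fps_nth (mu_half t (-2) 1) (N - i)) (2 * m) =
       (\<Sum>k\<le>M. fps_nth (?b k) (N - i) * fls_nth (fps_nth (mu_half t 2 0) i) (2 * (m + int k)))"
      by (simp add: fls_nth_sum distrib_left)
  qed
  also have "\<dots> = (\<Sum>k\<le>M. \<Sum>i=0..N. fps_nth (mu_slice (2 * (m + int k)) (mu_half t 2 0)) i * fps_nth (?b k) (N - i))"
    by (subst sum.swap) (simp add: mult.commute)
  also have "\<dots> = fps_nth (mu_trunc t m M) N"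
    by (simp only: mu_trunc_def fps_sum_nth sl fps_mult_nth[symmetric])
  finally show ?thesis .
qed

lemma fps_mult_nth_cong:
  assumes "\<And>i. i \<le> N \<Longrightarrow> fps_nth f i = fps_nth g i"
  shows "fps_nth (h * f) N = fps_nth (h * g) N"
  unfolding fps_mult_nth by (rule sum.cong) (use assms in auto)

text \<open>Creative telescoping with the certificate V. Its value at 0 is zero through 1 - q^0, and
  the remaining boundary value at M + 1 is divisible by q^(m + M + 1).\<close>

lemma mu_trunc_rec:
  "(1 - fps_const t * fps_X ^ Suc m) * mu_trunc t (int (Suc m)) M - (fps_const t - fps_X ^ m) * mu_trunc t (int m) M =
   - (fps_X ^ (m + Suc M) * ((1 - fps_X ^ Suc M) * mu_a t (m + Suc M) * mu_a t (Suc M)))"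
proof -
  define V where "V k = fps_X ^ m * mu_a t (m + k) * (1 - fps_X ^ k) * (fps_X ^ k * mu_a t k)" for k
  have "(1 - fps_const t * fps_X ^ Suc m) * mu_trunc t (int (Suc m)) M - (fps_const t - fps_X ^ m) * mu_trunc t (int m) M =
     (\<Sum>k\<le>M. (1 - fps_const t * fps_X ^ Suc m) * (mu_a t (Suc (m + k)) * (fps_X ^ k * mu_a t k)) -
        (fps_const t - fps_X ^ m) * (mu_a t (m + k) * (fps_X ^ k * mu_a t k)))"
    by (simp add: mu_trunc_def sum_distrib_left sum_subtractf nat_add_distrib)
  also have "\<dots> = (\<Sum>k\<le>M. V k - V (Suc k))"
  proof (rule sum.cong[OF refl])
    fix k
    have r1: "mu_a t (Suc (m + k)) - fps_X ^ Suc (m + k) * mu_a t (Suc (m + k)) = mu_a t (m + k) * (fps_const t - fps_X ^ (m + k))"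
      using mu_a_rec[of t "m + k"] by (simp add: algebra_simps)
    have r2: "mu_a t (Suc k) * (1 - fps_X ^ Suc k) = mu_a t k * (fps_const t - fps_X ^ k)" by (rule mu_a_rec)
    have "V (Suc k) = fps_X ^ m * mu_a t (Suc (m + k)) * (fps_X ^ Suc k * (mu_a t (Suc k) * (1 - fps_X ^ Suc k)))"
      by (simp only: V_def add_Suc_right mult_ac)
    also have "\<dots> = fps_X ^ m * mu_a t (Suc (m + k)) * (fps_X ^ Suc k * (mu_a t k * (fps_const t - fps_X ^ k)))"
      by (simp only: r2)
    finally have V: "V (Suc k) = fps_X ^ m * mu_a t (Suc (m + k)) * (fps_X ^ Suc k * (mu_a t k * (fps_const t - fps_X ^ k)))" .
    define A where "A = mu_a t (Suc (m + k))"
    define x :: "complex fps" where "x = fps_X ^ k"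
    define y :: "complex fps" where "y = fps_X ^ m"
    have "A - fps_X * y * x * A = mu_a t (m + k) * (fps_const t - y * x)"
      using r1 by (simp add: A_def x_def y_def power_add mult.assoc)
    moreover have "V (Suc k) = y * A * (fps_X * x * (mu_a t k * (fps_const t - x)))"
      by (simp only: V A_def x_def y_def power_Suc)
    moreover have "V k = y * mu_a t (m + k) * (1 - x) * (x * mu_a t k)" by (simp add: V_def x_def y_def)
    ultimately have "(1 - fps_const t * (fps_X * y)) * (A * (x * mu_a t k)) -
        (fps_const t - y) * (mu_a t (m + k) * (x * mu_a t k)) = V k - V (Suc k)"
      by algebra
    then show "(1 - fps_const t * fps_X ^ Suc m) * (mu_a t (Suc (m + k)) * (fps_X ^ k * mu_a t k)) -
        (fps_const t - fps_X ^ m) * (mu_a t (m + k) * (fps_X ^ k * mu_a t k)) = V k - V (Suc k)"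
      by (simp add: A_def x_def y_def)
  qed
  also have "\<dots> = V 0 - V (Suc M)" using sum_telescope[of V M] by simp
  also have "\<dots> = - (fps_X ^ (m + Suc M) * ((1 - fps_X ^ Suc M) * mu_a t (m + Suc M) * mu_a t (Suc M)))"
    by (simp add: V_def power_add mult_ac)
  finally show ?thesis .
qed

text \<open>The N-th coefficient is computed with the truncation at N; the boundary term of the
  truncated recurrence has order above N and does not reach it.\<close>

lemma mu_coeff_rec:
  "(1 - fps_const t * fps_X ^ Suc m) * mu_coeff t (2 * int (Suc m)) = (fps_const t - fps_X ^ m) * mu_coeff t (2 * int m)"
proof (rule fps_ext)
  fix N
  have "fps_nth ((1 - fps_const t * fps_X ^ Suc m) * mu_coeff t (2 * int (Suc m))) N -
      fps_nth ((fps_const t - fps_X ^ m) * mu_coeff t (2 * int m)) N =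
      fps_nth ((1 - fps_const t * fps_X ^ Suc m) * mu_trunc t (int (Suc m)) N -
        (fps_const t - fps_X ^ m) * mu_trunc t (int m) N) N"
    unfolding fps_sub_nth
    by (intro arg_cong2[of _ _ _ _ "(-)"] fps_mult_nth_cong mu_coeff_nth)
  also have "\<dots> = 0"
    unfolding mu_trunc_rec by (simp only: mult_minus_left fps_neg_nth fps_X_power_mult_nth) simp
  finally show "fps_nth ((1 - fps_const t * fps_X ^ Suc m) * mu_coeff t (2 * int (Suc m))) N =
      fps_nth ((fps_const t - fps_X ^ m) * mu_coeff t (2 * int m)) N" by simp
qed

text \<open>\<mu> is invariant under exchanging X^2 and q X^-2. In the convolution this symmetry is
  the shift of the summation index by m.\<close>

lemma mu_coeff_minus: "mu_coeff t (- 2 * int m) = fps_X ^ m * mu_coeff t (2 * int m)"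
proof (rule fps_ext)
  fix N
  have "mu_trunc t (- int m) (m + N) =
     (\<Sum>k\<le>m + N. if k < m then 0 else mu_a t (k - m) * (fps_X ^ k * mu_a t k))"
    unfolding mu_trunc_def by (rule sum.cong) (auto simp: nat_diff_distrib)
  also have "\<dots> = (\<Sum>k\<in>{m..m + N}. mu_a t (k - m) * (fps_X ^ k * mu_a t k))"
    by (rule sum.mono_neutral_cong_right) auto
  also have "\<dots> = (\<Sum>k\<le>N. mu_a t k * (fps_X ^ (k + m) * mu_a t (k + m)))"
    by (rule sum.reindex_bij_witness[of _ "\<lambda>k. k + m" "\<lambda>k. k - m"]) auto
  also have "\<dots> = fps_X ^ m * mu_trunc t (int m) N"
    by (simp add: mu_trunc_def sum_distrib_left power_add nat_add_distrib mult_ac add.commute)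
  finally have tr: "mu_trunc t (- int m) (m + N) = fps_X ^ m * mu_trunc t (int m) N" .
  have "fps_nth (mu_coeff t (- 2 * int m)) N = fps_nth (mu_trunc t (- int m) (m + N)) N"
    using mu_coeff_nth[of N "m + N" t "- int m"] by simp
  also have "\<dots> = fps_nth (fps_X ^ m * mu_coeff t (2 * int m)) N"
    unfolding tr by (rule fps_mult_nth_cong) (simp add: mu_coeff_nth)
  finally show "fps_nth (mu_coeff t (- 2 * int m)) N = fps_nth (fps_X ^ m * mu_coeff t (2 * int m)) N" .
qed

text \<open>Two fractions for the same series agree after cross multiplication as polynomials, since
  \<open>fps_of_poly\<close> is injective. The value at z therefore does not depend on the fraction
  chosen.\<close>

lemma rat_value_eqI:
  assumes "poly b z \<noteq> 0" "fps_of_poly b * F = fps_of_poly a"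
  shows "rat_value F z = poly a z / poly b z"
  unfolding rat_value_def
proof (rule the_equality)
  show "\<exists>a' b'. poly b' z \<noteq> 0 \<and> fps_of_poly b' * F = fps_of_poly a' \<and> poly a z / poly b z = poly a' z / poly b' z"
    using assms by blast
next
  fix v
  assume "\<exists>a' b'. poly b' z \<noteq> 0 \<and> fps_of_poly b' * F = fps_of_poly a' \<and> v = poly a' z / poly b' z"
  then obtain a' b' where *: "poly b' z \<noteq> 0" "fps_of_poly b' * F = fps_of_poly a'" "v = poly a' z / poly b' z" by blast
  have "fps_of_poly (a' * b) = fps_of_poly (a * b')"
    unfolding fps_of_poly_mult assms(2)[symmetric] *(2)[symmetric] by (simp add: mult_ac)
  then have "a' * b = a * b'" by (simp add: fps_of_poly_eq_iff)
  then have "poly a' z * poly b z = poly a z * poly b' z" by (metis poly_mult)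
  then show "v = poly a z / poly b z" unfolding *(3) using *(1) assms(1) by (simp add: frac_eq_eq)
qed

text \<open>The coefficient of X^(2m) in the normalized \<mu>, at numerical q; the extra power of q
  for negative m is the symmetry under X^2 -> q X^-2.\<close>

definition dmu :: "complex \<Rightarrow> complex \<Rightarrow> int \<Rightarrow> complex" where
  "dmu q t m = (if m < 0 then q ^ nat (- m) else 1) * (\<Prod>s<nat \<bar>m\<bar>. (t - q ^ s) / (1 - t * q ^ Suc s))"

text \<open>Iterating the first-order recurrence from the constant coefficient 1 exhibits numerator
  and denominator of the rational function as polynomials in the formal q.\<close>

lemma mu0_series_poly:
  "fps_of_poly (\<Prod>s<m. 1 - monom t (Suc s)) * mu0_series t (2 * int m) = fps_of_poly (\<Prod>s<m. [:t:] - monom 1 s)"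
proof (induction m)
  case 0
  have "fps_nth (mu_coeff t 0) 0 \<noteq> 0" using mu_slice_0_tail_nth_0 by (simp add: mu_coeff_def mu_eq_tail)
  then show ?case by (simp add: mu0_series_def fps_divide_unit inverse_mult_eq_1')
next
  case (Suc m)
  have u: "fps_nth (mu_coeff t 0) 0 \<noteq> 0" using mu_slice_0_tail_nth_0 by (simp add: mu_coeff_def mu_eq_tail)
  have "(1 - fps_const t * fps_X ^ Suc m) * mu0_series t (2 * int (Suc m)) = (fps_const t - fps_X ^ m) * mu0_series t (2 * int m)"
    unfolding mu0_series_def fps_divide_unit[OF u]
    by (simp only: mult.assoc[symmetric] mu_coeff_rec)
  moreover have "fps_of_poly (1 - monom t (Suc m)) = 1 - fps_const t * fps_X ^ Suc m"
    "fps_of_poly ([:t:] - monom 1 m) = fps_const t - fps_X ^ m"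
    by (simp_all add: fps_of_poly_diff fps_of_poly_monom fps_of_poly_const)
  moreover have "b * x * y = a * z" if "x * y = z * c" "b * c = a" for a b c x y z :: "complex fps"
    using that(1) by (simp add: that(2)[symmetric] mult_ac)
  ultimately show ?case using Suc.IH
    by (simp only: prod.lessThan_Suc fps_of_poly_mult)
qed

lemma mu0_coeff_even:
  assumes "\<And>k. k > 0 \<Longrightarrow> t * q ^ k \<noteq> 1"
  shows "mu0_coeff q t (2 * m) = dmu q t m"
proof -
  define k where "k = nat \<bar>m\<bar>"
  let ?b = "\<Prod>s<k. 1 - monom t (Suc s)"
  have b: "poly ?b q = (\<Prod>s<k. 1 - t * q ^ Suc s)" by (simp add: poly_prod poly_monom)
  have a: "poly (\<Prod>s<k. [:t:] - monom 1 s) q = (\<Prod>s<k. t - q ^ s)" by (simp add: poly_prod poly_monom)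
  have nz: "poly ?b q \<noteq> 0" unfolding b using assms[of "Suc _"] by auto
  show ?thesis
  proof (cases "m \<ge> 0")
    case True
    then have m: "m = int k" by (simp add: k_def)
    show ?thesis unfolding mu0_coeff_def m rat_value_eqI[OF nz mu0_series_poly] a b
      by (simp add: dmu_def prod_dividef)
  next
    case False
    then have m: "m = - int k" by (simp add: k_def)
    have "fps_nth (mu_coeff t 0) 0 \<noteq> 0" using mu_slice_0_tail_nth_0 by (simp add: mu_coeff_def mu_eq_tail)
    then have "mu0_series t (2 * m) = fps_X ^ k * mu0_series t (2 * int k)"
      using mu_coeff_minus[of t k] by (simp add: mu0_series_def fps_divide_unit m mult.assoc)
    then have "fps_of_poly ?b * mu0_series t (2 * m) = fps_of_poly (monom 1 k * (\<Prod>s<k. [:t:] - monom 1 s))"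
      using mu0_series_poly[of t k] by (simp only: fps_of_poly_mult fps_of_poly_monom) (simp add: mult_ac)
    note v = rat_value_eqI[OF nz this]
    show ?thesis using False unfolding mu0_coeff_def v poly_mult a b
      by (simp add: dmu_def prod_dividef poly_monom m)
  qed
qed

lemma dmu_minus: "dmu q t (- int k) = q ^ k * dmu q t (int k)"
  by (cases k) (simp_all add: dmu_def del: of_nat_Suc power_Suc)

lemma dmu_of_nat_Suc:
  assumes "t * q ^ Suc k \<noteq> 1"
  shows "(1 - t * q ^ Suc k) * dmu q t (int (Suc k)) = (t - q ^ k) * dmu q t (int k)"
  using assms by (simp add: dmu_def nat_add_distrib)

text \<open>A single recurrence for all integers m is what the telescoping of moments needs. Below
  zero it is the recurrence at positive index carried over by \<open>dmu_minus\<close>.\<close>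

lemma dmu_rec:
  assumes q: "q \<noteq> 0" and tq: "\<And>k. k > 0 \<Longrightarrow> t * q ^ k \<noteq> 1"
  shows "(1 - t * q powi (m + 1)) * dmu q t (m + 1) = (t - q powi m) * dmu q t m"
proof (cases "m \<ge> 0")
  case True
  then obtain k where m: "m = int k" by (metis nonneg_int_cases)
  have "int k + 1 = int (Suc k)" by simp
  then show ?thesis unfolding m using dmu_of_nat_Suc[OF tq[of "Suc k"]] by (simp only: power_int_of_nat)
next
  case False
  define k where "k = nat (- m - 1)"
  have m: "m = - int (Suc k)" "m + 1 = - int k" using False by (auto simp: k_def)
  have e: "(t * q ^ Suc k - 1) * dmu q t (int (Suc k)) = (q ^ k - t) * dmu q t (int k)"
    using dmu_of_nat_Suc[OF tq[of "Suc k"]] by (simp add: algebra_simps)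
  have "(1 - t * q powi (m + 1)) * dmu q t (m + 1) = (q ^ k - t) * dmu q t (int k)"
    unfolding m(2) dmu_minus using q by (simp add: power_int_minus field_simps)
  also have "\<dots> = (t - q powi m) * dmu q t m"
    unfolding e[symmetric] m(1) dmu_minus using q by (simp add: power_int_minus field_simps del: power_Suc of_nat_Suc)
  finally show ?thesis .
qed

subsection \<open>The norms\<close>

lemma ct_mu0_eq_sum:
  assumes "finite K" "Poly_Mapping.keys f \<subseteq> K"
  shows "ct_mu0 q t f = (\<Sum>m\<in>K. lkp f m * mu0_coeff q t (- m))"
  unfolding ct_mu0_def by (rule sum.mono_neutral_left) (use assms in \<open>auto simp: in_keys_iff\<close>)

lemma ct_mu0_add: "ct_mu0 q t (f + g) = ct_mu0 q t f + ct_mu0 q t g"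
proof -
  let ?K = "Poly_Mapping.keys f \<union> Poly_Mapping.keys g"
  show ?thesis
    by (subst (1 2 3) ct_mu0_eq_sum[of ?K]) (auto simp: keys_add lookup_add algebra_simps sum.distrib)
qed

lemma ct_mu0_lscale: "ct_mu0 q t (lscale c f) = c * ct_mu0 q t f"
  by (subst (1 2) ct_mu0_eq_sum[of "Poly_Mapping.keys f"]) (auto simp: keys_lscale sum_distrib_left mult.assoc)

lemma ct_mu0_sum: "ct_mu0 q t (\<Sum>i\<in>A. f i) = (\<Sum>i\<in>A. ct_mu0 q t (f i))"
  by (induction A rule: infinite_finite_induct) (simp_all add: ct_mu0_add, simp_all add: ct_mu0_def)

lemma ct_mu0_single: "ct_mu0 q t (Poly_Mapping.single m c) = c * mu0_coeff q t (- m)"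
  by (subst ct_mu0_eq_sum[of "{m}"]) auto

lemma lscale_mult_left: "lscale c f * g = lscale c (f * g)"
  by (simp add: lscale_def mult.assoc)

lemma sum_int_atLeastAtMost: "(\<Sum>i\<in>{0..int n}. f i) = (\<Sum>i\<le>n. f (int i))"
  by (rule sum.reindex_bij_witness[of _ int nat]) auto

lemma sum_int_telescope: "(\<Sum>i\<in>{0..int n}. f (i + 1) - f i) = f (int n + 1) - (f 0 :: complex)"
  unfolding sum_int_atLeastAtMost by (induction n) (simp_all add: algebra_simps)

context macdonald_params
begin

lemma q_powi_eq_1_iff: "q powi k = 1 \<longleftrightarrow> k = 0"
proof
  assume "q powi k = 1"
  then have "q ^ nat \<bar>k\<bar> = 1"
    by (cases "k \<ge> 0") (auto simp: power_int_def power_inverse)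
  then show "k = 0" using q_power[of "nat \<bar>k\<bar>"] by (cases "k = 0") auto
qed simp

lemma tq_powi: "k > 0 \<Longrightarrow> t * q powi k \<noteq> 1"
  using tq_power[of "nat k"] by (simp add: power_int_def)

abbreviation "dm \<equiv> dmu q t"

lemma ct_mu0_lpb_mult:
  "ct_mu0 q t (lpb n f * lpb m g) = (\<Sum>l\<in>{0..m}. g l * (\<Sum>i\<in>{0..n}. f i * mu0_coeff q t (n + m - 2 * i - 2 * l)))"
proof -
  have "lpb n f * lpb m g = (\<Sum>l\<in>{0..m}. \<Sum>i\<in>{0..n}. Poly_Mapping.single (2 * i - n + (2 * l - m)) (f i * g l))"
    unfolding lpb_def sum_product by (subst sum.swap) (simp add: mult_single)
  then show ?thesis
    by (simp add: ct_mu0_sum ct_mu0_single sum_distrib_left mult_ac algebra_simps)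
qed

text \<open>The constant term of \<open>a_poly n\<close> times X^(n - 2l) times the normalized
  \<mu>: the coefficient at X^(2i - n) meets the one of \<mu> at X^(2(l - i)).\<close>

definition S_moment :: "int \<Rightarrow> int \<Rightarrow> complex" where
  "S_moment n l = (\<Sum>i\<in>{0..n}. w i * p (n - i) * dm (l - i))"

lemma S_moment_extend: "n \<le> N \<Longrightarrow> S_moment n l = (\<Sum>i\<in>{0..N}. w i * p (n - i) * dm (l - i))"
  unfolding S_moment_def by (rule sum.mono_neutral_left) auto

text \<open>The summands telescope: this first-order recurrence in \<open>l\<close> is the q-Zeilberger relation
  for the sum \<open>S_moment n l\<close>.\<close>

lemma S_moment_rec_l:
  assumes n: "n \<ge> 0"
  shows "(1 - q powi (l - n)) * (1 - t * q powi (l + 1)) * S_moment n (l + 1) =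
    (1 - q powi l) * (t - q powi (l - n)) * S_moment n l"
proof -
  define g where "g = q powi (l - n)"
  \<comment> \<open>The certificate. It vanishes at i = 0 through 1 - q^i and at i = n + 1 through p
    (-1) = 0, so the telescoped sum is zero.\<close>
  define Z where "Z i = g * (1 - q powi i) * (1 - t * q * q powi (n - i)) * w i * p (n - i) * dm (l + 1 - i)" for i
  have step: "(1 - g) * (1 - t * q powi (l + 1)) * (w i * p (n - i) * dm (l + 1 - i)) -
     (1 - q powi l) * (t - g) * (w i * p (n - i) * dm (l - i)) = Z (i + 1) - Z i" for i
  proof -
    define x where "x = q powi i"
    define y where "y = q powi (n - i)"
    define D where "D = dm (l - i)"
    define D' where "D' = dm (l + 1 - i)"
    have gy: "q powi (l - i) = g * y"
      unfolding g_def y_def q_powi_add[symmetric] by simp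
    have L: "q powi l = g * y * x"
      unfolding g_def y_def x_def q_powi_add[symmetric] by simp
    have "(1 - t * q powi (l - i + 1)) * dm (l - i + 1) = (t - q powi (l - i)) * dm (l - i)"
      by (rule dmu_rec[OF q_nonzero tq_power])
    moreover have "l - i + 1 = l + 1 - i" "q powi (l - i + 1) = g * y * q"
      by (simp_all only: q_powi_add gy power_int_1_right)
    ultimately have rel: "(1 - t * (g * y * q)) * D' = (t - g * y) * D"
      by (simp only: gy D_def D'_def)
    have L1: "q powi (l + 1) = g * y * x * q" by (simp only: q_powi_add L power_int_1_right)
    have w1: "(1 - q * x) * w (i + 1) = (1 - t * x) * w i"
      using w_rec[of "i + 1"] by (simp add: q_powi_add x_def mult_ac)
    have p1: "(1 - y) * p (n - i) = (1 - t * y) * p (n - i - 1)"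
    proof -
      have "y = q powi (n - i - 1) * q" using q_powi_add[of "n - i - 1" 1] by (simp add: y_def)
      then show ?thesis using p_rec[of "n - i"] by (simp add: y_def mult_ac)
    qed
    have y1: "q * q powi (n - (i + 1)) = y" using q_powi_add[of 1 "n - (i + 1)"] by (simp add: y_def algebra_simps)
    have ix: "n - (i + 1) = n - i - 1" "l + 1 - (i + 1) = l - i" by simp_all
    have "Z (i + 1) = g * (1 - q * x) * (1 - t * y) * w (i + 1) * p (n - i - 1) * D"
      unfolding Z_def ix D_def using y1 by (simp add: ix q_powi_add x_def mult_ac)
    also have "\<dots> = g * ((1 - q * x) * w (i + 1)) * ((1 - t * y) * p (n - i - 1)) * D"
      by (simp only: mult_ac)
    finally have Z1: "Z (i + 1) = g * ((1 - t * x) * w i) * ((1 - y) * p (n - i)) * D"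
      by (simp only: w1 p1)
    have Z0: "Z i = g * (1 - x) * (1 - t * q * y) * w i * p (n - i) * D'"
      by (simp only: Z_def x_def y_def D'_def)
    show ?thesis
      unfolding Z1 Z0 L L1 D_def[symmetric] D'_def[symmetric] using rel by algebra
  qed
  obtain k where k: "n = int k" using n by (metis nonneg_int_cases)
  have "(1 - g) * (1 - t * q powi (l + 1)) * S_moment n (l + 1) - (1 - q powi l) * (t - g) * S_moment n l =
     (\<Sum>i\<in>{0..n}. Z (i + 1) - Z i)"
    unfolding step[symmetric] S_moment_def by (simp only: sum_distrib_left sum_subtractf)
  also have "\<dots> = 0" unfolding k sum_int_telescope by (simp add: Z_def k)
  finally show ?thesis by (simp add: g_def)
qed

text \<open>Orthogonality of E_(-n) to n monomials. At l = 0 the factor 1 - q^l kills the right hand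
  side of the recurrence, so the moment at 1 is zero; zeros then propagate until the factor 1 - q^(l
  - n) on the left vanishes at l = n.\<close>

lemma S_moment_eq_0:
  assumes "1 \<le> l" "l \<le> n"
  shows "S_moment n l = 0"
  using assms
proof (induction l rule: int_ge_induct)
  case base
  have "(1 - q powi (0 - n)) * (1 - t * q powi (0 + 1)) * S_moment n (0 + 1) = 0"
    using base by (subst S_moment_rec_l) auto
  then show ?case using base q_powi_eq_1_iff[of "- n"] tq_powi[of 1] by simp
next
  case (step l)
  have "(1 - q powi (l - n)) * (1 - t * q powi (l + 1)) * S_moment n (l + 1) = 0"
    using step by (subst S_moment_rec_l) auto
  then show ?case using step q_powi_eq_1_iff[of "l - n"] tq_powi[of "l + 1"] by simp
qed

text \<open>The recurrence in l cannot cross the block of zeros, so the two moments next to it need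
  a recurrence in n. It holds already for the coefficients w i * p (n - i), for each i, before
  summation.\<close>

lemma S_moment_rec_n:
  assumes n: "n \<ge> 0"
  shows "(1 - q powi n) * S_moment n l = (1 - t * q powi (n - 1)) * S_moment (n - 1) (l - 1) +
     (1 - t * q powi n) * S_moment (n - 1) l - (1 - t ^ 2 * q powi (n - 1)) * S_moment (n - 2) (l - 1)"
proof -
  have sh: "S_moment m (l - 1) = (\<Sum>i\<in>{0..n}. w (i - 1) * p (m + 1 - i) * dm (l - i))" if "m < n" for m
  proof -
    have "S_moment m (l - 1) = (\<Sum>i\<in>{0..n-1}. w i * p (m - i) * dm (l - 1 - i))"
      using that by (intro S_moment_extend) simp
    also have "\<dots> = (\<Sum>i\<in>{1..n}. w (i - 1) * p (m + 1 - i) * dm (l - i))"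
      by (rule sum.reindex_bij_witness[of _ "\<lambda>i. i - 1" "\<lambda>i. i + 1"]) (auto simp: algebra_simps)
    also have "\<dots> = (\<Sum>i\<in>{0..n}. w (i - 1) * p (m + 1 - i) * dm (l - i))"
      by (rule sum.mono_neutral_left) auto
    finally show ?thesis .
  qed
  have "(1 - q powi n) * (w i * p (n - i)) = (1 - t * q powi (n - 1)) * (w (i - 1) * p (n - i)) +
     (1 - t * q powi n) * (w i * p (n - 1 - i)) - (1 - t ^ 2 * q powi (n - 1)) * (w (i - 1) * p (n - 1 - i))" for i
  proof -
    define x where "x = q powi (i - 1)"
    define y where "y = q powi (n - i)"
    have x1: "q powi i = q * x" using q_powi_add[of 1 "i - 1"] by (simp add: x_def)
    have nn: "q powi n = q * x * y" unfolding x1[symmetric] y_def q_powi_add[symmetric] by simp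
    have n1: "q powi (n - 1) = x * y" unfolding x_def y_def q_powi_add[symmetric] by simp
    have w1: "(1 - q * x) * w i = (1 - t * x) * w (i - 1)" using w_rec[of i] by (simp add: x1 x_def)
    have ni: "n - i - 1 = n - 1 - i" by simp
    have p1: "(1 - y) * p (n - i) = (1 - t * y) * p (n - 1 - i)"
    proof -
      have "y = q powi (n - i - 1) * q" using q_powi_add[of "n - i - 1" 1] by (simp add: y_def)
      then show ?thesis using p_rec[of "n - i"] by (simp add: y_def mult_ac ni)
    qed
    show ?thesis unfolding nn n1 using w1 p1 by algebra
  qed
  note eq = this
  have pt: "(1 - q powi n) * (w i * p (n - i) * dm (l - i)) = (1 - t * q powi (n - 1)) * (w (i - 1) * p (n - i) * dm (l - i)) +
     (1 - t * q powi n) * (w i * p (n - 1 - i) * dm (l - i)) - (1 - t ^ 2 * q powi (n - 1)) * (w (i - 1) * p (n - 1 - i) * dm (l - i))" for i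
    using arg_cong[OF eq[of i], of "\<lambda>z. z * dm (l - i)"] by (simp add: algebra_simps)
  have "n - 1 + 1 = n" "n - 2 + 1 = n - 1" by simp_all
  then show ?thesis
    using sh[of "n - 1"] sh[of "n - 2"] S_moment_extend[of "n - 1" n l] S_moment_extend[of n n l]
    by (simp only: sum_distrib_left pt sum.distrib sum_subtractf)
qed

text \<open>The recurrence in n, taken at n + 1 and l = 1, involves four moments, two of which
  vanish by orthogonality. The moment above the block of zeros is treated in the same way with l = n
  + 1.\<close>

lemma S_moment_0_step:
  assumes "n \<ge> 1"
  shows "(1 - t * q powi n) * S_moment n 0 = (1 - t\<^sup>2 * q powi n) * S_moment (n - 1) 0"
  using S_moment_rec_n[of "n + 1" 1] S_moment_eq_0[of 1 "n + 1"] S_moment_eq_0[of 1 n] assms by simp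

lemma S_moment_top_step:
  assumes "n \<ge> 1"
  shows "(1 - t * q powi (n + 1)) * S_moment n (n + 1) = (1 - t\<^sup>2 * q powi n) * S_moment (n - 1) n"
  using S_moment_rec_n[of "n + 1" "n + 1"] S_moment_eq_0[of "n + 1" "n + 1"] S_moment_eq_0[of n n] assms by simp

lemma S_moment_0:
  shows "S_moment (int n) 0 = qpoch q (t\<^sup>2 * q) n / qpoch q (t * q) n"
proof (induction n)
  case 0
  then show ?case by (simp add: S_moment_def dmu_def)
next
  case (Suc n)
  have "q powi int (Suc n) = q * q ^ n" by (simp only: power_int_of_nat power_Suc)
  then show ?case using S_moment_0_step[of "int (Suc n)"] tq_powi[of "int (Suc n)"] Suc tqq_nonzero[of n] tqq_nonzero[of "Suc n"]
    by (simp add: qpoch_Suc field_simps)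
qed

lemma S_moment_top:
  shows "S_moment (int n) (int n + 1) = (t - 1) * qpoch q (t\<^sup>2 * q) n / qpoch q (t * q) (Suc n)"
proof (induction n)
  case 0
  then show ?case by (simp add: S_moment_def dmu_def qpoch_Suc)
next
  case (Suc n)
  have e: "q powi int (Suc n) = q * q ^ n" "q powi (int (Suc n) + 1) = q * q * q ^ n"
    by (simp_all only: q_powi_add power_int_of_nat power_Suc power_int_1_right mult_ac)
  have IH: "S_moment (int n) (int (Suc n)) = (t - 1) * qpoch q (t\<^sup>2 * q) n / qpoch q (t * q) (Suc n)"
    using Suc by (simp add: add.commute)
  have "(1 - t * (q * q * q ^ n)) * S_moment (int (Suc n)) (int (Suc n) + 1) =
      (1 - t\<^sup>2 * (q * q ^ n)) * ((t - 1) * qpoch q (t\<^sup>2 * q) n / qpoch q (t * q) (Suc n))"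
    using S_moment_top_step[of "int (Suc n)"] unfolding e IH[symmetric] by simp
  moreover have "1 - t * (q * q * q ^ n) \<noteq> 0" using tq_powi[of "int (Suc n) + 1"] unfolding e by simp
  ultimately show ?case using tqq_nonzero[of "Suc n"]
    by (simp add: qpoch_Suc[of _ _ "Suc n"] qpoch_Suc[of _ "t\<^sup>2 * q" n] del: of_nat_Suc) (simp add: field_simps)
qed

lemma a_poly_moment: "(\<Sum>i\<in>{0..n}. w i * p (n - i) * mu0_coeff q t (2 * (l - i))) = S_moment n l"
  unfolding S_moment_def by (rule sum.cong) (simp_all only: mu0_coeff_even[OF tq_power])

text \<open>Up to scaling, X^-1 \<open>b_poly (n + 1)\<close> is the conjugate of E_(-n). Against
  \<open>a_poly n\<close> orthogonality leaves only its top term p n X^n, whose pairing is the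
  moment at l = 0.\<close>

lemma norm_a_b:
  assumes n: "n \<ge> 0"
  shows "ct_mu0 q t (lmono (- 1) * (a_poly n * b_poly (n + 1))) = p n * S_moment n 0"
proof -
  let ?h = "\<lambda>l. q powi (n + 1 - l) * w (n + 1 - l) * p (l - 1)"
  have "lmono (- 1) * b_poly (n + 1) = (\<Sum>l\<in>{0..n+1}. Poly_Mapping.single (2 * l - (n + 2)) (?h l))"
    by (simp add: b_poly_def lpb_def sum_distrib_left mult_single algebra_simps)
  \<comment> \<open>Multiplication by X^-1 makes the exponents asymmetric; one more coefficient,
    equal to zero because w (-1) = 0, restores the shape of \<open>lpb\<close>.\<close>
  also have "\<dots> = lpb (n + 2) ?h"
    unfolding lpb_def by (rule sum.mono_neutral_left) auto
  finally have "lmono (- 1) * (a_poly n * b_poly (n + 1)) = lpb n (\<lambda>i. w i * p (n - i)) * lpb (n + 2) ?h"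
    by (simp add: a_poly_def mult.left_commute)
  then have "ct_mu0 q t (lmono (- 1) * (a_poly n * b_poly (n + 1))) =
     (\<Sum>l\<in>{0..n+2}. ?h l * (\<Sum>i\<in>{0..n}. w i * p (n - i) * mu0_coeff q t (n + (n + 2) - 2 * i - 2 * l)))"
    by (simp only: ct_mu0_lpb_mult)
  also have "\<dots> = (\<Sum>l\<in>{0..n+2}. ?h l * S_moment n (n + 1 - l))"
    unfolding a_poly_moment[symmetric] by (intro sum.cong arg_cong2[of _ _ _ _ "(*)"] refl arg_cong[of _ _ "mu0_coeff q t"]) simp
  also have "\<dots> = (\<Sum>l\<in>{0..n+2}. if l = n + 1 then p n * S_moment n 0 else 0)"
  proof (rule sum.cong[OF refl])
    fix l assume l: "l \<in> {0..n + 2}"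
    consider "l = 0" | "1 \<le> l" "l \<le> n" | "l = n + 1" | "l = n + 2" using l by fastforce
    then show "?h l * S_moment n (n + 1 - l) = (if l = n + 1 then p n * S_moment n 0 else 0)"
    proof cases
      case 2
      then show ?thesis by (simp add: S_moment_eq_0)
    qed (use n in auto)
  qed
  also have "\<dots> = p n * S_moment n 0" using n by simp
  finally show ?thesis .
qed

text \<open>Up to the factor 1 / p n these are the coefficients of the Rogers polynomial P_n, as a
  combination of the nonsymmetric ones.\<close>

definition c_sym :: "int \<Rightarrow> int \<Rightarrow> complex" where
  "c_sym n i = w i * p (n - i) + t * (q powi (n - i) * w (n - i) * p (i - 1))"

text \<open>Reversing the index by i -> n - i and using the symmetry of \<open>dm\<close> turns the
  \<open>b_poly\<close> part into a moment of \<open>a_poly (n - 1)\<close>, so both parts fall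
  under the same orthogonality.\<close>

lemma c_poly_moment:
  assumes n: "n \<ge> 1"
  shows "(\<Sum>i\<in>{0..n}. c_sym n i * mu0_coeff q t (2 * (l - i))) = S_moment n l + t * q powi (n - l) * S_moment (n - 1) (n - l)"
proof -
  have dm: "q powi k * dm (l - n + k) = q powi (n - l) * dm (n - l - k)" for k
  proof -
    have *: "dm (- m) = q powi m * dm m" if "m \<ge> 0" for m
      using that dmu_minus[of q t "nat m"] by (simp add: power_int_def)
    have e: "q powi (n - l) = q powi k * q powi (n - l - k)" unfolding q_powi_add[symmetric] by simp
    show ?thesis
    proof (cases "n - l - k \<ge> 0")
      case True
      then show ?thesis using *[of "n - l - k"] e by (simp add: algebra_simps)
    next
      case False
      then have "dm (n - l - k) = q powi (l - n + k) * dm (l - n + k)" using *[of "l - n + k"] by (simp add: algebra_simps)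
      moreover have "q powi (n - l) * q powi (l - n + k) = q powi k" unfolding q_powi_add[symmetric] by simp
      ultimately show ?thesis by (metis mult.assoc)
    qed
  qed
  have "(\<Sum>i\<in>{0..n}. c_sym n i * dm (l - i)) =
     S_moment n l + t * (\<Sum>i\<in>{0..n}. q powi (n - i) * w (n - i) * p (i - 1) * dm (l - i))"
    by (simp add: c_sym_def S_moment_def distrib_right sum.distrib sum_distrib_left mult.assoc)
  also have "(\<Sum>i\<in>{0..n}. q powi (n - i) * w (n - i) * p (i - 1) * dm (l - i)) =
      (\<Sum>k\<in>{0..n}. q powi k * w k * p (n - 1 - k) * dm (l - n + k))"
    by (rule sum.reindex_bij_witness[of _ "\<lambda>k. n - k" "\<lambda>k. n - k"]) (auto simp: algebra_simps)
  also have "\<dots> = (\<Sum>k\<in>{0..n}. q powi (n - l) * (w k * p (n - 1 - k) * dm (n - l - k)))"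
  proof (rule sum.cong[OF refl])
    fix k
    have "q powi k * w k * p (n - 1 - k) * dm (l - n + k) = w k * p (n - 1 - k) * (q powi k * dm (l - n + k))"
      by (simp only: mult_ac)
    also have "\<dots> = q powi (n - l) * (w k * p (n - 1 - k) * dm (n - l - k))"
      unfolding dm by (simp only: mult_ac)
    finally show "q powi k * w k * p (n - 1 - k) * dm (l - n + k) = q powi (n - l) * (w k * p (n - 1 - k) * dm (n - l - k))" .
  qed
  also have "\<dots> = q powi (n - l) * S_moment (n - 1) (n - l)"
    by (simp add: S_moment_extend[of "n - 1" n] sum_distrib_left)
  finally show ?thesis
    by (simp only: mu0_coeff_even[OF tq_power] mult.assoc)
qed

text \<open>All inner terms are killed by orthogonality. Only the two extreme coefficients of the
  polynomial contribute, and both are equal to p n.\<close>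

lemma norm_c:
  assumes n: "n \<ge> 1"
  shows "ct_mu0 q t (lpb n (c_sym n) * lpb n (c_sym n)) =
     p n * (S_moment n 0 + t * q powi n * S_moment (n - 1) n + t * S_moment (n - 1) 0)"
proof -
  have "ct_mu0 q t (lpb n (c_sym n) * lpb n (c_sym n)) =
     (\<Sum>l\<in>{0..n}. c_sym n l * (\<Sum>i\<in>{0..n}. c_sym n i * mu0_coeff q t (n + n - 2 * i - 2 * l)))"
    by (rule ct_mu0_lpb_mult)
  also have "\<dots> = (\<Sum>l\<in>{0..n}. c_sym n l * (S_moment n (n - l) + t * q powi l * S_moment (n - 1) l))"
  proof (rule sum.cong[OF refl])
    fix l
    have "(\<Sum>i\<in>{0..n}. c_sym n i * mu0_coeff q t (n + n - 2 * i - 2 * l)) = (\<Sum>i\<in>{0..n}. c_sym n i * mu0_coeff q t (2 * (n - l - i)))"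
      by (intro sum.cong arg_cong2[of _ _ _ _ "(*)"] refl arg_cong[of _ _ "mu0_coeff q t"]) simp
    also have "\<dots> = S_moment n (n - l) + t * q powi (n - (n - l)) * S_moment (n - 1) (n - (n - l))"
      by (rule c_poly_moment[OF n])
    also have "n - (n - l) = l" by simp
    finally show "c_sym n l * (\<Sum>i\<in>{0..n}. c_sym n i * mu0_coeff q t (n + n - 2 * i - 2 * l)) =
      c_sym n l * (S_moment n (n - l) + t * q powi l * S_moment (n - 1) l)" by (simp only:)
  qed
  also have "\<dots> = (\<Sum>l\<in>{0, n}. c_sym n l * (S_moment n (n - l) + t * q powi l * S_moment (n - 1) l))"
  proof (rule sum.mono_neutral_right)
    show "\<forall>l\<in>{0..n} - {0, n}. c_sym n l * (S_moment n (n - l) + t * q powi l * S_moment (n - 1) l) = 0"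
      by (auto simp: S_moment_eq_0)
  qed (use n in auto)
  also have "\<dots> = p n * (S_moment n 0 + t * q powi n * S_moment (n - 1) n + t * S_moment (n - 1) 0)"
  proof -
    have c0: "c_sym n 0 = p n" by (simp add: c_sym_def)
    have cn: "c_sym n n = p n" using w_lower[of n] by (simp add: c_sym_def)
    have "S_moment n n = 0" using n by (simp add: S_moment_eq_0)
    then show ?thesis using n by (simp add: c0 cn algebra_simps)
  qed
  finally show ?thesis .
qed

lemma c_lpb: "lpb n (c_sym n) = a_poly n + lscale t (b_poly n)"
proof -
  have "lscale c (lpb n f) = lpb n (\<lambda>i. c * f i)" for c f
    by (simp add: lpb_def lscale_def sum_distrib_left mult_single)
  moreover have "lpb n f + lpb n g = lpb n (\<lambda>i. f i + g i)" for f g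
    by (simp add: lpb_def sum.distrib single_add)
  ultimately show ?thesis by (simp add: a_poly_def b_poly_def c_sym_def[abs_def])
qed

end

context generic_params
begin

text \<open>One formula serves the indices -n and n + 1, since conjugation interchanges them up to a
  power of X and the two products under the constant term coincide.\<close>

definition nrm :: "int \<Rightarrow> complex" where
  "nrm n = qpoch q q (nat n) * qpoch q (t\<^sup>2 * q) (nat n) / (qpoch q (t * q) (nat n))\<^sup>2"

lemma E_norm_eq:
  assumes n: "n \<ge> 0"
  shows "E_norm r u (- n) = nrm n" "E_norm r u (n + 1) = nrm n"
proof -
  obtain k where k: "n = int k" using n by (metis nonneg_int_cases)
  have n1: "n + 1 > 0" using n by simp
  have val: "(1 / p n) * ((1 / p n) * (p n * S_moment n 0)) = nrm n"
    using qq_nonzero tqq_nonzero p_nonzero[OF n]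
    by (simp add: nrm_def k S_moment_0 wq_of_nat power2_eq_square)
  have eq: "E_poly r u (- n) * (lmono (- 1) * E_poly r u (n + 1)) =
     lscale (1 / p n) (lscale (1 / p n) (lmono (- 1) * (a_poly n * b_poly (n + 1))))"
    unfolding E_poly_neg[OF n] E_poly_pos[OF n1]
    by (simp add: lscale_mult_left lscale_mult_right mult_ac)
  have "ct_mu0 q t (E_poly r u (- n) * (lmono (- 1) * E_poly r u (n + 1))) = nrm n"
    unfolding eq ct_mu0_lscale norm_a_b[OF n] by (rule val)
  then show "E_norm r u (- n) = nrm n" "E_norm r u (n + 1) = nrm n"
    unfolding E_norm_def E_star_neg[OF n] E_star_pos[OF n] q_eq[symmetric] t_eq[symmetric]
    by (simp_all add: mult_ac)
qed

lemma P_poly_eq: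
  assumes n: "n > 0"
  shows "P_poly r u n = lscale (1 / p (int n)) (lpb (int n) (c_sym (int n)))"
proof -
  have n': "int n \<ge> 0" "int n > 0" using n by auto
  obtain k where k: "n = Suc k" using n by (cases n) auto
  have e: "(t - t * q ^ n) / ((1 - t * q ^ n) * p (int n - 1)) = t / p (int n)"
  proof -
    have "(1 - q ^ n) * p (int n) = (1 - t * q ^ n) * p (int n - 1)"
      using p_rec[of "int n"] q_powi_add[of 1 "int n - 1"] by (simp add: mult.assoc)
    moreover have "(t - t * q ^ n) * p (int n) = t * ((1 - q ^ n) * p (int n))" by (simp add: algebra_simps)
    ultimately have "(t - t * q ^ n) * p (int n) = t * ((1 - t * q ^ n) * p (int n - 1))" by simp
    moreover have "p (int n) \<noteq> 0" "(1 - t * q ^ n) * p (int n - 1) \<noteq> 0"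
      using p_nonzero[of "int n"] p_nonzero[of "int n - 1"] n tq_power[of n] by auto
    ultimately show "(t - t * q ^ n) / ((1 - t * q ^ n) * p (int n - 1)) = t / p (int n)"
      by (simp add: frac_eq_eq)
  qed
  have "lscale a (lscale b f) = lscale (a * b) f" for a b f
    by (rule poly_mapping_eqI) simp
  then show ?thesis
    unfolding P_poly_def Let_def q_eq[symmetric] t_eq[symmetric] E_poly_neg[OF n'(1)] E_poly_pos[OF n'(2)] c_lpb
    by (simp add: lscale_add e)
qed

lemma P_norm_eq:
  "P_norm r u (Suc n) = (1 + t) * qpoch q q (Suc n) * qpoch q (t\<^sup>2 * q) n / (qpoch q (t * q) n * qpoch q (t * q) (Suc n))"
proof -
  have "P_norm r u (Suc n) = 1 / p (int (Suc n)) * (1 / p (int (Suc n)) * ct_mu0 q t (lpb (int (Suc n)) (c_sym (int (Suc n))) * lpb (int (Suc n)) (c_sym (int (Suc n)))))"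
    unfolding P_norm_def P_poly_eq[OF zero_less_Suc] q_eq[symmetric] t_eq[symmetric]
    by (simp only: lscale_mult_left lscale_mult_right ct_mu0_lscale)
  also have "ct_mu0 q t (lpb (int (Suc n)) (c_sym (int (Suc n))) * lpb (int (Suc n)) (c_sym (int (Suc n)))) =
     p (int (Suc n)) * (S_moment (int (Suc n)) 0 + t * q powi (int (Suc n)) * S_moment (int n) (int n + 1) + t * S_moment (int n) 0)"
    by (subst norm_c) (simp_all add: algebra_simps)
  also have "S_moment (int (Suc n)) 0 + t * q powi (int (Suc n)) * S_moment (int n) (int n + 1) + t * S_moment (int n) 0 =
     (1 + t) * qpoch q (t\<^sup>2 * q) n / qpoch q (t * q) n"
  proof -
    define x where "x = q ^ Suc n"
    define a where "a = qpoch q (t * q) n"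
    define b where "b = qpoch q (t\<^sup>2 * q) n"
    define z where "z = 1 - t * x"
    have a': "qpoch q (t * q) (Suc n) = a * z" and b': "qpoch q (t\<^sup>2 * q) (Suc n) = b * (1 - t\<^sup>2 * x)"
      by (simp_all add: a_def b_def z_def x_def qpoch_Suc mult_ac)
    have nz: "a \<noteq> 0" "z \<noteq> 0" using tqq_nonzero[of "Suc n"] unfolding a' by auto
    have "b * (1 - t\<^sup>2 * x) + t * x * ((t - 1) * b) + t * b * z = (1 + t) * b * z"
      unfolding z_def by algebra
    then have "(b * (1 - t\<^sup>2 * x) + t * x * ((t - 1) * b) + t * b * z) / (a * z) = (1 + t) * b / a"
      using nz by simp
    moreover have "b * (1 - t\<^sup>2 * x) / (a * z) + t * x * ((t - 1) * b / (a * z)) + t * (b / a) =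
      (b * (1 - t\<^sup>2 * x) + t * x * ((t - 1) * b) + t * b * z) / (a * z)"
      using nz by (simp add: add_divide_distrib)
    ultimately show ?thesis
      unfolding S_moment_0 S_moment_top power_int_of_nat a' b' a_def[symmetric] b_def[symmetric] x_def[symmetric]
      by simp
  qed
  also have "1 / p (int (Suc n)) * (1 / p (int (Suc n)) * (p (int (Suc n)) * ((1 + t) * qpoch q (t\<^sup>2 * q) n / qpoch q (t * q) n))) =
    (1 + t) * qpoch q q (Suc n) * qpoch q (t\<^sup>2 * q) n / (qpoch q (t * q) n * qpoch q (t * q) (Suc n))"
    using p_nonzero[of "int (Suc n)"] qq_nonzero tqq_nonzero unfolding wq_of_nat by (simp add: field_simps)
  finally show ?thesis .
qed

lemma P_poly_0: "P_poly r u 0 = 1"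
proof -
  have "E_poly r u 0 = lscale (1 / p 0) (a_poly 0)" using E_poly_neg[of 0] by simp
  also have "\<dots> = 1" by (rule poly_mapping_eqI) (auto simp: a_poly_def lpb_def lookup_one)
  finally show ?thesis by (simp add: P_poly_def Let_def lscale_def)
qed

lemma P_norm_0: "P_norm r u 0 = 1"
  unfolding P_norm_def P_poly_0 q_eq[symmetric] t_eq[symmetric]
  using ct_mu0_single[of q t 0 1] mu0_coeff_even[OF tq_power, of 0] by (simp add: dmu_def)

text \<open>(t^2 q; q)_n sits in the numerator of the norm, so its nonvanishing comes from the part
  of \<open>generic\<close> about norms, not from the existence of the polynomials.\<close>

lemma t2q_nonzero: "qpoch q (t\<^sup>2 * q) n \<noteq> 0"
  using E_norm_eq(1)[of "int n"] gen by (auto simp: generic_def nrm_def)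

lemma t2_power: "k > 0 \<Longrightarrow> t\<^sup>2 * q ^ k \<noteq> 1"
  using t2q_nonzero[of k] by (cases k) (auto simp: qpoch_Suc mult.assoc)

lemma t_neq_minus_1: "1 + t \<noteq> 0"
proof -
  have "P_norm r u 1 \<noteq> 0" using gen by (simp add: generic_def)
  then show ?thesis using P_norm_eq[of 0] by auto
qed

end

subsection \<open>Infinite q-products\<close>

definition qinf :: "complex \<Rightarrow> complex \<Rightarrow> complex" where
  "qinf q c = (prodinf (\<lambda>l. 1 - c * q ^ l))"

text \<open>From 1 + x \<le> exp x for every factor. The bound does not involve n and therefore
  passes to the infinite product.\<close>

lemma qpoch_norm_le:
  assumes "norm q < 1"
  shows "norm (qpoch q c n) \<le> exp (norm c / (1 - norm q))"
proof -
  have "norm (qpoch q c n) = (\<Prod>l<n. norm (1 - c * q ^ l))" by (simp add: qpoch_def prod_norm)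
  also have "\<dots> \<le> (\<Prod>l<n. exp (norm c * norm q ^ l))"
  proof (rule prod_mono, safe)
    fix l
    have "norm (1 - c * q ^ l) \<le> 1 + norm c * norm q ^ l"
      using norm_triangle_ineq4[of 1 "c * q ^ l"] by (simp add: norm_mult norm_power)
    also have "\<dots> \<le> exp (norm c * norm q ^ l)" by (rule exp_ge_add_one_self)
    finally show "norm (1 - c * q ^ l) \<le> exp (norm c * norm q ^ l)" .
  qed simp
  also have "\<dots> = exp (norm c * (\<Sum>l<n. norm q ^ l))" by (simp add: exp_sum sum_distrib_left)
  also have "(\<Sum>l<n. norm q ^ l) \<le> (suminf (\<lambda>l. norm q ^ l))"
    by (rule sum_le_suminf) (use assms in auto)
  then have "exp (norm c * (\<Sum>l<n. norm q ^ l)) \<le> exp (norm c / (1 - norm q))"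
    using assms mult_left_mono[of "\<Sum>l<n. norm q ^ l" "1 / (1 - norm q)" "norm c"] by (simp add: suminf_geometric)
  finally show ?thesis .
qed

lemma qinf_convergent:
  fixes q c :: complex
  assumes "norm q < 1"
  shows "convergent_prod (\<lambda>l. 1 - c * q ^ l)"
proof -
  have "summable (\<lambda>l. norm c * norm q ^ l)"
    using assms by (intro summable_mult summable_geometric) auto
  then have "summable (\<lambda>l. norm (1 - c * q ^ l - 1))" by (simp add: norm_mult norm_power)
  then show ?thesis
    by (intro abs_convergent_prod_imp_convergent_prod summable_imp_abs_convergent_prod)
qed

lemma qpoch_LIMSEQ:
  assumes "norm q < 1"
  shows "qpoch q c \<longlonglongrightarrow> qinf q c"
proof -
  have "(\<lambda>n. \<Prod>i\<le>n. 1 - c * q ^ i) \<longlonglongrightarrow> qinf q c"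
    unfolding qinf_def by (rule convergent_prod_LIMSEQ[OF qinf_convergent[OF assms]])
  then have "(\<lambda>n. qpoch q c (Suc n)) \<longlonglongrightarrow> qinf q c"
    by (simp add: qpoch_def lessThan_Suc_atMost)
  then show ?thesis by (rule LIMSEQ_imp_Suc)
qed

lemma qinf_norm_le:
  assumes "norm q < 1"
  shows "norm (qinf q c) \<le> exp (norm c / (1 - norm q))"
  by (rule Lim_bounded[OF tendsto_norm[OF qpoch_LIMSEQ[OF assms]]]) (use qpoch_norm_le[OF assms] in auto)

lemma qinf_nonzero:
  assumes "norm q < 1" "\<And>l. c * q ^ l \<noteq> 1"
  shows "qinf q c \<noteq> 0"
  unfolding qinf_def by (rule prodinf_nonzero[OF qinf_convergent]) (use assms in auto)

lemma qinf_shift: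
  assumes "norm q < 1"
  shows "qinf q c = (1 - c) * qinf q (c * q)"
proof (rule LIMSEQ_unique)
  show "(\<lambda>n. qpoch q c (Suc n)) \<longlonglongrightarrow> qinf q c" using qpoch_LIMSEQ[OF assms] by (rule LIMSEQ_Suc)
  show "(\<lambda>n. qpoch q c (Suc n)) \<longlonglongrightarrow> (1 - c) * qinf q (c * q)"
    unfolding qpoch_Suc_shift by (intro tendsto_intros qpoch_LIMSEQ assms)
qed

lemma qinf_split:
  assumes "norm q < 1"
  shows "qinf q c = qpoch q c n * qinf q (c * q ^ n)"
proof (induction n)
  case (Suc n)
  then show ?case using qinf_shift[OF assms, of "c * q ^ n"] by (simp add: qpoch_Suc mult_ac)
qed simp

lemma holomorphic_on_suminf:
  fixes f :: "nat \<Rightarrow> complex \<Rightarrow> complex"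
  assumes S: "open S" and hol: "\<And>n. f n holomorphic_on S"
    and bound: "\<And>x. x \<in> S \<Longrightarrow> \<exists>d>0. \<exists>M. cball x d \<subseteq> S \<and> summable M \<and> (\<forall>n. \<forall>y\<in>cball x d. norm (f n y) \<le> M n)"
  shows "(\<lambda>x. suminf (\<lambda>n. f n x)) holomorphic_on S"
proof (rule holomorphic_uniform_sequence[OF S, of "\<lambda>N x. \<Sum>n<N. f n x"])
  show "(\<lambda>x. \<Sum>n<N. f n x) holomorphic_on S" for N
    by (intro holomorphic_intros hol)
  fix x assume "x \<in> S"
  from bound[OF this] show "\<exists>d>0. cball x d \<subseteq> S \<and> uniform_limit (cball x d) (\<lambda>N x. \<Sum>n<N. f n x) (\<lambda>x. suminf (\<lambda>n. f n x)) sequentially"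
    by (elim ex_forward conj_forward) (auto intro: Weierstrass_m_test)
qed

text \<open>Written as a telescoping series of polynomials in c, the infinite product has a
  geometric majorant on every closed disc of radius 1.\<close>

lemma qinf_holomorphic:
  assumes q: "norm q < 1"
  shows "qinf q holomorphic_on UNIV"
proof -
  let ?f = "\<lambda>n c. qpoch q c (Suc n) - qpoch q c n"
  have "qinf q = (\<lambda>c. 1 + (suminf (\<lambda>n. ?f n c)))"
  proof
    fix c
    have "(\<lambda>n. ?f n c) sums (qinf q c - qpoch q c 0)"
      by (rule telescope_sums[OF qpoch_LIMSEQ[OF q]])
    then show "qinf q c = 1 + (suminf (\<lambda>n. ?f n c))" by (simp add: sums_iff)
  qed
  moreover have "(\<lambda>c. suminf (\<lambda>n. ?f n c)) holomorphic_on UNIV"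
  proof (rule holomorphic_on_suminf)
    show "?f n holomorphic_on UNIV" for n unfolding qpoch_def by (intro holomorphic_intros)
    fix x :: complex
    let ?B = "norm x + 1"
    have "norm (?f n y) \<le> ?B * exp (?B / (1 - norm q)) * norm q ^ n" if "y \<in> cball x 1" for n y
    proof -
      have y: "norm y \<le> ?B" using that norm_triangle_ineq2[of y x] by (simp add: dist_norm norm_minus_commute)
      have "?f n y = - y * q ^ n * qpoch q y n" by (simp add: qpoch_Suc algebra_simps)
      then have "norm (?f n y) = norm y * norm q ^ n * norm (qpoch q y n)" by (simp add: norm_mult norm_power)
      also have "\<dots> \<le> ?B * norm q ^ n * exp (?B / (1 - norm q))"
      proof (intro mult_mono)
        have "norm (qpoch q y n) \<le> exp (norm y / (1 - norm q))" by (rule qpoch_norm_le[OF q])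
        also have "\<dots> \<le> exp (?B / (1 - norm q))" using y q by (simp add: divide_right_mono)
        finally show "norm (qpoch q y n) \<le> exp (?B / (1 - norm q))" .
      qed (use y in auto)
      finally show ?thesis by (simp add: mult_ac)
    qed
    moreover have "summable (\<lambda>n. ?B * exp (?B / (1 - norm q)) * norm q ^ n)"
      using q by (intro summable_mult summable_geometric) auto
    ultimately show "\<exists>d>0. \<exists>M. cball x d \<subseteq> UNIV \<and> summable M \<and> (\<forall>n. \<forall>y\<in>cball x d. norm (?f n y) \<le> M n)"
      by (intro exI[of _ "1 :: real"] conjI exI[of _ "\<lambda>n. ?B * exp (?B / (1 - norm q)) * norm q ^ n"] allI ballI) simp_all
  qed simp
  ultimately show ?thesis by (simp add: holomorphic_on_add)
qed

lemma qq_neq_1: "norm (q :: complex) < 1 \<Longrightarrow> k > 0 \<Longrightarrow> q ^ k \<noteq> 1"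
  by (metis less_irrefl norm_one norm_power power_less_one_iff norm_ge_zero zero_less_iff_neq_zero)

lemma qinf_qq_nonzero: "norm q < 1 \<Longrightarrow> qinf q q \<noteq> 0"
  by (rule qinf_nonzero) (auto dest: qq_neq_1[of q "Suc _"])

lemma wq_LIMSEQ:
  assumes "norm q < 1"
  shows "(\<lambda>n. wq q c (int n)) \<longlonglongrightarrow> qinf q c / qinf q q"
  unfolding wq_of_nat by (intro tendsto_divide qpoch_LIMSEQ qinf_qq_nonzero assms)

lemma wq_bounded:
  assumes "norm q < 1"
  obtains M where "M > 0" "\<And>i. norm (wq q c i) \<le> M"
proof -
  have "Bseq (\<lambda>n. wq q c (int n))"
    using wq_LIMSEQ[OF assms] by (intro convergent_imp_Bseq convergentI)
  then obtain M where M: "M > 0" "\<And>n. norm (wq q c (int n)) \<le> M" by (auto simp: Bseq_def)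
  have "norm (wq q c i) \<le> M" for i
    using M(2)[of "nat i"] M(1) by (cases "i < 0") auto
  with M(1) show ?thesis by (rule that)
qed

text \<open>The sum U satisfies (1 - y) U(y) = (1 - c y) U(q y) by the recurrence of
  \<open>wq\<close>. Iteration moves the argument to 0, where U is continuous with value 1.\<close>

lemma qbinomial_sums:
  assumes q: "norm q < 1" and x: "norm x < 1"
  shows "(\<lambda>n. wq q c (int n) * x ^ n) sums (qinf q (c * x) / qinf q x)"
proof -
  obtain M where M: "M > 0" "\<And>i. norm (wq q c i) \<le> M" using wq_bounded[OF q] by blast
  have summ: "summable (\<lambda>n. wq q c (int n) * y ^ n)" if "norm y < 1" for y
  proof (rule summable_comparison_test')
    show "summable (\<lambda>n. M * norm y ^ n)" using that by (intro summable_mult summable_geometric) auto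
    show "norm (wq q c (int n) * y ^ n) \<le> M * norm y ^ n" for n
      using M by (simp add: norm_mult norm_power mult_right_mono)
  qed
  define U where "U y = (suminf (\<lambda>n. wq q c (int n) * y ^ n))" for y
  have step: "(1 - y) * U y = (1 - c * y) * U (q * y)" if y: "norm y < 1" for y
  proof -
    have qy: "norm (q * y) < 1" using q y by (simp add: norm_mult) (metis mult_less_cancel_left2 mult_strict_mono' norm_ge_zero not_less mult.right_neutral)
    have s: "(\<lambda>n. wq q c (int n) * y ^ n) sums U y" "(\<lambda>n. wq q c (int n) * (q * y) ^ n) sums U (q * y)"
      unfolding U_def using summ[OF y] summ[OF qy] by (simp_all add: summable_sums)
    have "(\<lambda>n. wq q c (int (Suc n) - 1) * y ^ Suc n) sums (y * U y)"
      "(\<lambda>n. q powi (int (Suc n) - 1) * wq q c (int (Suc n) - 1) * y ^ Suc n) sums (y * U (q * y))"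
      using sums_mult[OF s(1), of y] sums_mult[OF s(2), of y] by (simp_all add: power_mult_distrib mult_ac)
    \<comment> \<open>The shift of the index adds only a zero term at n = 0, because
      \<open>wq\<close> vanishes at -1.\<close>
    then have s': "(\<lambda>n. wq q c (int n - 1) * y ^ n) sums (y * U y)" "(\<lambda>n. q powi (int n - 1) * wq q c (int n - 1) * y ^ n) sums (y * U (q * y))"
      by (simp_all only: sums_Suc_iff[of "\<lambda>n. wq q c (int n - 1) * y ^ n"]
          sums_Suc_iff[of "\<lambda>n. q powi (int n - 1) * wq q c (int n - 1) * y ^ n"]) simp_all
    have "(\<lambda>n. wq q c (int n) * y ^ n - wq q c (int n - 1) * y ^ n) sums (U y - y * U y)"
      by (intro sums_diff s s')
    moreover have "(\<lambda>n. wq q c (int n) * (q * y) ^ n - c * (q powi (int n - 1) * wq q c (int n - 1) * y ^ n)) sums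
      (U (q * y) - c * (y * U (q * y)))"
      by (intro sums_diff sums_mult s s')
    moreover have "wq q c (int n) * y ^ n - wq q c (int n - 1) * y ^ n =
        wq q c (int n) * (q * y) ^ n - c * (q powi (int n - 1) * wq q c (int n - 1) * y ^ n)" for n
    proof -
      have "wq q c (int n) - wq q c (int n - 1) = q ^ n * wq q c (int n) - c * (q powi (int n - 1) * wq q c (int n - 1))"
        using wq_rec[of q "int n" c, OF qq_neq_1[OF q]] by (simp add: algebra_simps)
      then have "(wq q c (int n) - wq q c (int n - 1)) * y ^ n = (q ^ n * wq q c (int n) - c * (q powi (int n - 1) * wq q c (int n - 1))) * y ^ n"
        by simp
      then show ?thesis by (simp add: algebra_simps power_mult_distrib)
    qed
    ultimately have "U y - y * U y = U (q * y) - c * (y * U (q * y))" by (simp add: sums_iff)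
    then show ?thesis by (simp add: algebra_simps)
  qed
  have qx: "norm (q ^ n * x) < 1" for n
  proof -
    have "norm (q ^ n * x) \<le> norm x" using q by (simp add: norm_mult norm_power mult_left_le_one_le power_le_one)
    then show ?thesis using x by simp
  qed
  have iter: "qpoch q x n * U x = qpoch q (c * x) n * U (q ^ n * x)" for n
  proof (induction n)
    case (Suc n)
    have "qpoch q x (Suc n) * U x = (1 - x * q ^ n) * (qpoch q x n * U x)" by (simp add: qpoch_Suc)
    also have "\<dots> = qpoch q (c * x) n * ((1 - q ^ n * x) * U (q ^ n * x))" unfolding Suc by (simp add: mult_ac)
    also have "\<dots> = qpoch q (c * x) (Suc n) * U (q ^ Suc n * x)"
      unfolding step[OF qx] by (simp add: qpoch_Suc mult_ac)
    finally show ?case .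
  qed simp
  have "isCont U 0"
  proof -
    have "isCont (\<lambda>y. suminf (\<lambda>n. wq q c (int n) * y ^ n)) 0"
      by (rule isCont_powser[of _ "1 / 2 :: complex"]) (use summ[of "1 / 2"] in \<open>auto simp: norm_divide\<close>)
    then show ?thesis by (simp add: U_def[abs_def])
  qed
  moreover have "(\<lambda>n. q ^ n * x) \<longlonglongrightarrow> 0"
    using tendsto_mult_right[OF LIMSEQ_power_zero[OF q], of x] by simp
  ultimately have "(\<lambda>n. U (q ^ n * x)) \<longlonglongrightarrow> U 0" by (rule isCont_tendsto_compose)
  then have "(\<lambda>n. qpoch q (c * x) n * U (q ^ n * x)) \<longlonglongrightarrow> qinf q (c * x) * U 0"
    by (intro tendsto_mult qpoch_LIMSEQ q)
  moreover have "(\<lambda>n. qpoch q (c * x) n * U (q ^ n * x)) \<longlonglongrightarrow> qinf q x * U x"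
    unfolding iter[symmetric] by (intro tendsto_mult qpoch_LIMSEQ q tendsto_const)
  ultimately have "qinf q x * U x = qinf q (c * x) * U 0" using LIMSEQ_unique by blast
  moreover have "U 0 = 1" by (simp add: U_def)
  moreover have "qinf q x \<noteq> 0"
  proof (rule qinf_nonzero[OF q])
    fix l show "x * q ^ l \<noteq> 1" using qx[of l] by (metis less_irrefl mult.commute norm_one)
  qed
  ultimately have "U x = qinf q (c * x) / qinf q x" by (simp add: field_simps)
  then show ?thesis using summ[OF x] unfolding U_def by (simp add: sums_iff)
qed

lemma sigma_fn_eq:
  assumes "norm q < 1"
  shows "sigma_fn q t L = qinf q (t * L\<^sup>2) / qinf q (L\<^sup>2)"
proof -
  have "sigma_fn q t L = prodinf (\<lambda>j. (1 - t * L\<^sup>2 * q ^ j) / (1 - L\<^sup>2 * q ^ j))"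
    by (simp add: sigma_fn_def mult_ac)
  then show ?thesis unfolding qinf_def by (simp only: prodinf_divide[OF qinf_convergent qinf_convergent] assms)
qed

lemma sigma_fn_series:
  assumes q: "norm q < 1" and L: "norm L < 1"
  shows "(\<lambda>i. L ^ (2 * Suc i) * (\<Prod>s=1..Suc i. (1 - t * q ^ (s - 1)) / (1 - q ^ s))) sums (sigma_fn q t L - 1)"
proof -
  have "norm (L\<^sup>2) < 1" using L by (simp add: norm_power power_less_one_iff)
  from qbinomial_sums[OF q this, of t]
  have "(\<lambda>i. wq q t (int (Suc i)) * (L\<^sup>2) ^ Suc i) sums (sigma_fn q t L - 1)"
    unfolding sigma_fn_eq[OF q] by (subst sums_Suc_iff) simp
  moreover have "(\<Prod>s=1..Suc i. (1 - t * q ^ (s - 1)) / (1 - q ^ s)) = wq q t (int (Suc i))" for i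
  proof -
    have "(\<Prod>s=1..Suc i. (1 - t * q ^ (s - 1)) / (1 - q ^ s)) = (\<Prod>l<Suc i. (1 - t * q ^ l) / (1 - q ^ Suc l))"
      by (rule prod.reindex_bij_witness[of _ Suc "\<lambda>s. s - 1"]) auto
    then show ?thesis unfolding wq_of_nat by (simp add: qpoch_def prod_dividef)
  qed
  ultimately show ?thesis by (simp only: power_mult mult.commute[of _ "wq q t _"])
qed

lemma mu_ct_eq:
  assumes q: "norm q < 1"
  shows "mu_ct q t = (qinf q (t * q))\<^sup>2 / (qinf q (t\<^sup>2 * q) * qinf q q)"
proof -
  note cv = qinf_convergent[OF q]
  have "mu_ct q t = (prodinf (\<lambda>j. ((1 - t * q * q ^ j) * (1 - t * q * q ^ j)) / ((1 - t\<^sup>2 * q * q ^ j) * (1 - q * q ^ j))))"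
    by (simp add: mu_ct_def power2_eq_square mult_ac)
  also have "\<dots> = (qinf q (t * q) * qinf q (t * q)) / (qinf q (t\<^sup>2 * q) * qinf q q)"
    unfolding qinf_def using cv
    by (simp only: prodinf_divide[symmetric] prodinf_mult[symmetric] convergent_prod_mult)
  finally show ?thesis by (simp add: power2_eq_square)
qed

lemma hyp_prod_eq: "hyp_prod q t L j = wq q t (int j) * (qpoch q (t * L\<^sup>2) j / qpoch q (q * L\<^sup>2) j)"
proof -
  have "hyp_prod q t L j = (\<Prod>l<j. ((1 - t * q ^ l) * (1 - t * q ^ l * L ^ 2)) / ((1 - q ^ Suc l) * (1 - q ^ Suc l * L ^ 2)))"
    unfolding hyp_prod_def by (rule prod.reindex_bij_witness[of _ Suc "\<lambda>s. s - 1"]) auto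
  also have "\<dots> = wq q t (int j) * (qpoch q (t * L\<^sup>2) j / qpoch q (q * L\<^sup>2) j)"
    unfolding wq_of_nat qpoch_def by (simp add: prod_dividef prod.distrib mult_ac)
  finally show ?thesis .
qed

subsection \<open>Bracket sums\<close>

locale main_params = generic_params +
  assumes q_norm: "norm q < 1" and t_neq_1: "t \<noteq> 1"
begin

text \<open>A Laurent polynomial in \<open>z\<close> whose coefficients are weighted by a function of \<open>q^i\<close> and \<open>q^(n-i)\<close>.  All identities
  below come from multiplying or shifting the weight; \<open>h = 1\<close> gives the Rogers polynomials.\<close>

definition bracket :: "int \<Rightarrow> (complex \<Rightarrow> complex \<Rightarrow> complex) \<Rightarrow> complex \<Rightarrow> complex" where
  "bracket n h z = (\<Sum>i\<in>{0..n}. w i * w (n - i) * h (q powi i) (q powi (n - i)) * z powi (2 * i - n))"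

text \<open>The weight is evaluated only at pairs with x y = q^n, so an identity of weights modulo
  this relation suffices. In this way q^n moves between the weight and the outer
  coefficient.\<close>

lemma bracket_lin:
  assumes "\<And>x y. x * y = q powi n \<Longrightarrow> f x y = a * g x y + b * h x y"
  shows "bracket n f z = a * bracket n g z + b * bracket n h z"
proof -
  have "f (q powi i) (q powi (n - i)) = a * g (q powi i) (q powi (n - i)) + b * h (q powi i) (q powi (n - i))" for i
    by (rule assms) (simp flip: q_powi_add)
  then show ?thesis by (simp add: bracket_def sum_distrib_left sum.distrib[symmetric] algebra_simps)
qed

lemma bracket_scale:
  assumes "\<And>x y. x * y = q powi n \<Longrightarrow> f x y = a * g x y"
  shows "bracket n f z = a * bracket n g z"
  using bracket_lin[of n f a g 0 g z] assms by simp

text \<open>The factor 1 - y vanishes at the last index i = n + 1; at the others it lowers w by its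
  recurrence, which creates 1 - t y.\<close>

lemma bracket_shift_right:
  assumes z: "z \<noteq> 0"
  shows "bracket (n + 1) (\<lambda>x y. (1 - y) * h x y) z = inverse z * bracket n (\<lambda>x y. (1 - t * y) * h x (q * y)) z"
proof -
  have "bracket (n + 1) (\<lambda>x y. (1 - y) * h x y) z =
     (\<Sum>i\<in>{0..n}. w i * w (n + 1 - i) * ((1 - q powi (n + 1 - i)) * h (q powi i) (q powi (n + 1 - i))) * z powi (2 * i - (n + 1)))"
    unfolding bracket_def
  proof (rule sum.mono_neutral_right, goal_cases)
    case 3
    have "i = n + 1" if "i \<in> {0..n+1} - {0..n}" for i using that by auto
    then show ?case by (metis (no_types, lifting) diff_self mult_zero_left mult_zero_right power_int_0_right)
  qed auto
  also have "\<dots> = inverse z * bracket n (\<lambda>x y. (1 - t * y) * h x (q * y)) z"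
    unfolding bracket_def sum_distrib_left
  proof (rule sum.cong[OF refl])
    fix i
    have "(1 - q powi (n + 1 - i)) * w (n + 1 - i) = (1 - t * q powi (n - i)) * w (n - i)"
      using w_rec[of "n + 1 - i"] by (simp add: algebra_simps)
    moreover have "q powi (n + 1 - i) = q * q powi (n - i)"
      using q_powi_add[of 1 "n - i"] by (simp add: algebra_simps)
    moreover have "z powi (2 * i - (n + 1)) = inverse z * z powi (2 * i - n)"
      using power_int_add[of z "-1" "2 * i - n"] z by (simp add: algebra_simps)
    ultimately show "w i * w (n + 1 - i) * ((1 - q powi (n + 1 - i)) * h (q powi i) (q powi (n + 1 - i))) * z powi (2 * i - (n + 1)) =
      inverse z * (w i * w (n - i) * ((1 - t * q powi (n - i)) * h (q powi i) (q * q powi (n - i))) * z powi (2 * i - n))"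
      by algebra
  qed
  finally show ?thesis .
qed

lemma bracket_shift_left:
  assumes z: "z \<noteq> 0"
  shows "bracket (n + 1) (\<lambda>x y. (1 - x) * h x y) z = z * bracket n (\<lambda>x y. (1 - t * x) * h (q * x) y) z"
proof -
  have "bracket (n + 1) (\<lambda>x y. (1 - x) * h x y) z =
     (\<Sum>i\<in>{1..n+1}. w i * w (n + 1 - i) * ((1 - q powi i) * h (q powi i) (q powi (n + 1 - i))) * z powi (2 * i - (n + 1)))"
    unfolding bracket_def
  proof (rule sum.mono_neutral_right, goal_cases)
    case 3
    have "i = 0" if "i \<in> {0..n+1} - {1..n+1}" for i using that by auto
    then show ?case by (metis (no_types, lifting) diff_self mult_zero_left mult_zero_right power_int_0_right)
  qed auto
  also have "\<dots> = (\<Sum>i\<in>{0..n}. w (i + 1) * w (n - i) * ((1 - q powi (i + 1)) * h (q powi (i + 1)) (q powi (n - i))) * z powi (2 * i - n + 1))"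
    by (rule sum.reindex_bij_witness[of _ "\<lambda>i. i + 1" "\<lambda>i. i - 1"]) (auto simp: algebra_simps)
  also have "\<dots> = z * bracket n (\<lambda>x y. (1 - t * x) * h (q * x) y) z"
    unfolding bracket_def sum_distrib_left
  proof (rule sum.cong[OF refl])
    fix i
    have "(1 - q powi (i + 1)) * w (i + 1) = (1 - t * q powi i) * w i"
      using w_rec[of "i + 1"] by (simp add: algebra_simps)
    moreover have "q powi (i + 1) = q * q powi i"
      using q_powi_add[of 1 i] by (simp add: algebra_simps)
    moreover have "z powi (2 * i - n + 1) = z * z powi (2 * i - n)"
      using power_int_add[of z 1 "2 * i - n"] z by (simp add: algebra_simps)
    ultimately show "w (i + 1) * w (n - i) * ((1 - q powi (i + 1)) * h (q powi (i + 1)) (q powi (n - i))) * z powi (2 * i - n + 1) =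
      z * (w i * w (n - i) * ((1 - t * q powi i) * h (q * q powi i) (q powi (n - i))) * z powi (2 * i - n))"
      by algebra
  qed
  finally show ?thesis .
qed

abbreviation "rogers n \<equiv> bracket n (\<lambda>x y. 1)"

text \<open>The values of \<open>a_poly\<close> and \<open>b_poly\<close>. The relation (1 - t) p i
  = (1 - t q^i) w i turns the mixed products of w and p into brackets in w alone.\<close>

definition a_val :: "int \<Rightarrow> complex \<Rightarrow> complex" where
  "a_val n z = bracket n (\<lambda>x y. 1 - t * y) z / (1 - t)"

definition b_val :: "int \<Rightarrow> complex \<Rightarrow> complex" where
  "b_val n z = bracket n (\<lambda>x y. y * (1 - x)) z / (1 - t)"

lemma a_val_bracket: "(1 - t) * a_val n z = bracket n (\<lambda>x y. 1 - t * y) z"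
  and b_val_bracket: "(1 - t) * b_val n z = bracket n (\<lambda>x y. y * (1 - x)) z"
  using t_neq_1 by (simp_all add: a_val_def b_val_def)

lemma cancel_1_minus_t: "(1 - t) * a = (1 - t) * b \<Longrightarrow> a = b"
  using t_neq_1 by simp

lemma leval_a_poly: "leval (a_poly n) z = a_val n z"
proof -
  have "w i * p (n - i) = w i * w (n - i) * (1 - t * q powi (n - i)) / (1 - t)" for i
  proof -
    have "w i * p (n - i) * (1 - t) = w i * w (n - i) * (1 - t * q powi (n - i))"
      using p_w[of "n - i"] by algebra
    then show ?thesis using t_neq_1 by (simp add: eq_divide_eq)
  qed
  then show ?thesis by (simp add: a_poly_def leval_lpb a_val_def bracket_def sum_divide_distrib)
qed

lemma leval_b_poly: "leval (b_poly n) z = b_val n z"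
proof -
  have "q powi (n - i) * w (n - i) * p (i - 1) = w i * w (n - i) * (q powi (n - i) * (1 - q powi i)) / (1 - t)" for i
  proof -
    have "(1 - t) * p (i - 1) = (1 - q powi i) * w i" using p_w[of "i - 1"] w_rec[of i] by simp
    then have "p (i - 1) = (1 - q powi i) * w i / (1 - t)" using t_neq_1 by (simp add: field_simps)
    then show ?thesis by simp
  qed
  then show ?thesis by (simp add: b_poly_def leval_lpb b_val_def bracket_def sum_divide_distrib)
qed

text \<open>The left side is expanded in two ways, by 2 for the summand z and by 3 for the summand
  1/z; the four brackets P, Q, P', Q' then recombine into the neighbouring polynomials.\<close>

lemma rogers_pieri:
  assumes z: "z \<noteq> 0"
  shows "(1 - t * q powi n) * (z + inverse z) * rogers n z =
    (1 - q powi (n + 1)) * rogers (n + 1) z + (1 - t\<^sup>2 * q powi (n - 1)) * rogers (n - 1) z"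
proof -
  define P where "P = bracket n (\<lambda>x y. 1 - t * x) z"
  define Q where "Q = bracket n (\<lambda>x y. (1 - t * y) * x) z"
  define P' where "P' = bracket (n - 1) (\<lambda>x y. 1 - t * x) z"
  define Q' where "Q' = bracket (n - 1) (\<lambda>x y. (1 - t * y) * x) z"
  have 1: "(1 - q powi (n + 1)) * rogers (n + 1) z = z * P + inverse z * Q"
  proof -
    have "(1 - q powi (n + 1)) * rogers (n + 1) z = bracket (n + 1) (\<lambda>x y. 1 - x * y) z"
      by (rule bracket_scale[symmetric]) simp
    also have "\<dots> = 1 * bracket (n + 1) (\<lambda>x y. (1 - x) * 1) z + 1 * bracket (n + 1) (\<lambda>x y. (1 - y) * x) z"
      by (rule bracket_lin) (simp add: algebra_simps)
    finally show ?thesis unfolding bracket_shift_right[OF z] bracket_shift_left[OF z] by (simp add: P_def Q_def)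
  qed
  have 2: "(1 - t * q powi n) * rogers n z = P + t * (inverse z * Q')"
  proof -
    have "(1 - t * q powi n) * rogers n z = bracket n (\<lambda>x y. 1 - t * (x * y)) z"
      by (rule bracket_scale[symmetric]) simp
    also have "\<dots> = 1 * bracket n (\<lambda>x y. 1 - t * x) z + t * bracket n (\<lambda>x y. (1 - y) * x) z"
      by (rule bracket_lin) (simp add: algebra_simps)
    finally show ?thesis using bracket_shift_right[OF z, of "n - 1" "\<lambda>x y. x"] by (simp add: P_def Q'_def)
  qed
  have 3: "(1 - t * q powi n) * rogers n z = z * P' + Q"
  proof -
    have "(1 - t * q powi n) * rogers n z = bracket n (\<lambda>x y. 1 - t * (x * y)) z"
      by (rule bracket_scale[symmetric]) simp
    also have "\<dots> = 1 * bracket n (\<lambda>x y. (1 - x) * 1) z + 1 * bracket n (\<lambda>x y. (1 - t * y) * x) z"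
      by (rule bracket_lin) (simp add: algebra_simps)
    finally show ?thesis using bracket_shift_left[OF z, of "n - 1" "\<lambda>x y. 1"] by (simp add: P'_def Q_def)
  qed
  have 4: "(1 - t\<^sup>2 * q powi (n - 1)) * rogers (n - 1) z = t * Q' + P'"
  proof -
    have "(1 - t\<^sup>2 * q powi (n - 1)) * rogers (n - 1) z = bracket (n - 1) (\<lambda>x y. 1 - t\<^sup>2 * (x * y)) z"
      by (rule bracket_scale[symmetric]) simp
    also have "\<dots> = t * bracket (n - 1) (\<lambda>x y. (1 - t * y) * x) z + 1 * bracket (n - 1) (\<lambda>x y. 1 - t * x) z"
      by (rule bracket_lin) (simp add: algebra_simps power2_eq_square)
    finally show ?thesis by (simp add: Q'_def P'_def)
  qed
  have "(1 - t * q powi n) * (z + inverse z) * rogers n z =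
    z * ((1 - t * q powi n) * rogers n z) + inverse z * ((1 - t * q powi n) * rogers n z)"
    by (simp add: algebra_simps)
  also have "\<dots> = z * (P + t * (inverse z * Q')) + inverse z * (z * P' + Q)" by (simp only: 2 flip: 3)
  also have "\<dots> = (z * P + inverse z * Q) + (t * Q' + P')" using z by (simp add: field_simps)
  finally show ?thesis unfolding 1 4 .
qed

lemma rogers_eq_a_val_b_val: "(1 - t * q powi n) * rogers n z = (1 - t) * (a_val n z + t * b_val n z)"
proof -
  have "(1 - t * q powi n) * rogers n z = bracket n (\<lambda>x y. 1 - t * (x * y)) z"
    by (rule bracket_scale[symmetric]) simp
  also have "\<dots> = 1 * bracket n (\<lambda>x y. 1 - t * y) z + t * bracket n (\<lambda>x y. y * (1 - x)) z"
    by (rule bracket_lin) (simp add: algebra_simps)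
  finally show ?thesis unfolding a_val_bracket[symmetric] b_val_bracket[symmetric] by (simp add: algebra_simps)
qed

text \<open>Dividing z by q^(1/2) inserts the weight y = q^(n - i), up to a power of r. Times 1 - t
  q^n this weight is a combination of those of \<open>a_val\<close> and \<open>b_val\<close>, with
  coefficients different from the ones for z itself.\<close>

lemma rogers_half_shift:
  assumes z: "z \<noteq> 0"
  shows "(1 - t * q powi n) * rogers n (z / r\<^sup>2) = (1 - t) * (r powi (2 * n) * a_val n z + r powi (- 2 * n) * b_val n z)"
proof -
  have "(z / r\<^sup>2) powi (2 * i - n) = r powi (- 2 * n) * q powi (n - i) * z powi (2 * i - n)" for i
  proof -
    have "(r\<^sup>2) powi (2 * i - n) = r powi (2 * (2 * i - n))" by (simp add: power_int_power)
    moreover have "r powi (- 2 * n) * q powi (n - i) * r powi (2 * (2 * i - n)) = 1"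
      using r_nonzero by (simp only: flip: r_powi power_int_add) (simp add: algebra_simps flip: power_int_add)
    ultimately show ?thesis using r_nonzero by (simp add: power_int_divide_distrib field_simps)
  qed
  then have "rogers n (z / r\<^sup>2) = r powi (- 2 * n) * bracket n (\<lambda>x y. y) z"
    by (simp add: bracket_def sum_distrib_left mult_ac)
  moreover have "(1 - t * q powi n) * bracket n (\<lambda>x y. y) z = q powi n * bracket n (\<lambda>x y. 1 - t * y) z + 1 * bracket n (\<lambda>x y. y * (1 - x)) z"
  proof -
    have "(1 - t * q powi n) * bracket n (\<lambda>x y. y) z = bracket n (\<lambda>x y. (1 - t * (x * y)) * y) z"
      by (rule bracket_scale[symmetric]) simp
    also have "\<dots> = q powi n * bracket n (\<lambda>x y. 1 - t * y) z + 1 * bracket n (\<lambda>x y. y * (1 - x)) z"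
      by (rule bracket_lin, drule sym) (simp add: algebra_simps)
    finally show ?thesis .
  qed
  moreover have "r powi (- 2 * n) * q powi n = r powi (2 * n)"
    using r_nonzero by (simp flip: r_powi power_int_add)
  ultimately show ?thesis unfolding a_val_bracket[symmetric] b_val_bracket[symmetric] by algebra
qed

text \<open>Brings the value at n - 1 back to index n. Together with \<open>b_val_shift\<close> this
  allows sums with shifted indices to be compared at one level n.\<close>

lemma a_val_shift:
  assumes z: "z \<noteq> 0"
  shows "(1 - t * q powi n) * (inverse z * a_val (n - 1) z) = (1 - q powi n) * a_val n z - (1 - t) * b_val n z"
proof -
  have "inverse z * bracket (n - 1) (\<lambda>x y. 1 - t * y) z = bracket n (\<lambda>x y. 1 - y) z"
    using bracket_shift_right[OF z, of "n - 1" "\<lambda>x y. 1"] by simp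
  moreover have "(1 - t * q powi n) * bracket n (\<lambda>x y. 1 - y) z = (1 - q powi n) * bracket n (\<lambda>x y. 1 - t * y) z + (- (1 - t)) * bracket n (\<lambda>x y. y * (1 - x)) z"
  proof -
    have "(1 - t * q powi n) * bracket n (\<lambda>x y. 1 - y) z = bracket n (\<lambda>x y. (1 - t * (x * y)) * (1 - y)) z"
      by (rule bracket_scale[symmetric]) simp
    also have "\<dots> = (1 - q powi n) * bracket n (\<lambda>x y. 1 - t * y) z + (- (1 - t)) * bracket n (\<lambda>x y. y * (1 - x)) z"
      by (rule bracket_lin, drule sym) (simp add: algebra_simps)
    finally show ?thesis .
  qed
  ultimately have "(1 - t * q powi n) * (inverse z * bracket (n - 1) (\<lambda>x y. 1 - t * y) z) =
      (1 - q powi n) * bracket n (\<lambda>x y. 1 - t * y) z + (- (1 - t)) * bracket n (\<lambda>x y. y * (1 - x)) z"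
    by (simp only:)
  then have "(1 - t) * ((1 - t * q powi n) * (inverse z * a_val (n - 1) z)) = (1 - t) * ((1 - q powi n) * a_val n z - (1 - t) * b_val n z)"
    unfolding a_val_bracket[symmetric] b_val_bracket[symmetric] by algebra
  then show ?thesis by (rule cancel_1_minus_t)
qed

lemma b_val_shift_bracket:
  assumes z: "z \<noteq> 0"
  shows "inverse z * b_val (n + 1) z = bracket n (\<lambda>x y. (1 - t * x) * y) z / (1 - t)"
  using bracket_shift_left[OF z, of n "\<lambda>x y. y"] z by (simp add: b_val_def mult.commute)

lemma b_val_shift:
  assumes z: "z \<noteq> 0"
  shows "(1 - t * q powi n) * (inverse z * b_val (n + 1) z) = (1 - t) * q powi n * a_val n z + (1 - t\<^sup>2 * q powi n) * b_val n z"
proof -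
  have "(1 - t * q powi n) * bracket n (\<lambda>x y. (1 - t * x) * y) z =
     ((1 - t) * q powi n) * bracket n (\<lambda>x y. 1 - t * y) z + (1 - t\<^sup>2 * q powi n) * bracket n (\<lambda>x y. y * (1 - x)) z"
  proof -
    have "(1 - t * q powi n) * bracket n (\<lambda>x y. (1 - t * x) * y) z = bracket n (\<lambda>x y. (1 - t * (x * y)) * ((1 - t * x) * y)) z"
      by (rule bracket_scale[symmetric]) simp
    also have "\<dots> = ((1 - t) * q powi n) * bracket n (\<lambda>x y. 1 - t * y) z + (1 - t\<^sup>2 * q powi n) * bracket n (\<lambda>x y. y * (1 - x)) z"
      by (rule bracket_lin, drule sym) (simp add: algebra_simps power2_eq_square)
    finally show ?thesis .
  qed
  moreover have "(1 - t) * (inverse z * b_val (n + 1) z) = bracket n (\<lambda>x y. (1 - t * x) * y) z"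
    unfolding b_val_shift_bracket[OF z] using t_neq_1 by simp
  ultimately have "(1 - t) * ((1 - t * q powi n) * (inverse z * b_val (n + 1) z)) =
      (1 - t) * ((1 - t) * q powi n * a_val n z + (1 - t\<^sup>2 * q powi n) * b_val n z)"
    unfolding a_val_bracket[symmetric] b_val_bracket[symmetric] by algebra
  then show ?thesis by (rule cancel_1_minus_t)
qed

text \<open>The factor 1 - t z^-2 turns the nonsymmetric value into Rogers polynomials of two
  neighbouring degrees; it is the origin of the denominator 1 - t \<Lambda>^-2 in the formula for
  \<Psi>.\<close>

lemma a_val_symmetrize:
  assumes z: "z \<noteq> 0"
  shows "(1 - t) * (1 - t * inverse z ^ 2) * a_val n z =
    (1 - t\<^sup>2 * q powi n) * rogers n z - t * (1 - q powi (n + 1)) * (inverse z * rogers (n + 1) z)"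
proof -
  have "inverse z * bracket n (\<lambda>x y. 1 - t * y) z = bracket (n + 1) (\<lambda>x y. 1 - y) z"
    using bracket_shift_right[OF z, of n "\<lambda>x y. 1"] by simp
  also have "bracket (n + 1) (\<lambda>x y. 1 - y) z = (1 - q powi (n + 1)) * rogers (n + 1) z + (- 1) * bracket (n + 1) (\<lambda>x y. (1 - x) * y) z"
    by (rule bracket_lin) (simp add: algebra_simps)
  also have "bracket (n + 1) (\<lambda>x y. (1 - x) * y) z = z * bracket n (\<lambda>x y. (1 - t * x) * y) z"
    by (rule bracket_shift_left[OF z])
  finally have 1: "inverse z * bracket n (\<lambda>x y. 1 - t * y) z = (1 - q powi (n + 1)) * rogers (n + 1) z - z * bracket n (\<lambda>x y. (1 - t * x) * y) z"
    by simp
  have "(1 - t\<^sup>2 * q powi n) * rogers n z = bracket n (\<lambda>x y. 1 - t\<^sup>2 * (x * y)) z"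
    by (rule bracket_scale[symmetric]) simp
  also have "\<dots> = 1 * bracket n (\<lambda>x y. 1 - t * y) z + t * bracket n (\<lambda>x y. (1 - t * x) * y) z"
    by (rule bracket_lin) (simp add: algebra_simps power2_eq_square)
  finally have 2: "(1 - t\<^sup>2 * q powi n) * rogers n z = bracket n (\<lambda>x y. 1 - t * y) z + t * bracket n (\<lambda>x y. (1 - t * x) * y) z" by simp
  have 3: "(1 - t) * a_val n z = bracket n (\<lambda>x y. 1 - t * y) z" using t_neq_1 by (simp add: a_val_def)
  have zi: "z * inverse z = 1" using z by simp
  show ?thesis using 1 2 3 zi by algebra
qed

lemma b_val_symmetrize:
  assumes z: "z \<noteq> 0"
  shows "(1 - t) * (1 - t * inverse z ^ 2) * b_val (n + 1) z =
    (1 - q powi (n + 1)) * rogers (n + 1) z - (1 - t\<^sup>2 * q powi n) * (inverse z * rogers n z)"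
proof -
  have "(1 - q powi (n + 1)) * rogers (n + 1) z = bracket (n + 1) (\<lambda>x y. 1 - x * y) z"
    by (rule bracket_scale[symmetric]) simp
  also have "\<dots> = 1 * bracket (n + 1) (\<lambda>x y. y * (1 - x)) z + 1 * bracket (n + 1) (\<lambda>x y. 1 - y) z"
    by (rule bracket_lin) (simp add: algebra_simps)
  also have "bracket (n + 1) (\<lambda>x y. 1 - y) z = inverse z * bracket n (\<lambda>x y. 1 - t * y) z"
    using bracket_shift_right[OF z, of n "\<lambda>x y. 1"] by simp
  finally have 1: "(1 - q powi (n + 1)) * rogers (n + 1) z = bracket (n + 1) (\<lambda>x y. y * (1 - x)) z + inverse z * bracket n (\<lambda>x y. 1 - t * y) z"
    by simp
  have "(1 - t\<^sup>2 * q powi n) * rogers n z = bracket n (\<lambda>x y. 1 - t\<^sup>2 * (x * y)) z"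
    by (rule bracket_scale[symmetric]) simp
  also have "\<dots> = 1 * bracket n (\<lambda>x y. 1 - t * y) z + t * bracket n (\<lambda>x y. (1 - t * x) * y) z"
    by (rule bracket_lin) (simp add: algebra_simps power2_eq_square)
  finally have 2: "(1 - t\<^sup>2 * q powi n) * rogers n z = bracket n (\<lambda>x y. 1 - t * y) z + t * bracket n (\<lambda>x y. (1 - t * x) * y) z" by simp
  have 3: "(1 - t) * b_val (n + 1) z = bracket (n + 1) (\<lambda>x y. y * (1 - x)) z" using t_neq_1 by (simp add: b_val_def)
  have 4: "(1 - t) * (inverse z * b_val (n + 1) z) = bracket n (\<lambda>x y. (1 - t * x) * y) z"
    unfolding b_val_shift_bracket[OF z] using t_neq_1 by simp
  show ?thesis using 1 2 3 4 by algebra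
qed

end

section \<open>Gaussian majorants and sums over the integers\<close>

lemma gauss_summable:
  fixes \<rho> B :: real
  assumes "0 \<le> \<rho>" "\<rho> < 1" "B \<ge> 0"
  shows "summable (\<lambda>n. \<rho> ^ n\<^sup>2 * B ^ n)"
proof (rule summable_comparison_test_ev)
  have "(\<lambda>n. \<rho> ^ n * B) \<longlonglongrightarrow> 0 * B"
    using assms by (intro tendsto_mult_right LIMSEQ_power_zero) auto
  then have "(\<lambda>n. \<rho> ^ n * B) \<longlonglongrightarrow> 0" by simp
  then have "eventually (\<lambda>n. \<rho> ^ n * B < 1 / 2) sequentially" by (rule order_tendstoD) simp
  then show "\<forall>\<^sub>F n in sequentially. norm (\<rho> ^ n\<^sup>2 * B ^ n) \<le> (1 / 2) ^ n"
  proof eventually_elim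
    case (elim n)
    have "norm (\<rho> ^ n\<^sup>2 * B ^ n) = (\<rho> ^ n * B) ^ n"
      using assms by (simp add: power_mult_distrib power2_eq_square power_mult)
    also have "\<dots> \<le> (1 / 2) ^ n" by (rule power_mono) (use elim assms in auto)
    finally show ?case .
  qed
  show "summable (\<lambda>n. (1 / 2 :: real) ^ n)" by (rule summable_geometric) simp
qed

lemma summable_on_int_abs:
  fixes f :: "nat \<Rightarrow> real"
  assumes "summable f" "\<And>n. f n \<ge> 0"
  shows "(\<lambda>i::int. f (nat \<bar>i\<bar>)) summable_on UNIV"
proof -
  have s: "f summable_on UNIV" using assms by (simp add: summable_on_UNIV_nonneg_real_iff)
  have 1: "(\<lambda>i::int. f (nat \<bar>i\<bar>)) summable_on {0..}"
    by (rule iffD1[OF summable_on_reindex_bij_witness[of UNIV nat int _ _ f] s]) auto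
  have 2: "(\<lambda>i::int. f (nat \<bar>i\<bar>)) summable_on {..0}"
    by (rule iffD1[OF summable_on_reindex_bij_witness[of UNIV "\<lambda>i. nat (- i)" "\<lambda>n. - int n" _ _ f] s]) auto
  have "{0..} \<union> {..0} = (UNIV :: int set)" by auto
  then show ?thesis using summable_on_union[OF 1 2] by simp
qed

lemma gauss_summable_int:
  fixes \<rho> B :: real
  assumes "0 \<le> \<rho>" "\<rho> < 1" "B \<ge> 0"
  shows "(\<lambda>i::int. \<rho> ^ nat (i\<^sup>2) * B ^ nat \<bar>i\<bar>) summable_on UNIV"
proof -
  have "nat (i\<^sup>2) = (nat \<bar>i\<bar>)\<^sup>2" for i :: int
    by (simp add: nat_power_eq[symmetric])
  then show ?thesis
    using summable_on_int_abs[OF gauss_summable[OF assms]] assms by simp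
qed

lemma norm_powi_le:
  fixes L :: complex
  assumes "norm L \<le> B" "norm (inverse L) \<le> B"
  shows "norm (L powi k) \<le> B ^ nat \<bar>k\<bar>"
proof (cases "k \<ge> 0")
  case True
  then show ?thesis using assms by (simp add: power_int_def norm_power power_mono)
next
  case False
  then show ?thesis using power_mono[OF assms(2), of "nat (- k)"] by (simp add: power_int_def norm_power norm_inverse)
qed

lemma infsum_shift_int:
  fixes f :: "int \<Rightarrow> complex"
  shows "infsum (\<lambda>i. f (i + a)) UNIV = infsum f UNIV"
  by (rule infsum_reindex_bij_witness[of _ "\<lambda>i. i - a" "\<lambda>i. i + a"]) auto

lemma summable_on_shift_int:
  fixes f :: "int \<Rightarrow> complex"
  shows "(\<lambda>i. f (i + a)) summable_on UNIV \<longleftrightarrow> f summable_on UNIV"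
  by (rule summable_on_reindex_bij_witness[of _ "\<lambda>i. i - a" "\<lambda>i. i + a"]) auto

lemma infsum_int_eq_suminf:
  fixes f :: "int \<Rightarrow> complex"
  assumes "f summable_on UNIV" "\<And>i. i < 0 \<Longrightarrow> f i = 0"
  shows "infsum f UNIV = suminf (\<lambda>n. f (int n))" "summable (\<lambda>n. f (int n))"
proof -
  have "(f has_sum infsum f UNIV) UNIV" using assms(1) by simp
  then have "(f has_sum infsum f UNIV) {0..}"
    by (rule has_sum_cong_neutral[THEN iffD1, rotated -1]) (use assms(2) in auto)
  then have "((\<lambda>n. f (int n)) has_sum infsum f UNIV) UNIV"
    by (rule has_sum_reindex_bij_witness[of _ int nat, THEN iffD1, rotated -1]) auto
  then have "(\<lambda>n. f (int n)) sums infsum f UNIV" by (rule has_sum_imp_sums)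
  then show "infsum f UNIV = suminf (\<lambda>n. f (int n))" "summable (\<lambda>n. f (int n))" by (simp_all add: sums_iff)
qed

subsection \<open>A second-order q-difference equation and its decaying solutions\<close>

text \<open>Iterating the inequality to infinity, where a tends to zero, leaves the geometric tail
  of the errors.\<close>

lemma tail_bound:
  fixes a :: "nat \<Rightarrow> real"
  assumes "a \<longlonglongrightarrow> 0" "\<And>n. a n \<le> a (Suc n) + c * \<rho> ^ n" "0 \<le> \<rho>" "\<rho> < 1" "c \<ge> 0"
  shows "a n \<le> c * \<rho> ^ n / (1 - \<rho>)"
proof -
  have *: "a n \<le> a (n + N) + c * \<rho> ^ n * (\<Sum>k<N. \<rho> ^ k)" for N
  proof (induction N)
    case (Suc N)
    then show ?case using assms(2)[of "n + N"] by (simp add: power_add algebra_simps)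
  qed simp
  have "a n \<le> a (n + N) + c * \<rho> ^ n / (1 - \<rho>)" for N
  proof -
    have "(\<Sum>k<N. \<rho> ^ k) \<le> (suminf (\<lambda>k. \<rho> ^ k))" using assms by (intro sum_le_suminf) auto
    then have "(\<Sum>k<N. \<rho> ^ k) \<le> 1 / (1 - \<rho>)" using assms by (simp add: suminf_geometric)
    then have "c * \<rho> ^ n * (\<Sum>k<N. \<rho> ^ k) \<le> c * \<rho> ^ n * (1 / (1 - \<rho>))"
      using assms by (intro mult_left_mono) auto
    then show ?thesis using *[of N] by simp
  qed
  moreover have "(\<lambda>N. a (n + N) + c * \<rho> ^ n / (1 - \<rho>)) \<longlonglongrightarrow> 0 + c * \<rho> ^ n / (1 - \<rho>)"
    using LIMSEQ_ignore_initial_segment[OF assms(1), of n] by (intro tendsto_add tendsto_const) (simp add: add.commute)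
  ultimately have "a n \<le> 0 + c * \<rho> ^ n / (1 - \<rho>)" by (intro LIMSEQ_le_const) auto
  then show ?thesis by simp
qed

text \<open>The left side is the difference operator with constant coefficients and characteristic
  roots L and 1/L; the right side perturbs it by an amount of size q^m.\<close>

definition qd_eq :: "complex \<Rightarrow> complex \<Rightarrow> complex \<Rightarrow> (int \<Rightarrow> complex) \<Rightarrow> bool" where
  "qd_eq q t L g \<longleftrightarrow> (\<forall>m. g (m - 2) + g m - (L + inverse L) * g (m - 1) =
     q powi m * (g m + t\<^sup>2 * g (m + 2) - (L + inverse L) * t * g (m + 1)))"

lemma qd_eq_lin:
  assumes "qd_eq q t L f" "qd_eq q t L g"
  shows "qd_eq q t L (\<lambda>m. a * f m + b * g m)"
  unfolding qd_eq_def
proof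
  fix m
  have "f (m - 2) + f m - (L + inverse L) * f (m - 1) =
     q powi m * (f m + t\<^sup>2 * f (m + 2) - (L + inverse L) * t * f (m + 1))"
    "g (m - 2) + g m - (L + inverse L) * g (m - 1) =
     q powi m * (g m + t\<^sup>2 * g (m + 2) - (L + inverse L) * t * g (m + 1))"
    using assms by (simp_all add: qd_eq_def)
  then show "a * f (m - 2) + b * g (m - 2) + (a * f m + b * g m) - (L + inverse L) * (a * f (m - 1) + b * g (m - 1)) =
    q powi m * (a * f m + b * g m + t\<^sup>2 * (a * f (m + 2) + b * g (m + 2)) - (L + inverse L) * t * (a * f (m + 1) + b * g (m + 1)))"
    by algebra
qed

text \<open>The operator on the left factors into e(j) = d(j+1) - L d(j) and e(j+1) - e(j) / L, both
  with multipliers of modulus one. Summing each of them from infinity bounds the largest |d| beyond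
  m0 by a proper fraction of itself.\<close>

lemma qd_eq_unique:
  assumes q: "norm q < 1" and L: "norm L = 1" and eq: "qd_eq q t L d"
    and lim: "(\<lambda>n. d (int n)) \<longlonglongrightarrow> 0"
  shows "d m = 0"
proof -
  have L0: "L \<noteq> 0" using L by auto
  have rec: "d (m - 2) + d m - (L + inverse L) * d (m - 1) =
     q powi m * (d m + t\<^sup>2 * d (m + 2) - (L + inverse L) * t * d (m + 1))" for m
    using eq by (simp add: qd_eq_def)
  define \<rho> where "\<rho> = norm q"
  define C where "C = 1 + (norm t)\<^sup>2 + 2 * norm t"
  have \<rho>: "0 \<le> \<rho>" "\<rho> < 1" using q by (auto simp: \<rho>_def)
  have C: "C > 0" by (simp add: C_def add_pos_nonneg)
  \<comment> \<open>C bounds the coefficients of the perturbation, and each of the two summations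
    costs a factor 1 / (1 - \<rho>); m0 is taken so far out that the combined factor is below
    1.\<close>
  have "(\<lambda>n. C * \<rho> ^ n / (1 - \<rho>) / (1 - \<rho>)) \<longlonglongrightarrow> C * 0 / (1 - \<rho>) / (1 - \<rho>)"
    using \<rho> by (intro tendsto_intros LIMSEQ_power_zero) auto
  then have "eventually (\<lambda>n. C * \<rho> ^ n / (1 - \<rho>) / (1 - \<rho>) < 1) sequentially"
    by (intro order_tendstoD) auto
  then obtain m0 where m0: "C * \<rho> ^ m0 / (1 - \<rho>) / (1 - \<rho>) < 1" by (auto simp: eventually_sequentially)
  define D where "D n = norm (d (int (m0 + n)))" for n
  have D0: "D \<longlonglongrightarrow> 0"
    using tendsto_norm[OF LIMSEQ_ignore_initial_segment[OF lim, of m0]] by (simp add: D_def[abs_def] add.commute)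
  have zero: "D n = 0" for n
  proof (rule ccontr)
    assume n: "D n \<noteq> 0"
    then have Dn: "D n > 0" by (simp add: D_def)
    obtain N where N: "\<And>k. k \<ge> N \<Longrightarrow> D k < D n"
      using order_tendstoD(2)[OF D0 Dn] by (auto simp: eventually_sequentially)
    \<comment> \<open>Since D tends to zero, the supremum over all indices is a maximum over
      finitely many; the contraction is applied at an index k where it is attained.\<close>
    define \<mu> where "\<mu> = Max (D ` {..max N n})"
    have \<mu>: "D k \<le> \<mu>" for k
    proof (cases "k \<le> max N n")
      case True
      then show ?thesis by (simp add: \<mu>_def)
    next
      case False
      then have "D k \<le> D n" using N[of k] by (simp add: less_imp_le)
      also have "D n \<le> \<mu>" by (simp add: \<mu>_def)
      finally show ?thesis .
    qed
    have "\<mu> \<in> D ` {..max N n}" unfolding \<mu>_def by (rule Max_in) auto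
    then obtain k where k: "\<mu> = D k" by auto
    have \<mu>0: "\<mu> > 0" using \<mu>[of n] Dn by simp
    define e where "e j = d (int (m0 + Suc j)) - L * d (int (m0 + j))" for j
    have e0: "(\<lambda>j. norm (e j)) \<longlonglongrightarrow> 0"
    proof -
      have "(\<lambda>j. d (int (j + Suc m0)) - L * d (int (j + m0))) \<longlonglongrightarrow> 0 - L * 0"
        by (intro tendsto_diff tendsto_mult tendsto_const LIMSEQ_ignore_initial_segment[OF lim])
      then have "e \<longlonglongrightarrow> 0" by (simp add: e_def[abs_def] add_ac)
      from tendsto_norm[OF this] show ?thesis by simp
    qed
    have eb: "norm (e j) \<le> norm (e (Suc j)) + (C * \<mu> * \<rho> ^ (m0 + 2)) * \<rho> ^ j" for j
    proof -
      define n where "n = m0 + Suc (Suc j)"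
      let ?R = "d (int n) + t\<^sup>2 * d (int (n + 2)) - (L + inverse L) * t * d (int (n + 1))"
      have i: "int n - 2 = int (m0 + j)" "int n - 1 = int (m0 + Suc j)" "int n + 2 = int (n + 2)" "int n + 1 = int (n + 1)"
        by (simp_all add: n_def)
      have "e (Suc j) - inverse L * e j = d (int n - 2) + d (int n) - (L + inverse L) * d (int n - 1)"
        unfolding i using L0 by (simp add: e_def n_def algebra_simps)
      also have "\<dots> = q ^ n * ?R" unfolding rec[of "int n"] i(3,4) by simp
      finally have "inverse L * e j = e (Suc j) - q ^ n * ?R" by (simp add: algebra_simps)
      then have "norm (e j) = norm (e (Suc j) - q ^ n * ?R)"
        using L by (metis norm_inverse norm_mult inverse_1 mult_1)
      also have "\<dots> \<le> norm (e (Suc j)) + \<rho> ^ n * norm ?R"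
        using norm_triangle_ineq4[of "e (Suc j)" "q ^ n * ?R"] by (simp add: norm_mult norm_power \<rho>_def)
      also have "norm ?R \<le> C * \<mu>"
      proof -
        have b: "norm (d (int n)) \<le> \<mu>" "norm (d (int (n + 2))) \<le> \<mu>" "norm (d (int (n + 1))) \<le> \<mu>"
          using \<mu>[of "Suc (Suc j)"] \<mu>[of "Suc (Suc j) + 2"] \<mu>[of "Suc (Suc j) + 1"] by (simp_all add: D_def n_def add_ac)
        have LL: "norm (L + inverse L) \<le> 2" using norm_triangle_ineq[of L "inverse L"] L by (simp add: norm_inverse)
        have "norm ?R \<le> norm (d (int n)) + norm (t\<^sup>2 * d (int (n + 2))) + norm ((L + inverse L) * t * d (int (n + 1)))"
          using norm_triangle_ineq4[of "d (int n) + t\<^sup>2 * d (int (n + 2))" "(L + inverse L) * t * d (int (n + 1))"]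
            norm_triangle_ineq[of "d (int n)" "t\<^sup>2 * d (int (n + 2))"] by linarith
        also have "\<dots> \<le> \<mu> + (norm t)\<^sup>2 * \<mu> + 2 * norm t * \<mu>"
          unfolding norm_mult norm_power
          by (intro add_mono mult_mono b LL order.refl) (use \<mu>0 in auto)
        finally show ?thesis by (simp add: C_def algebra_simps)
      qed
      then have "\<rho> ^ n * norm ?R \<le> \<rho> ^ n * (C * \<mu>)" using \<rho> by (intro mult_left_mono) auto
      finally show ?thesis by (simp add: n_def power_add mult_ac)
    qed
    have eb': "norm (e j) \<le> (C * \<mu> * \<rho> ^ (m0 + 2)) * \<rho> ^ j / (1 - \<rho>)" for j
      by (rule tail_bound[OF e0 eb]) (use \<rho> C \<mu>0 in auto)
    have db: "D j \<le> D (Suc j) + (C * \<mu> * \<rho> ^ (m0 + 2) / (1 - \<rho>)) * \<rho> ^ j" for j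
    proof -
      have "L * d (int (m0 + j)) = d (int (m0 + Suc j)) - e j" by (simp add: e_def)
      then have "D j = norm (d (int (m0 + Suc j)) - e j)"
        using L by (metis D_def norm_mult mult_1)
      also have "\<dots> \<le> D (Suc j) + norm (e j)" unfolding D_def by (rule norm_triangle_ineq4)
      finally show ?thesis using eb'[of j] by simp
    qed
    have "D k \<le> (C * \<mu> * \<rho> ^ (m0 + 2) / (1 - \<rho>)) * \<rho> ^ k / (1 - \<rho>)"
      by (rule tail_bound[OF D0 db]) (use \<rho> C \<mu>0 in auto)
    also have "\<dots> = (C * \<mu> * \<rho> ^ m0 / (1 - \<rho>) / (1 - \<rho>)) * \<rho> ^ (k + 2)" by (simp add: power_add)
    also have "\<dots> \<le> (C * \<mu> * \<rho> ^ m0 / (1 - \<rho>) / (1 - \<rho>)) * 1"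
      using \<rho> C \<mu>0 by (intro mult_left_mono power_le_one) auto
    also have "\<dots> = (C * \<rho> ^ m0 / (1 - \<rho>) / (1 - \<rho>)) * \<mu>" by simp
    also have "\<dots> < 1 * \<mu>" using m0 \<mu>0 by (intro mult_strict_right_mono)
    finally show False using k by simp
  qed
  have up: "d i = 0" if "i \<ge> int m0" for i
  proof -
    have "i = int (m0 + nat (i - int m0))" using that by simp
    then show ?thesis using zero[of "nat (i - int m0)"] unfolding D_def by (metis norm_eq_zero)
  qed
  \<comment> \<open>Solved for its lowest term d (m - 2), the equation carries the zeros from m0
    down to all smaller indices.\<close>
  have "\<forall>i\<ge>int m0 - int k. d i = 0" for k
  proof (induction k)
    case 0
    then show ?case using up by simp
  next
    case (Suc k)
    define z where "z = int m0 - int (Suc k)"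
    have z: "int m0 - int k = z + 1" by (simp add: z_def)
    have "d (z + 2 - 2) = 0"
      using rec[of "z + 2"] Suc unfolding z by simp
    then have "d z = 0" by simp
    then show ?case using Suc unfolding z z_def[symmetric] by (metis zle_add1_eq_le zless_add1_eq order_le_less add1_zle_eq)
  qed
  from this[of "nat (int m0 - m)"] show ?thesis by simp
qed

section \<open>Coefficients of \<Phi> in powers of X\<close>

context main_params
begin

text \<open>The quantity (q; q)_n / (t^2; q)_n into which the reciprocal norm of P_n turns, up to (1
  - t q^n) / (1 - t), when the polynomials are rescaled to \<open>rogers\<close>.\<close>

definition Rn :: "int \<Rightarrow> complex" where
  "Rn n = (if n < 0 then 0 else 1 / wq q (t\<^sup>2) n)"

text \<open>With n = m + 2i the coefficient of X^m in \<open>rogers n X\<close> is w i * w (m + i),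
  and splitting q^(n^2/4) t^(n/2) leaves the powers of q and t shown. The offset e admits the
  neighbouring polynomials that the Pieri rule produces.\<close>

definition bracket_term :: "int \<Rightarrow> complex \<Rightarrow> int \<Rightarrow> int \<Rightarrow> complex" where
  "bracket_term e L m i = q powi (i\<^sup>2 + m * i) * t powi i * w i * w (m + i) * rogers (m + 2 * i + e) L"

definition Phi_coeff_term :: "complex \<Rightarrow> int \<Rightarrow> int \<Rightarrow> complex" where
  "Phi_coeff_term L m i = Rn (m + 2 * i) * (1 - t * q powi (m + 2 * i)) * bracket_term 0 L m i"

text \<open>Up to the factor \<open>q^(m^2/4) t^(m/2) / (1 - t)\<close>, the coefficient of \<open>X\<^sup>m\<close> in \<open>\<Phi>(X, L)\<close>.\<close>

definition Phi_coeff :: "complex \<Rightarrow> int \<Rightarrow> complex" where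
  "Phi_coeff L m = infsum (Phi_coeff_term L m) UNIV"

lemma wt2_nonzero: "n \<ge> 0 \<Longrightarrow> wq q (t\<^sup>2) n \<noteq> 0"
proof -
  have "t\<^sup>2 * q ^ l \<noteq> 1" for l
  proof (cases l)
    case 0
    have "(t - 1) * (t + 1) \<noteq> 0" using t_neq_1 t_neq_minus_1 by (simp add: add.commute)
    then show ?thesis by (simp add: 0 algebra_simps power2_eq_square)
  qed (use t2_power[of l] in auto)
  then show "n \<ge> 0 \<Longrightarrow> wq q (t\<^sup>2) n \<noteq> 0" by (simp add: wq_def qq_nonzero qpoch_nonzero)
qed

lemma Rn_rec:
  assumes "n \<ge> 0"
  shows "Rn (n + 1) * (1 - t\<^sup>2 * q powi n) = Rn n * (1 - q powi (n + 1))"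
proof -
  have "(1 - q powi (n + 1)) * wq q (t\<^sup>2) (n + 1) = (1 - t\<^sup>2 * q powi n) * wq q (t\<^sup>2) n"
    using wq_rec[of q "n + 1" "t\<^sup>2", OF q_power] by simp
  then show ?thesis using assms wt2_nonzero[of n] wt2_nonzero[of "n + 1"]
    by (simp add: Rn_def frac_eq_eq mult.commute)
qed

text \<open>The recurrence of \<open>Rn\<close> breaks at the index -1, where \<open>Rn\<close>
  jumps from 0 to 1; the product of the two w vanishes there. In \<open>Rn_rogers\<close> the Rogers
  polynomial of index -1 plays the same part.\<close>

lemma Rn_w: "w i * w k * (Rn (i + k) * (1 - q powi (i + k + 1))) = w i * w k * (Rn (i + k + 1) * (1 - t\<^sup>2 * q powi (i + k)))"
proof (cases "i \<ge> 0 \<and> k \<ge> 0")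
  case True
  then show ?thesis using Rn_rec[of "i + k"] by simp
qed auto

lemma Rn_rogers: "rogers n L * (Rn (n + 1) * (1 - t\<^sup>2 * q powi n)) = rogers n L * (Rn n * (1 - q powi (n + 1)))"
proof (cases "n \<ge> 0")
  case True
  then show ?thesis using Rn_rec[of n] by simp
qed (simp add: bracket_def)

lemma Rn_bounded: obtains M where "M > 0" "\<And>n. norm (Rn n) \<le> M"
proof -
  have "(\<lambda>n. wq q (t\<^sup>2) (int n)) \<longlonglongrightarrow> qinf q (t\<^sup>2) / qinf q q" by (rule wq_LIMSEQ[OF q_norm])
  moreover have nz: "qinf q (t\<^sup>2) / qinf q q \<noteq> 0"
  proof -
    have "t\<^sup>2 * q ^ l \<noteq> 1" for l
    proof
      assume a: "t\<^sup>2 * q ^ l = 1"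
      then have "wq q (t\<^sup>2) (int (Suc l)) = 0" unfolding wq_of_nat by (simp add: qpoch_Suc)
      then show False using wt2_nonzero[of "int (Suc l)"] by simp
    qed
    then show ?thesis using qinf_nonzero[OF q_norm, of "t\<^sup>2"] qinf_qq_nonzero[OF q_norm] by simp
  qed
  ultimately have "(\<lambda>n. 1 / wq q (t\<^sup>2) (int n)) \<longlonglongrightarrow> 1 / (qinf q (t\<^sup>2) / qinf q q)"
    by (intro tendsto_divide tendsto_const)
  then have "Bseq (\<lambda>n. 1 / wq q (t\<^sup>2) (int n))" by (intro convergent_imp_Bseq convergentI)
  then obtain M where M: "M > 0" "\<And>n. norm (1 / wq q (t\<^sup>2) (int n)) \<le> M" by (auto simp: Bseq_def)
  have "norm (Rn n) \<le> M" for n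
    using M(2)[of "nat n"] M(1) by (cases "n < 0") (auto simp: Rn_def)
  with M(1) show ?thesis by (rule that)
qed

lemma qinf_t2_nonzero: "qinf q (t\<^sup>2) \<noteq> 0"
proof (rule qinf_nonzero[OF q_norm])
  fix l show "t\<^sup>2 * q ^ l \<noteq> 1"
  proof
    assume a: "t\<^sup>2 * q ^ l = 1"
    then have "wq q (t\<^sup>2) (int (Suc l)) = 0" unfolding wq_of_nat by (simp add: qpoch_Suc)
    then show False using wt2_nonzero[of "int (Suc l)"] by simp
  qed
qed

lemma Rn_LIMSEQ: "(\<lambda>n. Rn (int n)) \<longlonglongrightarrow> qinf q q / qinf q (t\<^sup>2)"
proof -
  have "(\<lambda>n. 1 / wq q (t\<^sup>2) (int n)) \<longlonglongrightarrow> 1 / (qinf q (t\<^sup>2) / qinf q q)"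
    by (intro tendsto_divide tendsto_const wq_LIMSEQ q_norm) (use qinf_t2_nonzero qinf_qq_nonzero[OF q_norm] in auto)
  then show ?thesis by (simp add: Rn_def[abs_def])
qed

lemma rogers_bound:
  obtains K where "K > 0" "\<And>n L B. B \<ge> 1 \<Longrightarrow> norm L \<le> B \<Longrightarrow> norm (inverse L) \<le> B \<Longrightarrow>
    norm (rogers (int n) L) \<le> K * (real n + 1) * B ^ n"
proof -
  obtain M where M: "M > 0" "\<And>i. norm (w i) \<le> M" using wq_bounded[OF q_norm, of t] by auto
  have "norm (rogers (int n) L) \<le> (M * M) * (real n + 1) * B ^ n"
    if B: "B \<ge> 1" "norm L \<le> B" "norm (inverse L) \<le> B" for n L B
  proof -
    have "norm (rogers (int n) L) \<le> (\<Sum>i\<in>{0..int n}. M * M * B ^ n)"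
      unfolding bracket_def
    proof (rule sum_norm_le)
      fix i assume i: "i \<in> {0..int n}"
      have "norm (L powi (2 * i - int n)) \<le> B ^ nat \<bar>2 * i - int n\<bar>" by (rule norm_powi_le[OF B(2,3)])
      also have "\<dots> \<le> B ^ n" by (rule power_increasing) (use i B in auto)
      finally show "norm (w i * w (int n - i) * 1 * L powi (2 * i - int n)) \<le> M * M * B ^ n"
        unfolding mult_1_right norm_mult using M by (intro mult_mono) auto
    qed
    also have "\<dots> = (M * M) * (real n + 1) * B ^ n" by simp
    finally show ?thesis .
  qed
  then show ?thesis using M(1) by (intro that[of "M * M"]) auto
qed

text \<open>Uniform over the annulus 1/B \<le> |L| \<le> B, since the bound serves summability and,
  later, holomorphy in L. The linear factor n + 1 of \<open>rogers_bound\<close> is absorbed into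
  2^n.\<close>

lemma bracket_term_bound:
  assumes B: "B \<ge> 1"
  obtains K D where "K > 0" "D > 0" "\<And>e i L. e \<in> {-1, 0, 1} \<Longrightarrow> L \<noteq> 0 \<Longrightarrow> norm L \<le> B \<Longrightarrow> norm (inverse L) \<le> B \<Longrightarrow>
    norm (bracket_term e L m i) \<le> K * (norm q ^ nat (i\<^sup>2) * D ^ nat \<bar>i\<bar>)"
proof -
  obtain M where M: "M > 0" "\<And>i. norm (w i) \<le> M" using wq_bounded[OF q_norm, of t] by auto
  obtain C where C: "C > 0" "\<And>n L B. B \<ge> 1 \<Longrightarrow> norm L \<le> B \<Longrightarrow> norm (inverse L) \<le> B \<Longrightarrow>
    norm (rogers (int n) L) \<le> C * (real n + 1) * B ^ n" using rogers_bound by blast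
  define D where "D = norm (q powi m) * norm t * (2 * B)\<^sup>2"
  define K where "K = M * M * (C * (2 * B) ^ (nat \<bar>m\<bar> + 1))"
  have Cb: "norm (rogers n L) \<le> C * (2 * B) ^ nat \<bar>n\<bar>" if L: "norm L \<le> B" "norm (inverse L) \<le> B" for n L
  proof (cases "n \<ge> 0")
    case True
    then obtain k where k: "n = int k" by (metis nonneg_int_cases)
    have "norm (rogers n L) \<le> C * (real k + 1) * B ^ k" using C(2)[OF B L] by (simp add: k)
    also have "real k + 1 \<le> 2 ^ k" by (induction k) auto
    then have "C * (real k + 1) * B ^ k \<le> C * 2 ^ k * B ^ k" using C(1) B by (intro mult_mono) auto
    finally show ?thesis by (simp add: k power_mult_distrib mult.assoc)
  next
    case False
    then show ?thesis using C(1) B by (simp add: bracket_def)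
  qed
  have "norm (bracket_term e L m i) \<le> K * (norm q ^ nat (i\<^sup>2) * D ^ nat \<bar>i\<bar>)"
    if e: "e \<in> {-1, 0, 1}" and L: "L \<noteq> 0" "norm L \<le> B" "norm (inverse L) \<le> B" for e i L
  proof (cases "i < 0")
    case True
    then show ?thesis using M C B q_nonzero t_nonzero by (simp add: bracket_term_def K_def D_def)
  next
    case False
    then obtain k where k: "i = int k" by (metis nonneg_int_cases not_le)
    have "norm (rogers (m + 2 * i + e) L) \<le> C * (2 * B) ^ nat \<bar>m + 2 * i + e\<bar>" by (rule Cb[OF L(2,3)])
    also have "\<dots> \<le> C * (2 * B) ^ (nat \<bar>m\<bar> + 1 + 2 * k)"
      using C(1) B e by (intro mult_left_mono power_increasing) (auto simp: k)
    finally have c: "norm (rogers (m + 2 * i + e) L) \<le> C * (2 * B) ^ (nat \<bar>m\<bar> + 1 + 2 * k)" .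
    have q1: "norm (q powi (i\<^sup>2 + m * i)) = norm q ^ nat (i\<^sup>2) * norm (q powi m) ^ k"
    proof -
      have "q powi (i\<^sup>2 + m * i) = q powi (i\<^sup>2) * (q powi m) powi i" by (simp add: q_powi_add power_int_mult)
      then show ?thesis by (simp add: norm_mult k power_int_def norm_power nat_power_eq)
    qed
    have t1: "norm (t powi i) = norm t ^ k" by (simp add: k norm_power)
    have "norm (bracket_term e L m i) \<le> (norm q ^ nat (i\<^sup>2) * norm (q powi m) ^ k) * norm t ^ k * M * M * (C * (2 * B) ^ (nat \<bar>m\<bar> + 1 + 2 * k))"
      unfolding bracket_term_def norm_mult q1 t1 by (intro mult_mono c M order.refl) (use M in auto)
    also have "\<dots> = K * (norm q ^ nat (i\<^sup>2) * D ^ nat \<bar>i\<bar>)"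
    proof -
      have p: "(2 * B) ^ (nat \<bar>m\<bar> + 1 + 2 * k) = (2 * B) ^ (nat \<bar>m\<bar> + 1) * ((2 * B)\<^sup>2) ^ k"
        by (simp only: power_add power_mult)
      have D: "D ^ k = norm (q powi m) ^ k * norm t ^ k * ((2 * B)\<^sup>2) ^ k"
        unfolding D_def by (rule trans[OF power_mult_distrib]) (simp only: power_mult_distrib[of "norm (q powi m)"])
      have "nat \<bar>i\<bar> = k" by (simp add: k)
      then show ?thesis unfolding p K_def by (simp only: D mult_ac)
    qed
    finally show ?thesis .
  qed
  moreover have "K > 0" "D > 0" using M C B q_nonzero t_nonzero by (auto simp: K_def D_def)
  ultimately show ?thesis by (rule that[rotated 2])
qed

lemma bracket_term_summable:
  assumes L: "L \<noteq> 0" and c: "\<And>i. norm (c i) \<le> A" and e: "e \<in> {-1, 0, 1}"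
  shows "(\<lambda>i. c i * bracket_term e L m i) summable_on UNIV"
proof -
  define B where "B = max 1 (max (norm L) (norm (inverse L)))"
  have B: "B \<ge> 1" "norm L \<le> B" "norm (inverse L) \<le> B" by (auto simp: B_def)
  obtain K D where KD: "K > 0" "D > 0" "\<And>e i L. e \<in> {-1, 0, 1} \<Longrightarrow> L \<noteq> 0 \<Longrightarrow> norm L \<le> B \<Longrightarrow> norm (inverse L) \<le> B \<Longrightarrow>
    norm (bracket_term e L m i) \<le> K * (norm q ^ nat (i\<^sup>2) * D ^ nat \<bar>i\<bar>)"
    using bracket_term_bound[OF B(1), of m] by metis
  have A: "A \<ge> 0" using order.trans[OF norm_ge_zero c] .
  have "(\<lambda>i::int. A * K * (norm q ^ nat (i\<^sup>2) * D ^ nat \<bar>i\<bar>)) summable_on UNIV"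
    using gauss_summable_int[OF norm_ge_zero q_norm, of D] KD(2) by (intro summable_on_cmult_right) auto
  moreover have "norm (c i * bracket_term e L m i) \<le> A * K * (norm q ^ nat (i\<^sup>2) * D ^ nat \<bar>i\<bar>)" for i
    unfolding norm_mult mult.assoc using KD(3)[OF e L B(2,3), of i] c[of i] A by (intro mult_mono) auto
  ultimately have "(\<lambda>i. norm (c i * bracket_term e L m i)) summable_on UNIV"
    by (rule summable_on_comparison_test) auto
  then show ?thesis by (rule abs_summable_summable)
qed

lemma norm_q_powi_le: "k \<ge> -1 \<Longrightarrow> norm (q powi k) \<le> 1 / norm q"
proof -
  assume k: "k \<ge> -1"
  have "norm (q powi (k + 1)) \<le> 1" using k q_norm by (simp add: power_int_def norm_power power_le_one)
  then have "norm (q powi k) * norm q \<le> 1" using q_powi_add[of k 1] by (simp add: norm_mult)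
  then show ?thesis using q_nonzero by (simp add: field_simps)
qed

lemma coeff_bound:
  assumes M: "\<And>n. norm (Rn n) \<le> M" and l: "l \<ge> -1"
  shows "norm (Rn k * (1 - a * q powi (k + l))) \<le> M * (1 + norm a / norm q)"
proof (cases "k < 0")
  case True
  have "M \<ge> 0" using order.trans[OF norm_ge_zero M] .
  then show ?thesis using True by (simp add: Rn_def)
next
  case False
  have "norm (1 - a * q powi (k + l)) \<le> 1 + norm a * norm (q powi (k + l))"
    using norm_triangle_ineq4[of 1 "a * q powi (k + l)"] by (simp add: norm_mult)
  also have "\<dots> \<le> 1 + norm a * (1 / norm q)"
    using False l by (intro add_left_mono mult_left_mono norm_q_powi_le) auto
  finally have "norm (1 - a * q powi (k + l)) \<le> 1 + norm a / norm q" by simp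
  then show ?thesis unfolding norm_mult using M[of k] by (intro mult_mono) (auto intro: order.trans[OF norm_ge_zero M])
qed

lemma Phi_coeff_term_summable: "L \<noteq> 0 \<Longrightarrow> Phi_coeff_term L m summable_on UNIV"
proof -
  assume L: "L \<noteq> 0"
  obtain M where M: "M > 0" "\<And>n. norm (Rn n) \<le> M" using Rn_bounded by blast
  show ?thesis unfolding Phi_coeff_term_def[abs_def]
    by (rule bracket_term_summable[OF L]) (use coeff_bound[OF M(2), of 0 _ t] in auto)
qed

end

lemma has_sum_diff_group:
  fixes f g :: "'a \<Rightarrow> 'b :: topological_ab_group_add"
  assumes "(f has_sum a) A" "(g has_sum b) A"
  shows "((\<lambda>x. f x - g x) has_sum (a - b)) A"
  using has_sum_add[OF assms(1), of "\<lambda>x. - g x" "- b"] assms(2) by (simp add: has_sum_uminus)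

context main_params
begin

text \<open>After division by the common factor this is an identity between two-term products of the
  coefficients \<open>w i\<close>; it follows from the recurrence of \<open>w\<close> alone.\<close>

lemma Phi_coeff_term_pointwise:
  fixes m i :: int and L :: complex
  defines "n \<equiv> m + 2 * i"
  assumes L: "L \<noteq> 0"
  shows "Phi_coeff_term L (m - 2) (i + 1) + Phi_coeff_term L m i - q powi m * Phi_coeff_term L m i - q powi m * t\<^sup>2 * Phi_coeff_term L (m + 2) (i - 1) =
    Rn (n - 1) * (1 - q powi n) * bracket_term 1 L (m - 1) i
    + Rn (n + 1) * (1 - t\<^sup>2 * q powi n) * bracket_term (-1) L (m - 1) (i + 1)
    - t * q powi m * (Rn (n - 1) * (1 - q powi n) * bracket_term 1 L (m + 1) (i - 1)
        + Rn (n + 1) * (1 - t\<^sup>2 * q powi n) * bracket_term (-1) L (m + 1) i)"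
proof -
  define E where "E = q powi (i\<^sup>2 + m * i) * t powi i"
  define x where "x = q powi i"
  define y where "y = q powi (m + i)"
  define g where "g = q powi m"
  define qi where "qi = inverse q"
  define xi where "xi = inverse x"
  define yi where "yi = inverse y"
  define ti where "ti = inverse t"
  have inv: "qi * q = 1" "xi * x = 1" "yi * y = 1" "ti * t = 1"
    using q_nonzero t_nonzero by (simp_all add: qi_def xi_def x_def yi_def y_def ti_def)
  define C where "C = rogers n L"
  define R where "R = Rn n"
  define B0 where "B0 = w (i - 1)"
  define B1 where "B1 = w i"
  define B2 where "B2 = w (i + 1)"
  define K0 where "K0 = w (m + i - 1)"
  define K1 where "K1 = w (m + i)"
  define K2 where "K2 = w (m + i + 1)"
  have gx: "y = g * x" by (simp add: y_def g_def x_def q_powi_add)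
  have qn: "q powi n = x * y" unfolding n_def x_def y_def q_powi_add[symmetric] by (simp add: algebra_simps)
  have qn1: "q powi (n + 1) = x * y * q" by (simp add: q_powi_add qn)
  have qn0: "q powi (n - 1) = x * y * qi" using q_powi_add[of n "-1"] by (simp add: qn qi_def)
  have ti1: "t powi (i + 1) = t powi i * t" "t powi (i - 1) = t powi i * ti"
    using t_nonzero power_int_add[of t i "-1"] by (simp_all add: power_int_add ti_def)
  have rw: "(1 - q * x) * B2 = (1 - t * x) * B1" "(1 - x) * B1 = (1 - t * (x * qi)) * B0"
    using w_rec[of "i + 1"] w_rec[of i] q_powi_add[of i "-1"]
    by (simp_all add: q_powi_add x_def B2_def B1_def B0_def qi_def mult_ac)
  have rk: "(1 - q * y) * K2 = (1 - t * y) * K1" "(1 - y) * K1 = (1 - t * (y * qi)) * K0"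
    using w_rec[of "m + i + 1"] w_rec[of "m + i"] q_powi_add[of "m + i" "-1"] q_powi_add[of "m + i" 1]
    by (simp_all add: y_def K2_def K1_def K0_def qi_def mult_ac)
  have e: "q powi ((i + 1)\<^sup>2 + (m - 2) * (i + 1)) = q powi (i\<^sup>2 + m * i) * g * qi"
    "q powi ((i - 1)\<^sup>2 + (m + 2) * (i - 1)) * g = q powi (i\<^sup>2 + m * i) * qi"
    "q powi (i\<^sup>2 + (m - 1) * i) = q powi (i\<^sup>2 + m * i) * xi"
    "q powi ((i + 1)\<^sup>2 + (m - 1) * (i + 1)) = q powi (i\<^sup>2 + m * i) * y"
    "q powi ((i - 1)\<^sup>2 + (m + 1) * (i - 1)) = q powi (i\<^sup>2 + m * i) * yi"
    "q powi (i\<^sup>2 + (m + 1) * i) = q powi (i\<^sup>2 + m * i) * x"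
  proof -
    have qa: "q powi a = q powi b * q powi c" if "a = b + c" for a b c
      unfolding that by (rule q_powi_add)
    have g': "g * qi = q powi (m - 1)" using q_powi_add[of m "-1"] by (simp add: g_def qi_def)
    have "q powi ((i + 1)\<^sup>2 + (m - 2) * (i + 1)) = q powi (i\<^sup>2 + m * i) * q powi (m - 1)"
      by (rule qa) (simp add: algebra_simps power2_eq_square)
    then show "q powi ((i + 1)\<^sup>2 + (m - 2) * (i + 1)) = q powi (i\<^sup>2 + m * i) * g * qi"
      by (simp add: g'[symmetric])
    have "q powi ((i - 1)\<^sup>2 + (m + 2) * (i - 1)) * q powi m = q powi (i\<^sup>2 + m * i) * q powi (-1)"
      unfolding q_powi_add[symmetric] by (rule arg_cong[of _ _ "power_int q"]) (simp add: algebra_simps power2_eq_square)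
    then show "q powi ((i - 1)\<^sup>2 + (m + 2) * (i - 1)) * g = q powi (i\<^sup>2 + m * i) * qi"
      by (simp add: g_def qi_def)
    have "q powi (i\<^sup>2 + (m - 1) * i) = q powi (i\<^sup>2 + m * i) * q powi (- i)"
      by (rule qa) (simp add: algebra_simps power2_eq_square)
    then show "q powi (i\<^sup>2 + (m - 1) * i) = q powi (i\<^sup>2 + m * i) * xi"
      by (simp add: xi_def x_def power_int_minus)
    show "q powi ((i + 1)\<^sup>2 + (m - 1) * (i + 1)) = q powi (i\<^sup>2 + m * i) * y"
      unfolding y_def by (rule qa) (simp add: algebra_simps power2_eq_square)
    have "q powi ((i - 1)\<^sup>2 + (m + 1) * (i - 1)) = q powi (i\<^sup>2 + m * i) * q powi (- (m + i))"
      by (rule qa) (simp add: algebra_simps power2_eq_square)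
    then show "q powi ((i - 1)\<^sup>2 + (m + 1) * (i - 1)) = q powi (i\<^sup>2 + m * i) * yi"
      unfolding yi_def y_def power_int_minus .
    show "q powi (i\<^sup>2 + (m + 1) * i) = q powi (i\<^sup>2 + m * i) * x"
      unfolding x_def by (rule qa) (simp add: algebra_simps power2_eq_square)
  qed
  have idx: "m - 2 + 2 * (i + 1) = n" "m + 2 * i = n" "m + 2 + 2 * (i - 1) = n"
    "m - 1 + 2 * i + 1 = n" "m - 1 + 2 * (i + 1) + - 1 = n" "m + 1 + 2 * (i - 1) + 1 = n" "m + 1 + 2 * i + - 1 = n"
    "m - 2 + (i + 1) = m + i - 1" "m + 2 + (i - 1) = m + i + 1" "m - 1 + i = m + i - 1" "m - 1 + (i + 1) = m + i"
    "m + 1 + (i - 1) = m + i" "m + 1 + i = m + i + 1" "n + 0 = n"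
    by (simp_all add: n_def)
  have ii: "i + (m + i - 1) = n - 1" "i - 1 + (m + i) = n - 1" "n - 1 + 1 = n" by (simp_all add: n_def)
  have r1: "B1 * K0 * (Rn (n - 1) * (1 - x * y)) = B1 * K0 * (R * (1 - t\<^sup>2 * (x * y * qi)))"
    using Rn_w[of i "m + i - 1"] unfolding ii qn qn0 by (simp only: B1_def K0_def R_def)
  have r2: "B0 * K1 * (Rn (n - 1) * (1 - x * y)) = B0 * K1 * (R * (1 - t\<^sup>2 * (x * y * qi)))"
    using Rn_w[of "i - 1" "m + i"] unfolding ii qn qn0 by (simp only: B0_def K1_def R_def)
  have r3: "C * (Rn (n + 1) * (1 - t\<^sup>2 * (x * y))) = C * (R * (1 - x * y * q))"
    using Rn_rogers[of n L] unfolding qn qn1 by (simp add: C_def R_def)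
  \<comment> \<open>Splitting 1 - q x y, or 1 - t^2 x y / q, and applying the recurrences of w
    reduces every mixed product to B2 * K0, B1 * K1 and B0 * K2, the products that occur on the left
    side.\<close>
  have e1: "B2 * K1 * (1 - q * x * y) = y * (1 - t * x) * (B1 * K1) + (1 - t * (y * qi)) * (B2 * K0)"
    using rw rk by algebra
  have e2: "B1 * K2 * (1 - q * x * y) = x * (1 - t * y) * (B1 * K1) + (1 - t * (x * qi)) * (B0 * K2)"
    using rw rk by algebra
  have e3: "B1 * K0 * (1 - t\<^sup>2 * (x * y * qi)) = t * x * (1 - y) * (B1 * K1) + (1 - q * x) * (B2 * K0)"
    using rw rk inv(1) by algebra
  have e4: "B0 * K1 * (1 - t\<^sup>2 * (x * y * qi)) = t * y * (1 - x) * (B1 * K1) + (1 - q * y) * (B0 * K2)"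
    using rw rk inv(1) by algebra
  have e5: "(1 - q * x) * (1 - t * (y * qi)) * (B2 * K0) = (1 - t * x) * (1 - y) * (B1 * K1)"
    using rw rk by algebra
  have e6: "(1 - q * y) * (1 - t * (x * qi)) * (B0 * K2) = (1 - t * y) * (1 - x) * (B1 * K1)"
    using rw rk by algebra
  have key: "(1 - t * (x * y)) * (g * qi * t * (B2 * K0) + (1 - g) * (B1 * K1) - t * qi * (B0 * K2)) =
    xi * (B1 * K0 * (1 - t\<^sup>2 * (x * y * qi))) + t * y * (B2 * K1 * (1 - q * x * y))
     - t * g * (yi * ti * (B0 * K1 * (1 - t\<^sup>2 * (x * y * qi))) + x * (B1 * K2 * (1 - q * x * y)))"
  proof -
    have "g * yi = xi" using gx inv by algebra
    have tg: "t * g * (yi * ti * z) = xi * z" for z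
    proof -
      have "t * g * (yi * ti * z) = (g * yi) * (ti * t) * z" by (simp add: mult_ac)
      then show ?thesis using \<open>g * yi = xi\<close> inv(4) by simp
    qed
    have "x * ((1 - t * (x * y)) * (g * qi * t * (B2 * K0) + (1 - g) * (B1 * K1) - t * qi * (B0 * K2))) =
      x * (xi * (B1 * K0 * (1 - t\<^sup>2 * (x * y * qi))) + t * y * (B2 * K1 * (1 - q * x * y))
     - (xi * (B0 * K1 * (1 - t\<^sup>2 * (x * y * qi))) + t * g * x * (B1 * K2 * (1 - q * x * y))))"
      unfolding e1 e2 e3 e4 using inv gx e5 e6 by algebra
    moreover have "x \<noteq> 0" using inv by auto
    ultimately have eq': "(1 - t * (x * y)) * (g * qi * t * (B2 * K0) + (1 - g) * (B1 * K1) - t * qi * (B0 * K2)) =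
      xi * (B1 * K0 * (1 - t\<^sup>2 * (x * y * qi))) + t * y * (B2 * K1 * (1 - q * x * y))
     - (xi * (B0 * K1 * (1 - t\<^sup>2 * (x * y * qi))) + t * g * x * (B1 * K2 * (1 - q * x * y)))"
      by (simp only: mult_cancel_left simp_thms)
    have tg': "t * g * (yi * ti * z + x * z') = xi * z + t * g * x * z'" for z z'
      unfolding distrib_left tg by (simp only: mult.assoc)
    show ?thesis unfolding eq' tg' ..
  qed
  have t1: "Phi_coeff_term L (m - 2) (i + 1) = E * (g * qi * t) * (R * (1 - t * (x * y))) * (B2 * K0) * C"
    unfolding Phi_coeff_term_def bracket_term_def idx e ti1 E_def R_def qn B2_def K0_def C_def by (simp only: mult_ac)
  have t2: "Phi_coeff_term L m i = E * (R * (1 - t * (x * y))) * (B1 * K1) * C"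
    unfolding Phi_coeff_term_def bracket_term_def idx E_def R_def qn B1_def K1_def C_def by (simp only: mult_ac)
  have t3: "q powi m * t\<^sup>2 * Phi_coeff_term L (m + 2) (i - 1) = E * (t * qi) * (R * (1 - t * (x * y))) * (B0 * K2) * C"
  proof -
    have "q powi m * t\<^sup>2 * Phi_coeff_term L (m + 2) (i - 1) =
       (q powi ((i - 1)\<^sup>2 + (m + 2) * (i - 1)) * g) * (t powi (i - 1) * t\<^sup>2) * (R * (1 - t * (x * y))) * (B0 * K2) * C"
      unfolding Phi_coeff_term_def bracket_term_def idx R_def qn B0_def K2_def C_def g_def by (simp only: mult_ac)
    also have "t powi (i - 1) * t\<^sup>2 = t powi i * t" unfolding ti1 using inv(4) by algebra
    finally show ?thesis unfolding e by (simp add: E_def mult_ac)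
  qed
  have t4: "Rn (n - 1) * (1 - q powi n) * bracket_term 1 L (m - 1) i = E * xi * (B1 * K0 * (Rn (n - 1) * (1 - x * y))) * C"
    unfolding bracket_term_def idx e E_def qn B1_def K0_def C_def by (simp only: mult_ac)
  have t5: "Rn (n + 1) * (1 - t\<^sup>2 * q powi n) * bracket_term (-1) L (m - 1) (i + 1) = E * y * t * (B2 * K1) * (C * (Rn (n + 1) * (1 - t\<^sup>2 * (x * y))))"
    unfolding bracket_term_def idx e E_def ti1 qn B2_def K1_def C_def by (simp only: mult_ac)
  have t6: "Rn (n - 1) * (1 - q powi n) * bracket_term 1 L (m + 1) (i - 1) = E * yi * ti * (B0 * K1 * (Rn (n - 1) * (1 - x * y))) * C"
    unfolding bracket_term_def idx e E_def ti1 qn B0_def K1_def C_def by (simp only: mult_ac)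
  have t7: "Rn (n + 1) * (1 - t\<^sup>2 * q powi n) * bracket_term (-1) L (m + 1) i = E * x * (B1 * K2) * (C * (Rn (n + 1) * (1 - t\<^sup>2 * (x * y))))"
    unfolding bracket_term_def idx e E_def qn B1_def K2_def C_def by (simp only: mult_ac)
  have "Phi_coeff_term L (m - 2) (i + 1) + Phi_coeff_term L m i - q powi m * Phi_coeff_term L m i - q powi m * t\<^sup>2 * Phi_coeff_term L (m + 2) (i - 1) =
    E * R * C * ((1 - t * (x * y)) * (g * qi * t * (B2 * K0) + (1 - g) * (B1 * K1) - t * qi * (B0 * K2)))"
    unfolding t1 t2 t3[folded g_def] g_def[symmetric] by (simp add: algebra_simps)
  also have "\<dots> = Rn (n - 1) * (1 - q powi n) * bracket_term 1 L (m - 1) i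
    + Rn (n + 1) * (1 - t\<^sup>2 * q powi n) * bracket_term (-1) L (m - 1) (i + 1)
    - t * q powi m * (Rn (n - 1) * (1 - q powi n) * bracket_term 1 L (m + 1) (i - 1)
        + Rn (n + 1) * (1 - t\<^sup>2 * q powi n) * bracket_term (-1) L (m + 1) i)"
    unfolding key t4 t5 t6 t7 r1 r2 r3 g_def[symmetric] by (simp add: algebra_simps)
  finally show ?thesis .
qed

lemma Phi_coeff_term_pieri:
  assumes L: "L \<noteq> 0"
  shows "(L + inverse L) * Phi_coeff_term L m i =
     Rn (m + 2 * i) * (1 - q powi (m + 2 * i + 1)) * bracket_term 1 L m i
     + Rn (m + 2 * i) * (1 - t\<^sup>2 * q powi (m + 2 * i - 1)) * bracket_term (-1) L m i"
proof -
  have "(L + inverse L) * Phi_coeff_term L m i = Rn (m + 2 * i) * (q powi (i\<^sup>2 + m * i) * t powi i * w i * w (m + i)) *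
    ((1 - t * q powi (m + 2 * i)) * (L + inverse L) * rogers (m + 2 * i) L)"
    by (simp add: Phi_coeff_term_def bracket_term_def mult_ac)
  also have "\<dots> = Rn (m + 2 * i) * (1 - q powi (m + 2 * i + 1)) * bracket_term 1 L m i
     + Rn (m + 2 * i) * (1 - t\<^sup>2 * q powi (m + 2 * i - 1)) * bracket_term (-1) L m i"
    unfolding rogers_pieri[OF L] by (simp add: bracket_term_def algebra_simps)
  finally show ?thesis .
qed

text \<open>The termwise identity is summed over all integers i, where index shifts disappear. The
  Pieri rule collects the terms on its right into L + 1/L times the values at m - 1 and m +
  1.\<close>

lemma Phi_coeff_qd_eq:
  assumes L: "L \<noteq> 0"
  shows "qd_eq q t L (Phi_coeff L)"
  unfolding qd_eq_def
proof
  fix m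
  obtain M where M: "M > 0" "\<And>n. norm (Rn n) \<le> M" using Rn_bounded by blast
  define a where "a k i = Rn (k + 2 * i) * (1 - q powi (k + 2 * i + 1)) * bracket_term 1 L k i" for k i
  define b where "b k i = Rn (k + 2 * i) * (1 - t\<^sup>2 * q powi (k + 2 * i - 1)) * bracket_term (-1) L k i" for k i
  have sa: "a k summable_on UNIV" for k
    unfolding a_def
  proof (rule bracket_term_summable[OF L])
    show "norm (Rn (k + 2 * i) * (1 - q powi (k + 2 * i + 1))) \<le> M * (1 + norm (1 :: complex) / norm q)" for i
      using coeff_bound[OF M(2), of 1 "k + 2 * i" 1] by simp
  qed simp
  have sb: "b k summable_on UNIV" for k
    unfolding b_def by (rule bracket_term_summable[OF L]) (use coeff_bound[OF M(2), of "-1" _ "t\<^sup>2"] in auto)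
  note sg = Phi_coeff_term_summable[OF L]
  have ab: "(L + inverse L) * Phi_coeff L k = infsum (a k) UNIV + infsum (b k) UNIV" for k
  proof -
    have "(L + inverse L) * Phi_coeff L k = infsum (\<lambda>i. (L + inverse L) * Phi_coeff_term L k i) UNIV"
      unfolding Phi_coeff_def by (rule infsum_cmult_right[symmetric]) (use sg in auto)
    also have "\<dots> = infsum (\<lambda>i. a k i + b k i) UNIV"
      by (simp only: Phi_coeff_term_pieri[OF L] a_def b_def)
    also have "\<dots> = infsum (a k) UNIV + infsum (b k) UNIV" by (rule infsum_add[OF sa sb])
    finally show ?thesis .
  qed
  have pt: "Phi_coeff_term L (m - 2) (i + 1) + Phi_coeff_term L m i - q powi m * Phi_coeff_term L m i - q powi m * t\<^sup>2 * Phi_coeff_term L (m + 2) (i - 1) =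
     a (m - 1) i + b (m - 1) (i + 1) - t * q powi m * (a (m + 1) (i - 1) + b (m + 1) i)" for i
    unfolding Phi_coeff_term_pointwise[OF L] a_def b_def by (simp add: algebra_simps)
  have hsum: "(f has_sum infsum f UNIV) UNIV" if "f summable_on (UNIV :: int set)" for f :: "int \<Rightarrow> complex"
    using that by simp
  have hs1: "((\<lambda>i. f (i + c)) has_sum infsum f UNIV) UNIV" if "f summable_on (UNIV :: int set)" for f :: "int \<Rightarrow> complex" and c
    using that hsum[of "\<lambda>i. f (i + c)"] by (simp add: summable_on_shift_int infsum_shift_int)
  have hs2: "((\<lambda>i. f (i - 1)) has_sum infsum f UNIV) UNIV" if "f summable_on (UNIV :: int set)" for f :: "int \<Rightarrow> complex"
    using hs1[OF that, of "-1"] by simp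
  have 1: "((\<lambda>i. Phi_coeff_term L (m - 2) (i + 1) + Phi_coeff_term L m i - q powi m * Phi_coeff_term L m i - q powi m * t\<^sup>2 * Phi_coeff_term L (m + 2) (i - 1))
     has_sum (Phi_coeff L (m - 2) + Phi_coeff L m - q powi m * Phi_coeff L m - q powi m * t\<^sup>2 * Phi_coeff L (m + 2))) UNIV"
    unfolding Phi_coeff_def
    by (intro has_sum_add has_sum_diff_group has_sum_cmult_right hs1 hs2 hsum sg)
  have 2: "((\<lambda>i. a (m - 1) i + b (m - 1) (i + 1) - t * q powi m * (a (m + 1) (i - 1) + b (m + 1) i))
     has_sum (infsum (a (m - 1)) UNIV + infsum (b (m - 1)) UNIV - t * q powi m * (infsum (a (m + 1)) UNIV + infsum (b (m + 1)) UNIV))) UNIV"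
    by (intro has_sum_add has_sum_diff_group has_sum_cmult_right hs1 hs2 hsum sa sb)
  have "Phi_coeff L (m - 2) + Phi_coeff L m - q powi m * Phi_coeff L m - q powi m * t\<^sup>2 * Phi_coeff L (m + 2) =
     (L + inverse L) * Phi_coeff L (m - 1) - t * q powi m * ((L + inverse L) * Phi_coeff L (m + 1))"
    unfolding ab using has_sum_unique[OF 1[unfolded pt] 2] by simp
  then show "Phi_coeff L (m - 2) + Phi_coeff L m - (L + inverse L) * Phi_coeff L (m - 1) =
     q powi m * (Phi_coeff L m + t\<^sup>2 * Phi_coeff L (m + 2) - (L + inverse L) * t * Phi_coeff L (m + 1))"
    by algebra
qed

text \<open>The coefficient of the hypergeometric solution multiplied by (q L^2; q)\<infinity>. This
  cancels the denominator (q L^2; q)_j in \<open>hyp_prod\<close> and leaves no poles in L.\<close>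

definition qd_sol_coeff :: "complex \<Rightarrow> nat \<Rightarrow> complex" where
  "qd_sol_coeff L j = q ^ (j\<^sup>2 + j) * L ^ (2 * j) * w (int j) * qpoch q (t * L\<^sup>2) j * qinf q (q ^ Suc j * L\<^sup>2)"

definition qd_sol :: "complex \<Rightarrow> int \<Rightarrow> complex" where
  "qd_sol L m = L powi m * suminf (\<lambda>j. qd_sol_coeff L j * (q powi m) ^ j)"

lemma qd_sol_coeff_bound:
  assumes B: "B > 0"
  obtains K where "K > 0" "\<And>j L. norm L \<le> B \<Longrightarrow> norm (qd_sol_coeff L j) \<le> K * (norm q ^ j\<^sup>2 * (B\<^sup>2) ^ j)"
proof -
  obtain M where M: "M > 0" "\<And>i. norm (w i) \<le> M" using wq_bounded[OF q_norm, of t] by auto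
  let ?E = "\<lambda>a. exp (a / (1 - norm q))"
  have "norm (qd_sol_coeff L j) \<le> (M * ?E (norm t * B\<^sup>2) * ?E (B\<^sup>2)) * (norm q ^ j\<^sup>2 * (B\<^sup>2) ^ j)"
    if L: "norm L \<le> B" for j L
  proof -
    have L2: "norm (L\<^sup>2) \<le> B\<^sup>2" using L by (simp add: norm_power power_mono)
    have 1: "norm (q ^ (j\<^sup>2 + j)) \<le> norm q ^ j\<^sup>2"
      unfolding norm_power by (rule power_decreasing) (use q_norm in auto)
    have 2: "norm (L ^ (2 * j)) \<le> (B\<^sup>2) ^ j"
      unfolding power_mult norm_power[of "L\<^sup>2"] by (rule power_mono[OF L2]) simp
    have 3: "norm (qpoch q (t * L\<^sup>2) j) \<le> ?E (norm t * B\<^sup>2)"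
    proof (rule order.trans[OF qpoch_norm_le[OF q_norm]])
      have "norm (t * L\<^sup>2) \<le> norm t * B\<^sup>2" unfolding norm_mult by (rule mult_left_mono[OF L2]) simp
      then show "?E (norm (t * L\<^sup>2)) \<le> ?E (norm t * B\<^sup>2)" using q_norm by (simp add: divide_right_mono)
    qed
    have 4: "norm (qinf q (q ^ Suc j * L\<^sup>2)) \<le> ?E (B\<^sup>2)"
    proof (rule order.trans[OF qinf_norm_le[OF q_norm]])
      have "norm (q ^ Suc j) \<le> 1" unfolding norm_power by (rule power_le_one) (use q_norm in auto)
      then have "norm (q ^ Suc j) * norm (L\<^sup>2) \<le> 1 * B\<^sup>2" by (intro mult_mono L2) auto
      then have "norm (q ^ Suc j * L\<^sup>2) \<le> B\<^sup>2" by (simp only: norm_mult mult_1)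
      then show "?E (norm (q ^ Suc j * L\<^sup>2)) \<le> ?E (B\<^sup>2)" using q_norm by (simp add: divide_right_mono)
    qed
    have "norm (qd_sol_coeff L j) \<le> norm q ^ j\<^sup>2 * (B\<^sup>2) ^ j * M * ?E (norm t * B\<^sup>2) * ?E (B\<^sup>2)"
      unfolding qd_sol_coeff_def norm_mult[of "_ * _"] norm_mult[of "q ^ (j\<^sup>2 + j)"]
      by (intro mult_mono 1 2 3 4 M) (use M B in auto)
    then show ?thesis by (simp add: mult_ac)
  qed
  then show ?thesis using M(1) by (intro that[of "M * ?E (norm t * B\<^sup>2) * ?E (B\<^sup>2)"]) auto
qed

lemma qd_sol_coeff_summable: "summable (\<lambda>j. qd_sol_coeff L j * x ^ j)"
proof -
  obtain K where K: "K > 0" "\<And>j L'. norm L' \<le> norm L + 1 \<Longrightarrow> norm (qd_sol_coeff L' j) \<le> K * (norm q ^ j\<^sup>2 * ((norm L + 1)\<^sup>2) ^ j)"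
    using qd_sol_coeff_bound[of "norm L + 1"] by (metis add_nonneg_pos norm_ge_zero zero_less_one)
  show ?thesis
  proof (rule summable_comparison_test')
    show "summable (\<lambda>j. K * (norm q ^ j\<^sup>2 * ((norm L + 1)\<^sup>2 * norm x) ^ j))"
      by (intro summable_mult gauss_summable q_norm) auto
    show "norm (qd_sol_coeff L j * x ^ j) \<le> K * (norm q ^ j\<^sup>2 * ((norm L + 1)\<^sup>2 * norm x) ^ j)" for j
    proof -
      have "norm (qd_sol_coeff L j * x ^ j) = norm (qd_sol_coeff L j) * norm x ^ j" by (simp add: norm_mult norm_power)
      also have "\<dots> \<le> (K * (norm q ^ j\<^sup>2 * ((norm L + 1)\<^sup>2) ^ j)) * norm x ^ j"
        by (intro mult_right_mono K) auto
      finally show ?thesis by (simp add: power_mult_distrib mult_ac)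
    qed
  qed
qed

text \<open>Inserting L^m S(q^m) with a power series S into the q-difference equation yields this
  two-term recurrence. Inverse powers occur because the shifts m - 1 and m - 2 divide the argument
  of S by q.\<close>

lemma qd_sol_coeff_rec:
  assumes L: "L \<noteq> 0"
  shows "qd_sol_coeff L (Suc j) * (1 - inverse (q ^ Suc j)) * (1 - inverse (L\<^sup>2) * inverse (q ^ Suc j)) =
    qd_sol_coeff L j * (1 - t * q ^ j) * (1 - t * L\<^sup>2 * q ^ j)"
proof -
  define x where "x = q ^ j"
  define Q where "Q = qinf q (q ^ Suc (Suc j) * L\<^sup>2)"
  have Q: "qinf q (q ^ Suc j * L\<^sup>2) = (1 - q * x * L\<^sup>2) * Q"
    using qinf_shift[OF q_norm, of "q ^ Suc j * L\<^sup>2"] by (simp add: x_def Q_def mult_ac)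
  have W: "w (int (Suc j)) * (1 - q * x) = w (int j) * (1 - t * x)"
    using w_rec[of "int (Suc j)"] by (simp add: x_def mult_ac power_int_add q_nonzero)
  have e: "q ^ ((Suc j)\<^sup>2 + Suc j) = q ^ (j\<^sup>2 + j) * (q * x)\<^sup>2"
    unfolding x_def power_Suc[symmetric] power_mult[symmetric] power_add[symmetric]
    by (rule arg_cong[of _ _ "power q"]) (simp add: power2_eq_square)
  have x0: "x \<noteq> 0" using q_nonzero by (simp add: x_def)
  have "q ^ Suc j \<noteq> 0" using q_nonzero by simp
  then have inv: "inverse (q ^ Suc j) * (q * x) = 1" "inverse (L\<^sup>2) * L\<^sup>2 = 1"
    using L left_inverse[of "q ^ Suc j"] unfolding x_def power_Suc[symmetric] by (simp_all only: left_inverse power_not_zero not_False_eq_True)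
  have L2: "L ^ (2 * Suc j) = L ^ (2 * j) * L\<^sup>2" by (simp add: power2_eq_square)
  have P1: "qd_sol_coeff L (Suc j) = q ^ (j\<^sup>2 + j) * (q * x)\<^sup>2 * (L ^ (2 * j) * L\<^sup>2) * w (int (Suc j)) * (qpoch q (t * L\<^sup>2) j * (1 - t * L\<^sup>2 * x)) * Q"
    unfolding qd_sol_coeff_def e L2 qpoch_Suc Q_def x_def ..
  have P0: "qd_sol_coeff L j = q ^ (j\<^sup>2 + j) * L ^ (2 * j) * w (int j) * qpoch q (t * L\<^sup>2) j * ((1 - q * x * L\<^sup>2) * Q)"
    unfolding qd_sol_coeff_def Q ..
  have aux: "X\<^sup>2 * Y * ((1 - b) * (1 - a * b)) = (1 - X) * (1 - X * Y)" if "b * X = 1" "a * Y = 1" for X Y a b :: complex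
    using that by algebra
  note f = aux[OF inv]
  define c where "c = q ^ (j\<^sup>2 + j) * L ^ (2 * j) * (qpoch q (t * L\<^sup>2) j * (1 - t * L\<^sup>2 * x)) * Q"
  have "qd_sol_coeff L (Suc j) * (1 - inverse (q ^ Suc j)) * (1 - inverse (L\<^sup>2) * inverse (q ^ Suc j)) =
     c * w (int (Suc j)) * ((q * x)\<^sup>2 * L\<^sup>2 * ((1 - inverse (q ^ Suc j)) * (1 - inverse (L\<^sup>2) * inverse (q ^ Suc j))))"
    unfolding P1 c_def by (simp only: mult_ac)
  also have "\<dots> = c * (w (int (Suc j)) * (1 - q * x)) * (1 - q * x * L\<^sup>2)"
    unfolding f by (simp only: mult_ac)
  also have "\<dots> = qd_sol_coeff L j * (1 - t * q ^ j) * (1 - t * L\<^sup>2 * q ^ j)"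
    unfolding W P0 c_def x_def[symmetric] by (simp only: mult_ac)
  finally show ?thesis .
qed

lemma qd_sol_qd_eq:
  assumes L: "L \<noteq> 0"
  shows "qd_eq q t L (qd_sol L)"
  unfolding qd_eq_def
proof
  fix m
  define x where "x = q powi m"
  define S where "S y = suminf (\<lambda>j. qd_sol_coeff L j * y ^ j)" for y
  have ss: "(\<lambda>j. qd_sol_coeff L j * y ^ j) sums S y" for y unfolding S_def using qd_sol_coeff_summable by (rule summable_sums)
  let ?li = "inverse (L\<^sup>2)"
  have "(\<lambda>j. qd_sol_coeff L j * x ^ j - (1 + ?li) * (qd_sol_coeff L j * (x * inverse q) ^ j) + ?li * (qd_sol_coeff L j * (x * inverse q * inverse q) ^ j)) sums
     (S x - (1 + ?li) * S (x * inverse q) + ?li * S (x * inverse q * inverse q))"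
    by (intro sums_add sums_diff sums_mult ss)
  moreover have "qd_sol_coeff L j * x ^ j - (1 + ?li) * (qd_sol_coeff L j * (x * inverse q) ^ j) + ?li * (qd_sol_coeff L j * (x * inverse q * inverse q) ^ j) =
     qd_sol_coeff L j * (1 - inverse (q ^ j)) * (1 - ?li * inverse (q ^ j)) * x ^ j" for j
    by (simp add: power_mult_distrib power_inverse algebra_simps)
  ultimately have A: "(\<lambda>j. qd_sol_coeff L j * (1 - inverse (q ^ j)) * (1 - ?li * inverse (q ^ j)) * x ^ j) sums
     (S x - (1 + ?li) * S (x * inverse q) + ?li * S (x * inverse q * inverse q))" by simp
  have "(\<lambda>j. x * (qd_sol_coeff L j * x ^ j - t * (L\<^sup>2 + 1) * (qd_sol_coeff L j * (x * q) ^ j) + t\<^sup>2 * L\<^sup>2 * (qd_sol_coeff L j * (x * q * q) ^ j))) sums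
     (x * (S x - t * (L\<^sup>2 + 1) * S (x * q) + t\<^sup>2 * L\<^sup>2 * S (x * q * q)))"
    by (intro sums_add sums_diff sums_mult ss)
  moreover have "x * (qd_sol_coeff L j * x ^ j - t * (L\<^sup>2 + 1) * (qd_sol_coeff L j * (x * q) ^ j) + t\<^sup>2 * L\<^sup>2 * (qd_sol_coeff L j * (x * q * q) ^ j)) =
     qd_sol_coeff L j * (1 - t * q ^ j) * (1 - t * L\<^sup>2 * q ^ j) * x ^ Suc j" for j
    by (simp add: power_mult_distrib algebra_simps power2_eq_square)
  ultimately have "(\<lambda>j. qd_sol_coeff L j * (1 - t * q ^ j) * (1 - t * L\<^sup>2 * q ^ j) * x ^ Suc j) sums
     (x * (S x - t * (L\<^sup>2 + 1) * S (x * q) + t\<^sup>2 * L\<^sup>2 * S (x * q * q)))" by simp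
  then have "(\<lambda>j. qd_sol_coeff L (Suc j) * (1 - inverse (q ^ Suc j)) * (1 - ?li * inverse (q ^ Suc j)) * x ^ Suc j) sums
     (x * (S x - t * (L\<^sup>2 + 1) * S (x * q) + t\<^sup>2 * L\<^sup>2 * S (x * q * q)))"
    by (simp only: qd_sol_coeff_rec[OF L])
  \<comment> \<open>The factor 1 - q^-j vanishes at j = 0, so undoing the index shift adds no
    initial term.\<close>
  then have "(\<lambda>j. qd_sol_coeff L j * (1 - inverse (q ^ j)) * (1 - ?li * inverse (q ^ j)) * x ^ j) sums
     (x * (S x - t * (L\<^sup>2 + 1) * S (x * q) + t\<^sup>2 * L\<^sup>2 * S (x * q * q)))"
    by (subst (asm) sums_Suc_iff) simp
  with A have eq: "S x - (1 + ?li) * S (x * inverse q) + ?li * S (x * inverse q * inverse q) =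
     x * (S x - t * (L\<^sup>2 + 1) * S (x * q) + t\<^sup>2 * L\<^sup>2 * S (x * q * q))"
    by (rule sums_unique2)
  define l where "l = L powi m"
  define li where "li = inverse L"
  have li: "li * L = 1" using L by (simp add: li_def)
  have li2: "?li = li\<^sup>2" by (simp add: li_def power_inverse)
  have p: "qd_sol L m = l * S x" "qd_sol L (m - 1) = l * li * S (x * inverse q)"
    "qd_sol L (m - 2) = l * li\<^sup>2 * S (x * inverse q * inverse q)"
    "qd_sol L (m + 1) = l * L * S (x * q)" "qd_sol L (m + 2) = l * L\<^sup>2 * S (x * q * q)"
  proof -
    have "q powi (m - 1) = x * inverse q" "q powi (m - 2) = x * inverse q * inverse q"
      "q powi (m + 1) = x * q" "q powi (m + 2) = x * q * q"
      using q_nonzero by (simp_all add: x_def power_int_diff power_int_add divide_inverse power2_eq_square)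
    moreover have "L powi (m - 1) = l * li" "L powi (m - 2) = l * li\<^sup>2" "L powi (m + 1) = l * L" "L powi (m + 2) = l * L\<^sup>2"
      using L by (simp_all add: l_def li_def power_int_diff power_int_add divide_inverse power_inverse)
    ultimately show "qd_sol L m = l * S x" "qd_sol L (m - 1) = l * li * S (x * inverse q)"
    "qd_sol L (m - 2) = l * li\<^sup>2 * S (x * inverse q * inverse q)"
    "qd_sol L (m + 1) = l * L * S (x * q)" "qd_sol L (m + 2) = l * L\<^sup>2 * S (x * q * q)"
      by (simp_all add: qd_sol_def S_def l_def x_def)
  qed
  show "qd_sol L (m - 2) + qd_sol L m - (L + inverse L) * qd_sol L (m - 1) =
     q powi m * (qd_sol L m + t\<^sup>2 * qd_sol L (m + 2) - (L + inverse L) * t * qd_sol L (m + 1))"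
    unfolding p x_def[symmetric] li_def[symmetric] using eq[unfolded li2] li by algebra
qed

end

subsection \<open>Asymptotics and analytic continuation\<close>

lemma null_mult_bounded:
  fixes a b :: "nat \<Rightarrow> complex"
  assumes "b \<longlonglongrightarrow> 0" "\<And>n. norm (a n) \<le> B"
  shows "(\<lambda>n. a n * b n) \<longlonglongrightarrow> 0"
proof (rule Lim_null_comparison)
  show "(\<lambda>n. B * norm (b n)) \<longlonglongrightarrow> 0"
    using tendsto_mult[OF tendsto_const tendsto_norm[OF assms(1)], of B] by simp
  show "\<forall>\<^sub>F n in sequentially. norm (a n * b n) \<le> B * norm (b n)"
    by (simp add: norm_mult mult_right_mono assms(2))
qed

text \<open>The closed disc of radius |x| / 2 around x lies in an annulus 1/B \<le> |L| \<le> B, so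
  annular bounds give locally uniform convergence.\<close>

lemma holomorphic_on_suminf_punctured:
  fixes f :: "nat \<Rightarrow> complex \<Rightarrow> complex"
  assumes hol: "\<And>n. f n holomorphic_on -{0}"
    and bound: "\<And>B. B \<ge> 1 \<Longrightarrow> \<exists>M. summable M \<and> (\<forall>n L. L \<noteq> 0 \<longrightarrow> norm L \<le> B \<longrightarrow> norm (inverse L) \<le> B \<longrightarrow> norm (f n L) \<le> M n)"
  shows "(\<lambda>L. suminf (\<lambda>n. f n L)) holomorphic_on -{0}"
proof (rule holomorphic_on_suminf[OF _ hol])
  fix x :: complex assume "x \<in> -{0}"
  then have x: "x \<noteq> 0" by simp
  define d where "d = norm x / 2"
  define B where "B = max 1 (max (2 * norm x) (2 / norm x))"
  have d: "d > 0" using x by (simp add: d_def)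
  have y: "y \<noteq> 0 \<and> norm y \<le> B \<and> norm (inverse y) \<le> B" if "y \<in> cball x d" for y
  proof -
    have dy: "norm (x - y) \<le> norm x / 2" using that by (simp add: d_def dist_norm)
    have "norm x - norm y \<le> norm (x - y)" "norm y - norm x \<le> norm (x - y)"
      using norm_triangle_ineq2[of x y] norm_triangle_ineq2[of y x] norm_minus_commute[of x y] by simp_all
    then have 1: "norm y \<ge> norm x / 2" and 2: "norm y \<le> 2 * norm x" using dy by auto
    have y0: "y \<noteq> 0" using 1 x by auto
    have "norm (inverse y) \<le> 2 / norm x" using le_imp_inverse_le[OF 1] x by (simp add: norm_inverse)
    then show ?thesis using 2 y0 by (simp add: B_def le_max_iff_disj)
  qed
  obtain M where M: "summable M" "\<forall>n L. L \<noteq> 0 \<longrightarrow> norm L \<le> B \<longrightarrow> norm (inverse L) \<le> B \<longrightarrow> norm (f n L) \<le> M n"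
    using bound[of B] by (auto simp: B_def)
  show "\<exists>d>0. \<exists>M. cball x d \<subseteq> -{0} \<and> summable M \<and> (\<forall>n. \<forall>y\<in>cball x d. norm (f n y) \<le> M n)"
  proof (intro exI[of _ d] exI[of _ M] conjI d M(1) allI ballI)
    show "cball x d \<subseteq> -{0}" using y by blast
    show "norm (f n z) \<le> M n" if "z \<in> cball x d" for n z
      using M(2) y[OF that] by blast
  qed
qed auto

section \<open>Asymptotics on the unit circle\<close>

context main_params
begin

definition winf :: complex where "winf = qinf q t / qinf q q"

lemma w_LIMSEQ: "(\<lambda>n. w (int n)) \<longlonglongrightarrow> winf"
  unfolding winf_def by (rule wq_LIMSEQ[OF q_norm])

lemma w_diff: "w (int n) - w (int n - 1) = q ^ n * w (int n) - t * (q powi (int n - 1) * w (int n - 1))"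
  using w_rec[of "int n"] by (simp add: algebra_simps)

text \<open>Taking differences multiplies the q-binomial series by 1 - x and thereby replaces (x;
  q)\<infinity> by (q x; q)\<infinity> in the denominator. The new series converges on the circle,
  at x = 1 included.\<close>

lemma w_diff_sums:
  assumes x: "norm x = 1"
  shows "(\<lambda>n. (w (int n) - w (int n - 1)) * x ^ n) sums (qinf q (t * x) / qinf q (q * x))"
proof -
  have qx: "norm (q * x) < 1" using q_norm x by (simp add: norm_mult)
  have s: "(\<lambda>n. w (int n) * (q * x) ^ n) sums (qinf q (t * (q * x)) / qinf q (q * x))"
    by (rule qbinomial_sums[OF q_norm qx])
  have "(\<lambda>n. t * x * (w (int n) * (q * x) ^ n)) sums (t * x * (qinf q (t * (q * x)) / qinf q (q * x)))"
    by (rule sums_mult[OF s])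
  then have "(\<lambda>n. t * (q powi (int (Suc n) - 1) * w (int (Suc n) - 1)) * x ^ Suc n) sums (t * x * (qinf q (t * (q * x)) / qinf q (q * x)))"
    by (simp add: power_mult_distrib mult_ac)
  then have "(\<lambda>n. t * (q powi (int n - 1) * w (int n - 1)) * x ^ n) sums (t * x * (qinf q (t * (q * x)) / qinf q (q * x)))"
    by (simp only: sums_Suc_iff[of "\<lambda>n. t * (q powi (int n - 1) * w (int n - 1)) * x ^ n"]) simp
  from sums_diff[OF s this]
  have "(\<lambda>n. (w (int n) - w (int n - 1)) * x ^ n) sums
     (qinf q (t * (q * x)) / qinf q (q * x) - t * x * (qinf q (t * (q * x)) / qinf q (q * x)))"
    by (simp add: w_diff power_mult_distrib algebra_simps)
  moreover have "qinf q (t * x) = (1 - t * x) * qinf q (t * (q * x))"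
    using qinf_shift[OF q_norm, of "t * x"] by (simp add: mult_ac)
  ultimately show ?thesis by (simp add: left_diff_distrib diff_divide_distrib)
qed

text \<open>Tannery's theorem: the differences of w are dominated by a multiple of q^i, and w (n -
  i) tends to \<open>winf\<close> for each fixed i.\<close>

lemma conv_LIMSEQ:
  assumes x: "norm x = 1"
  shows "(\<lambda>n. \<Sum>i\<le>n. (w (int i) - w (int i - 1)) * w (int n - int i) * x ^ i) \<longlonglongrightarrow> winf * (qinf q (t * x) / qinf q (q * x))"
proof -
  obtain M where M: "M > 0" "\<And>i. norm (w i) \<le> M" using wq_bounded[OF q_norm, of t] by auto
  define a where "a i n = (if i \<le> n then (w (int i) - w (int i - 1)) * w (int n - int i) * x ^ i else 0)" for i n
  define b where "b i = (w (int i) - w (int i - 1)) * winf * x ^ i" for i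
  define D where "D i = M * (1 + norm t / norm q) * norm q ^ i * M" for i
  have dw: "norm (w (int i) - w (int i - 1)) \<le> M * (1 + norm t / norm q) * norm q ^ i" for i
  proof -
    have "norm (q powi (int i - 1)) = norm q ^ i / norm q"
      using q_nonzero by (simp add: power_int_diff norm_divide norm_power)
    then have "norm (w (int i) - w (int i - 1)) \<le> norm q ^ i * norm (w (int i)) + norm t * (norm q ^ i / norm q * norm (w (int i - 1)))"
      unfolding w_diff using norm_triangle_ineq4[of "q ^ i * w (int i)" "t * (q powi (int i - 1) * w (int i - 1))"]
      by (simp add: norm_mult norm_power)
    also have "\<dots> \<le> norm q ^ i * M + norm t * (norm q ^ i / norm q * M)"
      by (intro add_mono mult_left_mono M) auto
    finally show ?thesis by (simp add: algebra_simps)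
  qed
  have lim: "(\<lambda>n. a i n) \<longlonglongrightarrow> b i" for i
  proof -
    have "(\<lambda>n. w (int (n + i) - int i)) \<longlonglongrightarrow> winf" using w_LIMSEQ by simp
    then have "(\<lambda>n. w (int n - int i)) \<longlonglongrightarrow> winf" by (rule LIMSEQ_offset)
    then have "(\<lambda>n. (w (int i) - w (int i - 1)) * w (int n - int i) * x ^ i) \<longlonglongrightarrow> b i"
      unfolding b_def by (intro tendsto_intros)
    then show ?thesis
      by (rule Lim_transform_eventually) (auto simp: eventually_sequentially a_def intro!: exI[of _ i])
  qed
  have bd: "norm (a i n) \<le> D i" for i n
  proof (cases "i \<le> n")
    case True
    have "norm (a i n) = norm (w (int i) - w (int i - 1)) * norm (w (int n - int i))"
      using True x by (simp add: a_def norm_mult norm_power)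
    also have "\<dots> \<le> D i" unfolding D_def by (intro mult_mono dw M) (use M in auto)
    finally show ?thesis .
  next
    case False
    then show ?thesis using M by (simp add: a_def D_def)
  qed
  have ev: "\<forall>\<^sub>F (i, n) in sequentially \<times>\<^sub>F sequentially. norm (a i n) \<le> D i"
    by (rule always_eventually) (use bd in auto)
  have "(\<lambda>n. suminf (\<lambda>i. a i n)) \<longlonglongrightarrow> suminf b"
  proof (rule tannerys_theorem[THEN conjunct2, THEN conjunct2])
    show "summable D" unfolding D_def using q_norm by (intro summable_mult2 summable_mult summable_geometric) auto
  qed (use lim ev in simp_all)
  moreover have "suminf (\<lambda>i. a i n) = (\<Sum>i\<le>n. (w (int i) - w (int i - 1)) * w (int n - int i) * x ^ i)" for n
  proof -
    have "suminf (\<lambda>i. a i n) = (\<Sum>i\<le>n. a i n)" by (rule suminf_finite) (auto simp: a_def)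
    then show ?thesis by (simp add: a_def)
  qed
  moreover have "suminf b = winf * (qinf q (t * x) / qinf q (q * x))"
    using sums_mult[OF w_diff_sums[OF x], of winf] by (simp add: b_def[abs_def] sums_iff mult_ac)
  ultimately show ?thesis by simp
qed

lemma rogers_inverse: "rogers n (inverse L) = rogers n L"
  unfolding bracket_def
  by (rule sum.reindex_bij_witness[of _ "\<lambda>i. n - i" "\<lambda>i. n - i"])
    (auto simp: power_int_inverse algebra_simps simp flip: power_int_minus)

text \<open>This combination annihilates the L^-n part of the oscillation. It turns the convolution
  of w with itself into one of w with its differences, which has a limit.\<close>

lemma rogers_diff:
  assumes L: "L \<noteq> 0"
  shows "rogers (int n) L - inverse L * rogers (int n - 1) L =
     L ^ n * (\<Sum>i\<le>n. (w (int i) - w (int i - 1)) * w (int n - int i) * (inverse (L\<^sup>2)) ^ i)"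
proof -
  have pw: "inverse L powi (2 * i - int k) = L powi (int k - 2 * i)" for i k
    by (simp add: power_int_inverse flip: power_int_minus)
  have 1: "rogers (int n) L = (\<Sum>i\<in>{0..int n}. w i * w (int n - i) * L powi (int n - 2 * i))"
    by (subst rogers_inverse[symmetric]) (simp add: bracket_def pw)
  have "rogers (int n - 1) L = (\<Sum>i\<in>{0..int n - 1}. w i * w (int n - 1 - i) * L powi (int n - 1 - 2 * i))"
    by (subst rogers_inverse[symmetric]) (simp add: bracket_def power_int_inverse flip: power_int_minus)
  then have "inverse L * rogers (int n - 1) L = (\<Sum>i\<in>{0..int n - 1}. w i * w (int n - 1 - i) * L powi (int n - 2 - 2 * i))"
  proof -
    have "inverse L * L powi (int n - 1 - 2 * i) = L powi (int n - 2 - 2 * i)" for i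
      using power_int_add[of L "-1" "int n - 1 - 2 * i"] L by (simp add: algebra_simps)
    note pwr = this
    show ?thesis unfolding \<open>rogers (int n - 1) L = _\<close> sum_distrib_left
      by (rule sum.cong[OF refl]) (simp only: pwr[symmetric], simp only: mult_ac)
  qed
  also have "\<dots> = (\<Sum>i\<in>{1..int n}. w (i - 1) * w (int n - i) * L powi (int n - 2 * i))"
    by (rule sum.reindex_bij_witness[of _ "\<lambda>i. i - 1" "\<lambda>i. i + 1"]) (auto simp: algebra_simps)
  also have "\<dots> = (\<Sum>i\<in>{0..int n}. w (i - 1) * w (int n - i) * L powi (int n - 2 * i))"
    by (rule sum.mono_neutral_left) auto
  finally have 2: "inverse L * rogers (int n - 1) L = (\<Sum>i\<in>{0..int n}. w (i - 1) * w (int n - i) * L powi (int n - 2 * i))" .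
  have "L powi (int n - 2 * int i) = L ^ n * inverse (L\<^sup>2) ^ i" for i
    using L by (simp add: power_int_diff power_int_mult power_inverse divide_inverse)
  then show ?thesis
    unfolding 1 2 sum_subtractf[symmetric] sum_int_atLeastAtMost
    by (simp add: sum_distrib_left algebra_simps)
qed

text \<open>The terms with i \<ge> 1 carry q^(m i), which beats the growth m + 1 of the Rogers
  polynomials on the circle; the subtracted expression is the term i = 0.\<close>

lemma Phi_coeff_asymptotic:
  assumes L: "norm L = 1"
  shows "(\<lambda>m. Phi_coeff L (int m) - Rn (int m) * (1 - t * q ^ m) * w (int m) * rogers (int m) L) \<longlonglongrightarrow> 0"
proof -
  have L0: "L \<noteq> 0" using L by auto
  obtain M where M: "M > 0" "\<And>i. norm (w i) \<le> M" using wq_bounded[OF q_norm, of t] by auto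
  obtain MR where MR: "MR > 0" "\<And>n. norm (Rn n) \<le> MR" using Rn_bounded by blast
  obtain C where C: "C > 0" "\<And>n L B. B \<ge> 1 \<Longrightarrow> norm L \<le> B \<Longrightarrow> norm (inverse L) \<le> B \<Longrightarrow>
    norm (rogers (int n) L) \<le> C * (real n + 1) * B ^ n" using rogers_bound by blast
  define A where "A = MR * (1 + norm t / norm q)"
  have A: "A \<ge> 0" using MR by (simp add: A_def)
  define G where "G j = norm q ^ j\<^sup>2 * (3 * norm t) ^ j" for j
  have G: "summable G" unfolding G_def by (rule gauss_summable) (use q_norm in auto)
  have bd: "norm (Phi_coeff_term L (int m) (int (Suc i))) \<le> (A * (M * M) * C) * ((real m + 1) * norm q ^ m) * G (Suc i)" for m i
  proof -
    define j where "j = Suc i"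
    have idx: "int m + 2 * int j = int (m + 2 * j)" "int m + int j = int (m + j)" "(int j)\<^sup>2 + int m * int j = int (j\<^sup>2 + m * j)" by simp_all
    have 1: "norm (Rn (int (m + 2 * j)) * (1 - t * q powi int (m + 2 * j))) \<le> A"
      using coeff_bound[OF MR(2), of 0 "int (m + 2 * j)" t] by (simp add: A_def)
    have 2: "norm (rogers (int (m + 2 * j)) L) \<le> C * ((real m + 1) * 3 ^ j)"
    proof -
      have "norm (rogers (int (m + 2 * j)) L) \<le> C * (real (m + 2 * j) + 1)"
        using C(2)[of 1 L "m + 2 * j"] L by (simp add: norm_inverse)
      \<comment> \<open>The growth is split into a factor in m, beaten by q^m, and a factor in j,
        which joins the Gaussian sum.\<close>
      also have "real (m + 2 * j) + 1 \<le> (real m + 1) * (1 + 2 * real j)" by (simp add: algebra_simps)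
      also have "1 + 2 * real j \<le> 3 ^ j" by (induction j) auto
      finally show ?thesis using C(1) by (simp add: mult_left_mono)
    qed
    have 3: "norm (q powi int (j\<^sup>2 + m * j)) \<le> norm q ^ j\<^sup>2 * norm q ^ m"
      unfolding power_int_of_nat norm_power power_add[symmetric] by (rule power_decreasing) (use q_norm in \<open>auto simp: j_def\<close>)
    have "norm (Phi_coeff_term L (int m) (int j)) = norm (Rn (int (m + 2 * j)) * (1 - t * q powi int (m + 2 * j))) *
       (norm (q powi int (j\<^sup>2 + m * j)) * norm t ^ j * norm (w (int j)) * norm (w (int (m + j))) * norm (rogers (int (m + 2 * j)) L))"
      unfolding Phi_coeff_term_def bracket_term_def idx add_0_right by (simp only: norm_mult power_int_of_nat norm_power)
    also have "\<dots> \<le> A * ((norm q ^ j\<^sup>2 * norm q ^ m) * norm t ^ j * M * M * (C * ((real m + 1) * 3 ^ j)))"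
      by (intro mult_mono 1 2 3 M order.refl) (use A M C in auto)
    also have "\<dots> = (A * (M * M) * C) * ((real m + 1) * norm q ^ m) * G j" by (simp add: G_def power_mult_distrib mult_ac)
    finally show ?thesis by (simp add: j_def)
  qed
  have split: "Phi_coeff L (int m) - Rn (int m) * (1 - t * q ^ m) * w (int m) * rogers (int m) L = suminf (\<lambda>i. Phi_coeff_term L (int m) (int (Suc i)))" for m
  proof -
    have z: "Phi_coeff_term L (int m) i = 0" if "i < 0" for i using that by (simp add: Phi_coeff_term_def bracket_term_def)
    note s = infsum_int_eq_suminf[OF Phi_coeff_term_summable[OF L0] z]
    have "Phi_coeff L (int m) = suminf (\<lambda>i. Phi_coeff_term L (int m) (int i))" unfolding Phi_coeff_def by (rule s(1))
    also have "\<dots> = suminf (\<lambda>i. Phi_coeff_term L (int m) (int (Suc i))) + Phi_coeff_term L (int m) (int 0)"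
      using suminf_split_head[OF s(2)] by simp
    also have "Phi_coeff_term L (int m) (int 0) = Rn (int m) * (1 - t * q ^ m) * w (int m) * rogers (int m) L"
      by (simp add: Phi_coeff_term_def bracket_term_def)
    finally show ?thesis by simp
  qed
  have "norm (Phi_coeff L (int m) - Rn (int m) * (1 - t * q ^ m) * w (int m) * rogers (int m) L) \<le>
      (A * (M * M) * C * suminf (\<lambda>i. G (Suc i))) * ((real m + 1) * norm q ^ m)" for m
  proof -
    have GS: "summable (\<lambda>i. G (Suc i))" using G by (simp add: summable_Suc_iff)
    have "norm (suminf (\<lambda>i. Phi_coeff_term L (int m) (int (Suc i)))) \<le> suminf (\<lambda>i. (A * (M * M) * C) * ((real m + 1) * norm q ^ m) * G (Suc i))"
      by (rule norm_suminf_le[OF bd summable_mult[OF GS]])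
    also have "\<dots> = (A * (M * M) * C) * ((real m + 1) * norm q ^ m) * suminf (\<lambda>i. G (Suc i))"
      by (rule suminf_mult[OF GS])
    finally show ?thesis unfolding split by (simp add: mult_ac)
  qed
  moreover have "(\<lambda>m. (A * (M * M) * C * suminf (\<lambda>i. G (Suc i))) * ((real m + 1) * norm q ^ m)) \<longlonglongrightarrow> 0"
  proof -
    have "(\<lambda>m. real m * norm q ^ m + norm q ^ m) \<longlonglongrightarrow> 0 + 0"
      using q_norm by (intro tendsto_add LIMSEQ_power_zero powser_times_n_limit_0) auto
    then have "(\<lambda>m. (real m + 1) * norm q ^ m) \<longlonglongrightarrow> 0" by (simp add: distrib_right)
    from tendsto_mult[OF tendsto_const this] show ?thesis by simp
  qed
  ultimately show ?thesis
    by (rule Lim_null_comparison[OF always_eventually[OF allI]])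
qed

text \<open>The product of the limits of \<open>Rn\<close> and of two factors w, one standing in the
  term i = 0 and one produced by the asymptotics of the Rogers polynomial.\<close>

definition connection_const :: complex where
  "connection_const = qinf q q / qinf q (t\<^sup>2) * winf * winf"

definition qd_sol_series :: "complex \<Rightarrow> complex \<Rightarrow> complex" where
  "qd_sol_series L x = suminf (\<lambda>j. qd_sol_coeff L j * x ^ j)"

lemma qd_sol_series_LIMSEQ: "(\<lambda>m. qd_sol_series L (q ^ m)) \<longlonglongrightarrow> qinf q (q * L\<^sup>2)"
proof -
  have "isCont (qd_sol_series L) 0" unfolding qd_sol_series_def[abs_def] by (rule isCont_powser[of _ 1]) (use qd_sol_coeff_summable[of L 1] in auto)
  moreover have "(\<lambda>m. q ^ m) \<longlonglongrightarrow> 0" using q_norm by (rule LIMSEQ_power_zero)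
  ultimately have "(\<lambda>m. qd_sol_series L (q ^ m)) \<longlonglongrightarrow> qd_sol_series L 0" by (rule isCont_tendsto_compose)
  moreover have "qd_sol_series L 0 = qinf q (q * L\<^sup>2)" by (simp add: qd_sol_series_def qd_sol_coeff_def)
  ultimately show ?thesis by simp
qed

lemma qd_sol_of_nat: "qd_sol L (int m) = L ^ m * qd_sol_series L (q ^ m)"
  by (simp add: qd_sol_def qd_sol_series_def)

text \<open>The identity with all denominators cleared, so that both sides are holomorphic for
  \<open>L \<noteq> 0\<close>.\<close>

lemma Phi_coeff_qd_sol_circle:
  assumes L: "norm L = 1" "L\<^sup>2 \<noteq> 1"
  shows "qinf q (inverse (L\<^sup>2)) * qinf q (q * L\<^sup>2) * Phi_coeff L m =
     connection_const * (qinf q (t * inverse (L\<^sup>2)) * qd_sol L m - inverse (L\<^sup>2) * qinf q (t * L\<^sup>2) * qd_sol (inverse L) m)"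
proof -
  have L0: "L \<noteq> 0" using L by auto
  define y where "y = L\<^sup>2"
  define x where "x = inverse (L\<^sup>2)"
  define li where "li = inverse L"
  have n1: "norm x = 1" "norm y = 1" "norm li = 1" using L by (simp_all add: x_def y_def li_def norm_inverse norm_power)
  have li: "li * L = 1" "x = li\<^sup>2" "li \<noteq> 0" using L0 by (simp_all add: li_def x_def power_inverse)
  define th where "th = qinf q x * qinf q (q * y)"
  have yx: "inverse x = y" by (simp add: x_def y_def)
  have lx: "inverse (li\<^sup>2) = y" "li\<^sup>2 = x" using L0 by (simp_all add: li_def y_def x_def power_inverse)
  define uu where "uu n = (\<Sum>i\<le>n. (w (int i) - w (int i - 1)) * w (int n - int i) * x ^ i)" for n
  define vv where "vv n = (\<Sum>i\<le>n. (w (int i) - w (int i - 1)) * w (int n - int i) * y ^ i)" for n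
  have ulim: "uu \<longlonglongrightarrow> winf * (qinf q (t * x) / qinf q (q * x))" and vlim: "vv \<longlonglongrightarrow> winf * (qinf q (t * y) / qinf q (q * y))"
    unfolding uu_def[abs_def] vv_def[abs_def] by (rule conv_LIMSEQ n1)+
  have cu: "rogers (int n) L - li * rogers (int n - 1) L = L ^ n * uu n" for n
    using rogers_diff[OF L0, of n] by (simp add: uu_def x_def li_def)
  have cv: "rogers (int n) L - L * rogers (int n - 1) L = li ^ n * vv n" for n
    using rogers_diff[OF li(3), of n] unfolding rogers_inverse[of _ L, folded li_def] lx vv_def
    using L0 yx by (simp add: li_def)
  \<comment> \<open>The two differences together recover the Rogers polynomial as L^n and L^-n times
    convergent sequences. The price is the factor L - 1/L, which is why L^2 = 1 is excluded.\<close>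
  have C: "(L - li) * rogers (int n) L = L ^ n * (L * uu n) - li ^ n * (li * vv n)" for n
  proof -
    have "(L - li) * rogers (int n) L = L * (rogers (int n) L - li * rogers (int n - 1) L) - li * (rogers (int n) L - L * rogers (int n - 1) L)"
      by (simp add: algebra_simps)
    then show ?thesis unfolding cu cv by (simp add: mult_ac)
  qed
  define c where "c m = Rn (int m) * (1 - t * q ^ m) * w (int m)" for m
  define cinf where "cinf = qinf q q / qinf q (t\<^sup>2) * winf"
  have "c \<longlonglongrightarrow> qinf q q / qinf q (t\<^sup>2) * (1 - t * 0) * winf"
    unfolding c_def[abs_def] by (intro tendsto_intros Rn_LIMSEQ w_LIMSEQ LIMSEQ_power_zero q_norm)
  then have clim: "c \<longlonglongrightarrow> cinf" by (simp add: cinf_def)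
  \<comment> \<open>The equation is linear and symmetric under L -> 1/L, so the difference of the
    two sides is again a solution; it remains to show that it tends to zero.\<close>
  define d where "d m = th * Phi_coeff L m + (- connection_const) * (qinf q (t * x) * qd_sol L m + (- (x * qinf q (t * y))) * qd_sol li m)" for m
  have "qd_eq q t L (qd_sol li)"
    using qd_sol_qd_eq[OF li(3)] unfolding qd_eq_def li_def by (simp add: add.commute)
  then have deq: "qd_eq q t L d"
    unfolding d_def[abs_def] by (intro qd_eq_lin Phi_coeff_qd_eq qd_sol_qd_eq L0)
  have nz: "qinf q (q * x) \<noteq> 0" "qinf q (q * y) \<noteq> 0"
  proof -
    have "q * z * q ^ l \<noteq> 1" if "norm z = 1" for z l
    proof
      assume "q * z * q ^ l = 1"
      then have "norm (q * z * q ^ l) = 1" by simp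
      then have "norm q ^ Suc l = 1" using that by (simp add: norm_mult norm_power mult_ac)
      then show False using q_norm power_less_one_iff[of "norm q" "Suc l"] by simp
    qed
    then show "qinf q (q * x) \<noteq> 0" "qinf q (q * y) \<noteq> 0" using n1 by (auto intro!: qinf_nonzero[OF q_norm])
  qed
  have thx: "th = (1 - x) * qinf q (q * x) * qinf q (q * y)"
    using qinf_shift[OF q_norm, of x] by (simp add: th_def mult.commute)
  have Llx: "L - li = L * (1 - x)" "L - li = (1 - x) * L" using li by algebra+
  have d0: "(\<lambda>m. (L - li) * d (int m)) \<longlonglongrightarrow> 0"
  proof -
    define e where "e m = Phi_coeff L (int m) - c m * rogers (int m) L" for m
    \<comment> \<open>A and B gather the coefficients of L^m and L^-m. Both tend to zero by the
      choice of \<open>connection_const\<close>, and the powers are bounded on the circle.\<close>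
    define A where "A m = th * (c m * (L * uu m)) - connection_const * qinf q (t * x) * qd_sol_series L (q ^ m) * (L - li)" for m
    define B where "B m = connection_const * x * qinf q (t * y) * qd_sol_series li (q ^ m) * (L - li) - th * (c m * (li * vv m))" for m
    have "(L - li) * d (int m) = th * (L - li) * e m + L ^ m * A m + li ^ m * B m" for m
    proof -
      have "(L - li) * d (int m) = th * (L - li) * e m + th * c m * ((L - li) * rogers (int m) L)
        - connection_const * qinf q (t * x) * qd_sol L (int m) * (L - li) + connection_const * x * qinf q (t * y) * qd_sol li (int m) * (L - li)"
        by (simp add: d_def e_def algebra_simps)
      then show ?thesis unfolding C qd_sol_of_nat A_def B_def by (simp add: algebra_simps)
    qed
    moreover have "e \<longlonglongrightarrow> 0" using Phi_coeff_asymptotic[OF L(1)] by (simp add: e_def[abs_def] c_def)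
    then have "(\<lambda>m. th * (L - li) * e m) \<longlonglongrightarrow> 0" using tendsto_mult[OF tendsto_const] by fastforce
    moreover have "(\<lambda>m. L ^ m * A m) \<longlonglongrightarrow> 0"
    proof (rule null_mult_bounded[where B = 1])
      have "A \<longlonglongrightarrow> th * (cinf * (L * (winf * (qinf q (t * x) / qinf q (q * x))))) - connection_const * qinf q (t * x) * qinf q (q * L\<^sup>2) * (L - li)"
        unfolding A_def[abs_def] by (intro tendsto_intros clim ulim qd_sol_series_LIMSEQ)
      moreover have "th * (cinf * (L * (winf * (qinf q (t * x) / qinf q (q * x))))) - connection_const * qinf q (t * x) * qinf q (q * L\<^sup>2) * (L - li) = 0"
        using nz unfolding thx Llx(2) connection_const_def cinf_def y_def[symmetric] by (simp add: mult_ac)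
      ultimately show "A \<longlonglongrightarrow> 0" by simp
    qed (use L in \<open>auto simp: norm_power\<close>)
    moreover have "(\<lambda>m. li ^ m * B m) \<longlonglongrightarrow> 0"
    proof (rule null_mult_bounded[where B = 1])
      have xL: "x * L = li" using li by algebra
      have "B \<longlonglongrightarrow> connection_const * x * qinf q (t * y) * qinf q (q * li\<^sup>2) * (L - li) - th * (cinf * (li * (winf * (qinf q (t * y) / qinf q (q * y)))))"
        unfolding B_def[abs_def] by (intro tendsto_intros clim vlim qd_sol_series_LIMSEQ)
      moreover have "connection_const * x * qinf q (t * y) * qinf q (q * li\<^sup>2) * (L - li) - th * (cinf * (li * (winf * (qinf q (t * y) / qinf q (q * y))))) = 0"
        using nz unfolding thx Llx(1) connection_const_def cinf_def li(2)[symmetric]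
        unfolding xL[symmetric] by (simp add: mult_ac)
      ultimately show "B \<longlonglongrightarrow> 0" by simp
    qed (use n1 in \<open>auto simp: norm_power\<close>)
    ultimately have "(\<lambda>m. (L - li) * d (int m)) \<longlonglongrightarrow> 0 + 0 + 0"
      by (simp only:) (intro tendsto_add)
    then show ?thesis by simp
  qed
  have "x \<noteq> 1" using L(2) by (simp add: x_def)
  then have "L - li \<noteq> 0" unfolding Llx(1) using L0 by simp
  then have "(\<lambda>m. d (int m)) \<longlonglongrightarrow> 0"
    using tendsto_mult[OF tendsto_const d0, of "inverse (L - li)"] by (simp add: mult.assoc[symmetric])
  from qd_eq_unique[OF q_norm L(1) deq this, of m] show ?thesis
    unfolding d_def th_def x_def y_def li_def by (simp add: algebra_simps)
qed

section \<open>Continuation to all nonzero arguments\<close>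

lemma Phi_coeff_holomorphic: "(\<lambda>L. Phi_coeff L m) holomorphic_on -{0}"
proof -
  obtain MR where MR: "MR > 0" "\<And>n. norm (Rn n) \<le> MR" using Rn_bounded by blast
  define A where "A = MR * (1 + norm t / norm q)"
  have A0: "A \<ge> 0" using MR by (simp add: A_def)
  have A: "norm (Rn k * (1 - t * q powi k)) \<le> A" for k
    using coeff_bound[OF MR(2), of 0 k t] by (simp add: A_def)
  have "(\<lambda>L. suminf (\<lambda>i. Phi_coeff_term L m (int i))) holomorphic_on -{0}"
  proof (rule holomorphic_on_suminf_punctured)
    show "(\<lambda>L. Phi_coeff_term L m (int i)) holomorphic_on -{0}" for i
      unfolding Phi_coeff_term_def bracket_term_def bracket_def by (intro holomorphic_intros) auto
    fix B :: real assume "B \<ge> 1"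
    obtain K D where KD: "K > 0" "D > 0" "\<And>e i L. e \<in> {-1, 0, 1} \<Longrightarrow> L \<noteq> 0 \<Longrightarrow> norm L \<le> B \<Longrightarrow> norm (inverse L) \<le> B \<Longrightarrow>
      norm (bracket_term e L m i) \<le> K * (norm q ^ nat (i\<^sup>2) * D ^ nat \<bar>i\<bar>)"
      using bracket_term_bound[OF \<open>B \<ge> 1\<close>, of m] by metis
    show "\<exists>M. summable M \<and> (\<forall>n L. L \<noteq> 0 \<longrightarrow> norm L \<le> B \<longrightarrow> norm (inverse L) \<le> B \<longrightarrow> norm (Phi_coeff_term L m (int n)) \<le> M n)"
    proof (intro exI[of _ "\<lambda>n. A * (K * (norm q ^ n\<^sup>2 * D ^ n))"] conjI allI impI)
      show "summable (\<lambda>n. A * (K * (norm q ^ n\<^sup>2 * D ^ n)))"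
        by (intro summable_mult gauss_summable) (use q_norm KD in auto)
      fix n and L :: complex assume L: "L \<noteq> 0" "norm L \<le> B" "norm (inverse L) \<le> B"
      have "nat ((int n)\<^sup>2) = n\<^sup>2" by (simp add: nat_power_eq)
      then have "norm (bracket_term 0 L m (int n)) \<le> K * (norm q ^ n\<^sup>2 * D ^ n)" using KD(3)[of 0 L "int n"] L by simp
      then show "norm (Phi_coeff_term L m (int n)) \<le> A * (K * (norm q ^ n\<^sup>2 * D ^ n))"
        unfolding Phi_coeff_term_def norm_mult[of "_ * _" "bracket_term _ _ _ _"] using A A0 by (intro mult_mono) auto
    qed
  qed
  moreover have "suminf (\<lambda>i. Phi_coeff_term L m (int i)) = Phi_coeff L m" if "L \<in> -{0}" for L
  proof -
    have z: "Phi_coeff_term L m i = 0" if "i < 0" for i using that by (simp add: Phi_coeff_term_def bracket_term_def)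
    show ?thesis using infsum_int_eq_suminf(1)[OF Phi_coeff_term_summable z] that by (simp add: Phi_coeff_def)
  qed
  ultimately show ?thesis by (rule holomorphic_transform)
qed

lemma qd_sol_holomorphic: "(\<lambda>L. qd_sol L m) holomorphic_on -{0}"
proof -
  have qh: "(\<lambda>z. qinf q (f z)) holomorphic_on S" if "f holomorphic_on S" for f S
    using holomorphic_on_compose_gen[OF that qinf_holomorphic[OF q_norm]] by (simp add: o_def)
  define x where "x = q powi m"
  have "(\<lambda>L. suminf (\<lambda>j. qd_sol_coeff L j * x ^ j)) holomorphic_on -{0}"
  proof (rule holomorphic_on_suminf_punctured)
    show "(\<lambda>L. qd_sol_coeff L j * x ^ j) holomorphic_on -{0}" for j
      unfolding qd_sol_coeff_def qpoch_def by (intro holomorphic_intros qh)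
    fix B :: real assume B: "B \<ge> 1"
    then have B0: "B > 0" by simp
    obtain K where K: "K > 0" "\<And>j L. norm L \<le> B \<Longrightarrow> norm (qd_sol_coeff L j) \<le> K * (norm q ^ j\<^sup>2 * (B\<^sup>2) ^ j)"
      using qd_sol_coeff_bound[OF B0] by metis
    show "\<exists>M. summable M \<and> (\<forall>j L. L \<noteq> 0 \<longrightarrow> norm L \<le> B \<longrightarrow> norm (inverse L) \<le> B \<longrightarrow> norm (qd_sol_coeff L j * x ^ j) \<le> M j)"
    proof (intro exI[of _ "\<lambda>j. K * (norm q ^ j\<^sup>2 * (B\<^sup>2 * norm x) ^ j)"] conjI allI impI)
      show "summable (\<lambda>j. K * (norm q ^ j\<^sup>2 * (B\<^sup>2 * norm x) ^ j))"
        by (intro summable_mult gauss_summable) (use q_norm in auto)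
      fix j and L :: complex assume L: "norm L \<le> B"
      have "norm (qd_sol_coeff L j * x ^ j) = norm (qd_sol_coeff L j) * norm x ^ j" by (simp add: norm_mult norm_power)
      also have "\<dots> \<le> (K * (norm q ^ j\<^sup>2 * (B\<^sup>2) ^ j)) * norm x ^ j" by (intro mult_right_mono K L) auto
      finally show "norm (qd_sol_coeff L j * x ^ j) \<le> K * (norm q ^ j\<^sup>2 * (B\<^sup>2 * norm x) ^ j)" by (simp add: power_mult_distrib mult_ac)
    qed
  qed
  then show ?thesis unfolding qd_sol_def x_def[symmetric] by (intro holomorphic_intros) auto
qed

text \<open>Both sides are holomorphic on the connected punctured plane and agree on the unit circle
  without 1 and -1, a set that accumulates at \<open>\<i>\<close>.\<close>

lemma Phi_coeff_qd_sol:
  assumes L: "L \<noteq> 0"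
  shows "qinf q (inverse (L\<^sup>2)) * qinf q (q * L\<^sup>2) * Phi_coeff L m =
     connection_const * (qinf q (t * inverse (L\<^sup>2)) * qd_sol L m - inverse (L\<^sup>2) * qinf q (t * L\<^sup>2) * qd_sol (inverse L) m)"
proof -
  have qh: "(\<lambda>z. qinf q (f z)) holomorphic_on S" if "f holomorphic_on S" for f S
    using holomorphic_on_compose_gen[OF that qinf_holomorphic[OF q_norm]] by (simp add: o_def)
  have pi: "(\<lambda>L. qd_sol (inverse L) m) holomorphic_on -{0}"
  proof -
    have "inverse holomorphic_on (-{0} :: complex set)" by (intro holomorphic_intros) auto
    moreover have "inverse ` (-{0 :: complex}) \<subseteq> -{0}" by auto
    ultimately show ?thesis using holomorphic_on_compose_gen[OF _ qd_sol_holomorphic, of inverse "-{0}" m] by (simp add: o_def)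
  qed
  define F where "F L = qinf q (inverse (L\<^sup>2)) * qinf q (q * L\<^sup>2) * Phi_coeff L m -
     connection_const * (qinf q (t * inverse (L\<^sup>2)) * qd_sol L m - inverse (L\<^sup>2) * qinf q (t * L\<^sup>2) * qd_sol (inverse L) m)" for L
  have "F L = 0"
  proof (rule analytic_continuation[of F "-{0}" "sphere 0 1 - {1, -1}" "\<i>"])
    show "F holomorphic_on -{0}" unfolding F_def[abs_def]
      by (intro holomorphic_intros qh Phi_coeff_holomorphic qd_sol_holomorphic pi) auto
    show "connected (-{0 :: complex})" by (rule connected_punctured_universe) simp
    have "\<i> islimpt sphere 0 1"
    proof (rule connected_imp_perfect)
      show "connected (sphere 0 1 :: complex set)" by (rule connected_sphere) simp
      fix x :: complex
      have "1 \<in> (sphere 0 1 :: complex set)" "-1 \<in> (sphere 0 1 :: complex set)" by auto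
      then show "sphere 0 1 \<noteq> {x}" by (metis one_neq_neg_one singletonD)
    qed simp
    moreover have "{1, -1} \<union> (sphere 0 1 - {1, -1}) = (sphere 0 1 :: complex set)" by auto
    ultimately show "\<i> islimpt (sphere 0 1 - {1, -1})"
      using islimpt_Un_finite[of "{1, -1 :: complex}" "\<i>" "sphere 0 1 - {1, -1}"] by simp
    show "F z = 0" if "z \<in> sphere 0 1 - {1, -1}" for z
      using that Phi_coeff_qd_sol_circle[of z m] by (auto simp: F_def power2_eq_1_iff)
  qed (use L in auto)
  then show ?thesis by (simp add: F_def)
qed

text \<open>\<open>qd_sol\<close> without the prefactor (q L^2; q)\<infinity>, that is with the
  genuine hypergeometric coefficients; used where L^2 is not a power of q.\<close>

definition hyp_sol :: "complex \<Rightarrow> int \<Rightarrow> complex" where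
  "hyp_sol L m = L powi m * suminf (\<lambda>j. q ^ (j\<^sup>2 + j) * L ^ (2 * j) * hyp_prod q t L j * (q powi m) ^ j)"

lemma qinf_neq_0:
  assumes "\<And>k :: int. z \<noteq> q powi k"
  shows "qinf q (z * q ^ j) \<noteq> 0"
proof (rule qinf_nonzero[OF q_norm])
  fix l
  show "z * q ^ j * q ^ l \<noteq> 1"
  proof
    assume *: "z * q ^ j * q ^ l = 1"
    have "q powi (- (int j + int l)) = inverse (q ^ j * q ^ l)"
      by (simp only: power_int_minus q_powi_add power_int_of_nat)
    then have "z = z * q ^ j * q ^ l * q powi (- (int j + int l))"
      using q_nonzero by (simp add: field_simps)
    then have "z = q powi (- (int j + int l))" unfolding * by simp
    then show False using assms by blast
  qed
qed

lemma qd_sol_hyp_sol: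
  assumes L: "\<And>k :: int. L\<^sup>2 \<noteq> q powi k"
  shows "qd_sol L m = qinf q (q * L\<^sup>2) * hyp_sol L m"
proof -
  have "qd_sol_coeff L j = qinf q (q * L\<^sup>2) * (q ^ (j\<^sup>2 + j) * L ^ (2 * j) * hyp_prod q t L j)" for j
  proof -
    have s: "qinf q (q * L\<^sup>2) = qpoch q (q * L\<^sup>2) j * qinf q (q ^ Suc j * L\<^sup>2)"
      using qinf_split[OF q_norm, of "q * L\<^sup>2" j] by (simp add: mult_ac)
    moreover have "qinf q (q * L\<^sup>2) \<noteq> 0" using qinf_neq_0[OF L, of 1] by (simp add: mult.commute)
    ultimately have "qpoch q (q * L\<^sup>2) j \<noteq> 0" by auto
    then show ?thesis unfolding s hyp_prod_eq qd_sol_coeff_def by simp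
  qed
  then have "qd_sol L m = L powi m * suminf (\<lambda>j. qinf q (q * L\<^sup>2) * (q ^ (j\<^sup>2 + j) * L ^ (2 * j) * hyp_prod q t L j * (q powi m) ^ j))"
    by (simp add: qd_sol_def mult.assoc)
  also have "suminf (\<lambda>j. qinf q (q * L\<^sup>2) * (q ^ (j\<^sup>2 + j) * L ^ (2 * j) * hyp_prod q t L j * (q powi m) ^ j)) =
      qinf q (q * L\<^sup>2) * suminf (\<lambda>j. q ^ (j\<^sup>2 + j) * L ^ (2 * j) * hyp_prod q t L j * (q powi m) ^ j)"
  proof -
    have nz: "qinf q (q * L\<^sup>2) \<noteq> 0" using qinf_neq_0[OF L, of 1] by (simp add: mult.commute)
    have "summable (\<lambda>j. qinf q (q * L\<^sup>2) * (q ^ (j\<^sup>2 + j) * L ^ (2 * j) * hyp_prod q t L j * (q powi m) ^ j))"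
      using qd_sol_coeff_summable[of L "q powi m"] \<open>\<And>j. qd_sol_coeff L j = _\<close> by (simp add: mult.assoc)
    then have "summable (\<lambda>j. q ^ (j\<^sup>2 + j) * L ^ (2 * j) * hyp_prod q t L j * (q powi m) ^ j)"
      using nz by (simp only: summable_cmult_iff simp_thms)
    then show ?thesis by (rule suminf_mult)
  qed
  finally show ?thesis by (simp add: hyp_sol_def mult_ac)
qed

lemma Phi_coeff_eq:
  assumes L: "L \<noteq> 0" "\<And>k :: int. L\<^sup>2 \<noteq> q powi k"
  shows "Phi_coeff L m = connection_const * (sigma_fn q t (inverse L) * hyp_sol L m + sigma_fn q t L * hyp_sol (inverse L) m)"
proof -
  define x where "x = inverse (L\<^sup>2)"
  define y where "y = L\<^sup>2"
  have xy: "x * y = 1" "x \<noteq> 0" using L(1) by (simp_all add: x_def y_def)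
  have x2: "(inverse L)\<^sup>2 = x" by (simp add: x_def power_inverse)
  have Li: "(inverse L)\<^sup>2 \<noteq> q powi k" for k :: int
  proof
    assume "(inverse L)\<^sup>2 = q powi k"
    then have "L\<^sup>2 = q powi (- k)" by (metis power_int_minus power_inverse inverse_inverse_eq)
    then show False using L(2) by blast
  qed
  have nz: "qinf q x \<noteq> 0" "qinf q y \<noteq> 0" "qinf q (q * x) \<noteq> 0" "qinf q (q * y) \<noteq> 0"
    using qinf_neq_0[OF L(2), of 0] qinf_neq_0[OF L(2), of 1] qinf_neq_0[OF Li, of 0] qinf_neq_0[OF Li, of 1]
    by (simp_all add: x2 y_def mult.commute)
  have sx: "qinf q x = (1 - x) * qinf q (q * x)" and sy: "qinf q y = (1 - y) * qinf q (q * y)"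
    using qinf_shift[OF q_norm, of x] qinf_shift[OF q_norm, of y] by (simp_all add: mult.commute)
  have k1: "1 - x \<noteq> 0" "1 - y \<noteq> 0" using nz sx sy by auto
  have eq: "qinf q x * qinf q (q * y) * Phi_coeff L m =
     connection_const * (qinf q (t * x) * (qinf q (q * y) * hyp_sol L m) - x * qinf q (t * y) * (qinf q (q * x) * hyp_sol (inverse L) m))"
    using Phi_coeff_qd_sol[OF L(1), of m] unfolding qd_sol_hyp_sol[OF L(2)] qd_sol_hyp_sol[OF Li] x2 by (simp add: x_def y_def)
  have s1: "sigma_fn q t (inverse L) = qinf q (t * x) / qinf q x" "sigma_fn q t L = qinf q (t * y) / qinf q y"
    unfolding sigma_fn_eq[OF q_norm] x2 by (simp_all add: y_def)
  have "qinf q x * qinf q (q * y) * (connection_const * (qinf q (t * x) / qinf q x * hyp_sol L m + qinf q (t * y) / qinf q y * hyp_sol (inverse L) m)) =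
    connection_const * (qinf q (t * x) * qinf q (q * y) * hyp_sol L m + qinf q (t * y) * (qinf q x * qinf q (q * y) / qinf q y) * hyp_sol (inverse L) m)"
    using nz by (simp add: distrib_left mult_ac)
  \<comment> \<open>The minus sign and the factor L^-2 of the cleared identity are absorbed here: x
    y = 1 gives (1 - x) / (1 - y) = -x.\<close>
  also have "qinf q x * qinf q (q * y) / qinf q y = - x * qinf q (q * x)"
  proof -
    have "qinf q x * qinf q (q * y) / qinf q y = (1 - x) / (1 - y) * qinf q (q * x)"
      unfolding sx sy using nz by simp
    also have "(1 - x) / (1 - y) = - x" using xy k1 by (simp add: divide_eq_eq algebra_simps)
    finally show ?thesis .
  qed
  finally have "qinf q x * qinf q (q * y) * (connection_const * (qinf q (t * x) / qinf q x * hyp_sol L m + qinf q (t * y) / qinf q y * hyp_sol (inverse L) m)) =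
     qinf q x * qinf q (q * y) * Phi_coeff L m"
    unfolding eq by (simp add: algebra_simps)
  then show ?thesis unfolding s1 using nz by (simp only: mult_cancel_left) auto
qed

lemma connection_const_eq: "(1 - t\<^sup>2) * connection_const = (1 - t)\<^sup>2 * mu_ct q t"
proof -
  have a: "qinf q (t\<^sup>2) = (1 - t\<^sup>2) * qinf q (t\<^sup>2 * q)" "qinf q t = (1 - t) * qinf q (t * q)"
    by (rule qinf_shift[OF q_norm])+
  have "1 - t\<^sup>2 \<noteq> 0" "qinf q (t\<^sup>2 * q) \<noteq> 0" using qinf_t2_nonzero a by auto
  then show ?thesis using qinf_qq_nonzero[OF q_norm]
    unfolding connection_const_def winf_def mu_ct_eq[OF q_norm] a by (simp add: power2_eq_square mult_ac)
qed

end

no_notation Infinite_Set_Sum.abs_summable_on (infix \<open>abs'_summable'_on\<close> 50)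
notation Infinite_Sum.abs_summable_on (infixr \<open>abs'_summable'_on\<close> 46)

subsection \<open>Geometrically bounded sequences\<close>

text \<open>Growth at most exponential in |n|. The class is closed under sums, products and shifts
  and is beaten by r^(n^2) for |r| < 1, so summability below reduces to composing closure
  rules.\<close>

definition geom :: "(int \<Rightarrow> complex) \<Rightarrow> bool" where
  "geom f \<longleftrightarrow> (\<exists>K\<ge>0. \<exists>D\<ge>1. \<forall>n. norm (f n) \<le> K * D ^ nat \<bar>n\<bar>)"

lemma geomI: "K \<ge> 0 \<Longrightarrow> D \<ge> 1 \<Longrightarrow> (\<And>n. norm (f n) \<le> K * D ^ nat \<bar>n\<bar>) \<Longrightarrow> geom f"
  unfolding geom_def by blast

lemma geom_bounded: "(\<And>n. norm (f n) \<le> K) \<Longrightarrow> geom f"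
  by (rule geomI[of K 1]) (auto intro: order.trans[OF norm_ge_zero])

lemma geom_const: "geom (\<lambda>n. c)"
  by (rule geom_bounded) (rule order.refl)

lemma geom_mult:
  assumes "geom f" "geom g"
  shows "geom (\<lambda>n. f n * g n)"
proof -
  obtain K D where 1: "K \<ge> 0" "D \<ge> 1" "\<And>n. norm (f n) \<le> K * D ^ nat \<bar>n\<bar>" using assms(1) unfolding geom_def by blast
  obtain K' D' where 2: "K' \<ge> 0" "D' \<ge> 1" "\<And>n. norm (g n) \<le> K' * D' ^ nat \<bar>n\<bar>" using assms(2) unfolding geom_def by blast
  show ?thesis
  proof (rule geomI)
    show "K * K' \<ge> 0" using 1 2 by simp
    show "D * D' \<ge> 1" using mult_mono[OF 1(2) 2(2)] 1 2 by simp
    fix n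
    have "norm (f n * g n) \<le> (K * D ^ nat \<bar>n\<bar>) * (K' * D' ^ nat \<bar>n\<bar>)"
      unfolding norm_mult by (intro mult_mono 1 2) (use 1 2 in auto)
    then show "norm (f n * g n) \<le> K * K' * (D * D') ^ nat \<bar>n\<bar>" by (simp add: power_mult_distrib mult_ac)
  qed
qed

lemma geom_add:
  assumes "geom f" "geom g"
  shows "geom (\<lambda>n. f n + g n)"
proof -
  obtain K D where 1: "K \<ge> 0" "D \<ge> 1" "\<And>n. norm (f n) \<le> K * D ^ nat \<bar>n\<bar>" using assms(1) unfolding geom_def by blast
  obtain K' D' where 2: "K' \<ge> 0" "D' \<ge> 1" "\<And>n. norm (g n) \<le> K' * D' ^ nat \<bar>n\<bar>" using assms(2) unfolding geom_def by blast
  show ?thesis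
  proof (rule geomI)
    show "K + K' \<ge> 0" using 1 2 by simp
    show "max D D' \<ge> 1" using 1 by simp
    fix n
    have "norm (f n + g n) \<le> norm (f n) + norm (g n)" by (rule norm_triangle_ineq)
    also have "\<dots> \<le> K * D ^ nat \<bar>n\<bar> + K' * D' ^ nat \<bar>n\<bar>" by (intro add_mono 1 2)
    also have "\<dots> \<le> K * max D D' ^ nat \<bar>n\<bar> + K' * max D D' ^ nat \<bar>n\<bar>"
      by (intro add_mono mult_left_mono power_mono) (use 1 2 in auto)
    finally show "norm (f n + g n) \<le> (K + K') * max D D' ^ nat \<bar>n\<bar>" by (simp add: distrib_right)
  qed
qed

lemma geom_diff: "geom f \<Longrightarrow> geom g \<Longrightarrow> geom (\<lambda>n. f n - g n)"
  using geom_add[of f "\<lambda>n. - 1 * g n"] geom_mult[OF geom_const[of "- 1"], of g] by simp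

lemma geom_shift:
  assumes "geom f"
  shows "geom (\<lambda>n. f (n + c))"
proof -
  obtain K D where 1: "K \<ge> 0" "D \<ge> 1" "\<And>n. norm (f n) \<le> K * D ^ nat \<bar>n\<bar>" using assms unfolding geom_def by blast
  show ?thesis
  proof (rule geomI)
    show "K * D ^ nat \<bar>c\<bar> \<ge> 0" "D \<ge> 1" using 1 by simp_all
    fix n
    have "norm (f (n + c)) \<le> K * D ^ nat \<bar>n + c\<bar>" by (rule 1)
    also have "\<dots> \<le> K * D ^ (nat \<bar>c\<bar> + nat \<bar>n\<bar>)"
      using 1 by (intro mult_left_mono power_increasing) auto
    finally show "norm (f (n + c)) \<le> K * D ^ nat \<bar>c\<bar> * D ^ nat \<bar>n\<bar>" by (simp add: power_add)
  qed
qed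

lemma geom_shift_diff: "geom f \<Longrightarrow> geom (\<lambda>n. f (n - c))"
  using geom_shift[of f "- c"] by simp

lemma geom_powi: "geom (\<lambda>n. z powi n)"
proof -
  define B where "B = max 1 (max (norm z) (norm (inverse z)))"
  show ?thesis
  proof (rule geomI[of 1 B])
    show "norm (z powi n) \<le> 1 * B ^ nat \<bar>n\<bar>" for n
      using norm_powi_le[of z B n] by (simp add: B_def)
  qed (auto simp: B_def)
qed

lemma geom_gauss_abs_summable:
  assumes r: "norm r < 1" and f: "geom f"
  shows "(\<lambda>n::int. r powi (n\<^sup>2) * f n) abs_summable_on UNIV"
proof -
  obtain K D where 1: "K \<ge> 0" "D \<ge> 1" "\<And>n. norm (f n) \<le> K * D ^ nat \<bar>n\<bar>" using f unfolding geom_def by blast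
  have "(\<lambda>i::int. K * (norm r ^ nat (i\<^sup>2) * D ^ nat \<bar>i\<bar>)) summable_on UNIV"
    using 1 by (intro summable_on_cmult_right gauss_summable_int r) auto
  moreover have "norm (r powi (n\<^sup>2) * f n) \<le> K * (norm r ^ nat (n\<^sup>2) * D ^ nat \<bar>n\<bar>)" for n :: int
  proof -
    have "norm (r powi (n\<^sup>2) * f n) = norm r ^ nat (n\<^sup>2) * norm (f n)"
      by (simp add: power_int_def norm_mult norm_power)
    also have "\<dots> \<le> norm r ^ nat (n\<^sup>2) * (K * D ^ nat \<bar>n\<bar>)" by (intro mult_left_mono 1) auto
    finally show ?thesis by (simp add: mult_ac)
  qed
  ultimately show ?thesis by (rule summable_on_comparison_test) auto
qed

lemmas geom_gauss_summable = geom_gauss_abs_summable[THEN abs_summable_summable]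

lemma theta_has_sum:
  assumes "norm r < 1"
  shows "((\<lambda>n::int. r powi (n\<^sup>2) * z powi n) has_sum theta r z) UNIV"
  unfolding theta_def using geom_gauss_summable[OF assms geom_powi[of z]] by simp

text \<open>Completing the square: q^(n^2/4) q^(-n/2) = q^(-1/4) q^((n-1)^2/4), followed by a shift
  of n.\<close>

lemma theta_quasi_periodic:
  assumes r: "norm r < 1" "r \<noteq> 0" and z: "z \<noteq> 0"
  shows "theta r (z / r\<^sup>2) = inverse r * z * theta r z"
proof -
  have "theta r (z / r\<^sup>2) = infsum (\<lambda>n::int. inverse r * z * (r powi ((n - 1)\<^sup>2) * z powi (n - 1))) UNIV"
    unfolding theta_def
  proof (rule infsum_cong)
    fix n :: int
    have "r powi ((n - 1)\<^sup>2) = r powi (n\<^sup>2) * r powi (- 2 * n) * r"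
      using r power_int_add[of r "n\<^sup>2" "- 2 * n"] power_int_add[of r "n\<^sup>2 + (- 2 * n)" 1]
      by (simp add: power2_eq_square algebra_simps)
    moreover have "(z / r\<^sup>2) powi n = z powi n * r powi (- 2 * n)"
    proof -
      have "(r\<^sup>2) powi n = r powi (2 * n)" by (metis power_int_mult power_int_numeral)
      then show ?thesis unfolding power_int_divide_distrib by (simp add: power_int_minus divide_inverse)
    qed
    moreover have "z powi n = z * z powi (n - 1)" using z power_int_add[of z 1 "n - 1"] by simp
    ultimately show "r powi (n\<^sup>2) * (z / r\<^sup>2) powi n = inverse r * z * (r powi ((n - 1)\<^sup>2) * z powi (n - 1))"
      using r by simp
  qed
  also have "\<dots> = infsum (\<lambda>n::int. inverse r * z * (r powi (n\<^sup>2) * z powi n)) UNIV"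
    using infsum_shift_int[of "\<lambda>n. inverse r * z * (r powi (n\<^sup>2) * z powi n)" "-1"] by simp
  also have "\<dots> = inverse r * z * theta r z"
    unfolding theta_def by (rule infsum_cmult_right) (use geom_gauss_summable[OF r(1) geom_powi[of z]] in auto)
  finally show ?thesis .
qed

context main_params
begin

lemma r_norm: "norm r < 1"
proof -
  have "norm r ^ 4 < 1" using q_norm by (simp add: q_eq norm_power)
  then show ?thesis by (simp add: power_less_one_iff)
qed

lemma geom_Rn: "geom Rn"
  using Rn_bounded by (metis geom_bounded)

text \<open>The absolute values stand inside the sum because the double series for \<Phi> has to
  converge absolutely before it is rearranged by powers of X.\<close>

lemma geom_bracket_abs:
  assumes H: "\<And>x y. norm x \<le> 1 \<Longrightarrow> norm y \<le> 1 \<Longrightarrow> norm (h x y) \<le> H"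
  shows "geom (\<lambda>n. of_real (\<Sum>i\<in>{0..n}. norm (w i * w (n - i) * h (q powi i) (q powi (n - i)) * z powi (2 * i - n))))"
proof -
  obtain M where M: "M > 0" "\<And>i. norm (w i) \<le> M" using wq_bounded[OF q_norm, of t] by auto
  define B where "B = max 1 (max (norm z) (norm (inverse z)))"
  have B: "B \<ge> 1" "norm z \<le> B" "norm (inverse z) \<le> B" by (auto simp: B_def)
  have H0: "H \<ge> 0" using order.trans[OF norm_ge_zero H[of 0 0]] by simp
  show ?thesis
  proof (rule geomI[of "M * M * H" "2 * B"])
    fix n :: int
    show "norm (of_real (\<Sum>i\<in>{0..n}. norm (w i * w (n - i) * h (q powi i) (q powi (n - i)) * z powi (2 * i - n))) :: complex)
       \<le> M * M * H * (2 * B) ^ nat \<bar>n\<bar>"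
    proof (cases "n \<ge> 0")
      case True
      then obtain k where k: "n = int k" by (metis nonneg_int_cases)
      have "(\<Sum>i\<in>{0..n}. norm (w i * w (n - i) * h (q powi i) (q powi (n - i)) * z powi (2 * i - n))) \<le> (\<Sum>i\<in>{0..n}. M * M * H * B ^ k)"
      proof (rule sum_mono)
        fix i assume i: "i \<in> {0..n}"
        have q1: "norm (q powi j) \<le> 1" if "j \<ge> 0" for j :: int
          using that q_norm by (simp add: power_int_def norm_power power_le_one)
        have "norm (z powi (2 * i - n)) \<le> B ^ nat \<bar>2 * i - n\<bar>" by (rule norm_powi_le[OF B(2,3)])
        also have "\<dots> \<le> B ^ k" by (rule power_increasing) (use i B k in auto)
        finally have "norm (z powi (2 * i - n)) \<le> B ^ k" .
        then show "norm (w i * w (n - i) * h (q powi i) (q powi (n - i)) * z powi (2 * i - n)) \<le> M * M * H * B ^ k"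
          unfolding norm_mult using i by (intro mult_mono M H q1) (use M H0 B in auto)
      qed
      also have "\<dots> = M * M * H * (real k + 1) * B ^ k" by (simp add: k)
      also have "\<dots> \<le> M * M * H * 2 ^ k * B ^ k"
      proof -
        have "real k + 1 \<le> 2 ^ k" by (induction k) auto
        then show ?thesis using M H0 B by (intro mult_right_mono mult_left_mono) auto
      qed
      finally have "(\<Sum>i\<in>{0..n}. norm (w i * w (n - i) * h (q powi i) (q powi (n - i)) * z powi (2 * i - n))) \<le> M * M * H * (2 * B) ^ k"
        by (simp add: power_mult_distrib mult.assoc)
      moreover have "(\<Sum>i\<in>{0..n}. norm (w i * w (n - i) * h (q powi i) (q powi (n - i)) * z powi (2 * i - n))) \<ge> 0"
        by (rule sum_nonneg) simp
      ultimately show ?thesis by (simp only: norm_of_real abs_of_nonneg) (simp add: k)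
    next
      case False
      then show ?thesis using M H0 B by simp
    qed
  qed (use M H0 B in auto)
qed

lemma geom_bracket:
  assumes H: "\<And>x y. norm x \<le> 1 \<Longrightarrow> norm y \<le> 1 \<Longrightarrow> norm (h x y) \<le> H"
  shows "geom (\<lambda>n. bracket n h z)"
proof -
  obtain K D where 1: "K \<ge> 0" "D \<ge> 1" "\<And>n. norm (of_real (\<Sum>i\<in>{0..n}. norm (w i * w (n - i) * h (q powi i) (q powi (n - i)) * z powi (2 * i - n))) :: complex) \<le> K * D ^ nat \<bar>n\<bar>"
    using geom_bracket_abs[of h H z, OF H] unfolding geom_def by blast
  show ?thesis
  proof (rule geomI[OF 1(1,2)])
    fix n
    have "norm (bracket n h z) \<le> (\<Sum>i\<in>{0..n}. norm (w i * w (n - i) * h (q powi i) (q powi (n - i)) * z powi (2 * i - n)))"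
      unfolding bracket_def by (rule norm_sum)
    also have "\<dots> \<le> norm (of_real (\<Sum>i\<in>{0..n}. norm (w i * w (n - i) * h (q powi i) (q powi (n - i)) * z powi (2 * i - n))) :: complex)"
      by (simp only: norm_of_real abs_ge_self)
    also have "\<dots> \<le> K * D ^ nat \<bar>n\<bar>" by (rule 1(3))
    finally show "norm (bracket n h z) \<le> K * D ^ nat \<bar>n\<bar>" .
  qed
qed

lemma geom_rogers: "geom (\<lambda>n. rogers n z)"
  by (rule geom_bracket[of _ 1]) simp

lemma geom_a_val: "geom (\<lambda>n. a_val n z)"
proof -
  have "geom (\<lambda>n. bracket n (\<lambda>x y. 1 - t * y) z)"
  proof (rule geom_bracket)
    fix x y :: complex assume "norm y \<le> 1"
    then show "norm (1 - t * y) \<le> 1 + norm t"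
      using norm_triangle_ineq4[of 1 "t * y"] mult_left_mono[of "norm y" 1 "norm t"] by (simp add: norm_mult)
  qed
  from geom_mult[OF this geom_const[of "1 / (1 - t)"]] show ?thesis by (simp add: a_val_def)
qed

lemma geom_b_val: "geom (\<lambda>n. b_val n z)"
proof -
  have "geom (\<lambda>n. bracket n (\<lambda>x y. y * (1 - x)) z)"
  proof (rule geom_bracket)
    fix x y :: complex assume *: "norm x \<le> 1" "norm y \<le> 1"
    have "norm (1 - x) \<le> 2" using norm_triangle_ineq4[of 1 x] * by simp
    then show "norm (y * (1 - x)) \<le> 2" using mult_mono[of "norm y" 1 "norm (1 - x)" 2] * by (simp add: norm_mult)
  qed
  from geom_mult[OF this geom_const[of "1 / (1 - t)"]] show ?thesis by (simp add: b_val_def)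
qed

subsection \<open>The symmetric function\<close>

text \<open>Defined for all integers and zero for n < 0, so that the level-by-level comparison with
  \<Psi> can shift indices freely.\<close>

definition Phi_summand :: "complex \<Rightarrow> complex \<Rightarrow> int \<Rightarrow> complex" where
  "Phi_summand X L n = r powi (n\<^sup>2) * (u powi n * ((1 - t * q powi n) / (1 - t)) * Rn n * rogers n L) * rogers n X"

lemma leval_P_poly: "leval (P_poly r u n) z = (1 - t * q ^ n) / ((1 - t) * p (int n)) * rogers (int n) z"
proof (cases "n = 0")
  case True
  have "leval 1 z = 1" using leval_lpb[of 0 "\<lambda>i. 1" z] by (simp add: lpb_def)
  then show ?thesis using True t_neq_1 by (simp add: P_poly_0 bracket_def)
next
  case False
  then have "leval (P_poly r u n) z = 1 / p (int n) * (a_val (int n) z + t * b_val (int n) z)"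
    by (simp only: P_poly_eq c_lpb leval_lscale leval_add leval_a_poly leval_b_poly neq0_conv)
  also have "a_val (int n) z + t * b_val (int n) z = (1 - t * q ^ n) / (1 - t) * rogers (int n) z"
    using rogers_eq_a_val_b_val[of "int n" z] t_neq_1 by (simp add: field_simps)
  finally show ?thesis by simp
qed

lemma one_minus_t2: "1 - t\<^sup>2 = (1 - t) * (1 + t)" "1 - t\<^sup>2 \<noteq> 0" "1 - t \<noteq> 0"
proof -
  show e: "1 - t\<^sup>2 = (1 - t) * (1 + t)" by (simp add: power2_eq_square algebra_simps)
  show "1 - t \<noteq> 0" using t_neq_1 by simp
  then show "1 - t\<^sup>2 \<noteq> 0" unfolding e using t_neq_minus_1 by simp
qed

lemma Rn_of_nat_Suc: "Rn (int (Suc k)) = qpoch q q (Suc k) / ((1 - t\<^sup>2) * qpoch q (t\<^sup>2 * q) k)"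
  unfolding Rn_def wq_of_nat qpoch_Suc_shift[of q "t\<^sup>2"] by simp

lemma Phi_term_eq: "Phi_term r u X L n = Phi_summand X L (int n)"
proof -
  \<comment> \<open>Here the squared normalization and the closed form of the norm combine to
    \<open>Rn\<close>. The index 0 is separate because \<open>P_norm_eq\<close> covers positive
    degrees only.\<close>
  have e: "((1 - t * q ^ n) / ((1 - t) * p (int n)))\<^sup>2 / P_norm r u n = (1 - t * q ^ n) / (1 - t) * Rn (int n)"
  proof (cases n)
    case 0
    then show ?thesis using one_minus_t2 by (simp add: P_norm_0 Rn_def)
  next
    case (Suc k)
    define a where "a = qpoch q (t * q) k"
    define b where "b = qpoch q (t\<^sup>2 * q) k"
    define c where "c = qpoch q q n"
    define z where "z = 1 - t * q ^ n"
    have a': "qpoch q (t * q) n = a * z" by (simp add: Suc qpoch_Suc a_def z_def mult_ac)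
    have nz: "a \<noteq> 0" "b \<noteq> 0" "c \<noteq> 0" "z \<noteq> 0"
      using tqq_nonzero[of n] t2q_nonzero[of k] qq_nonzero[of n] unfolding a' by (auto simp: b_def c_def)
    have P: "P_norm r u n = (1 + t) * c * b / (a * (a * z))"
      using P_norm_eq[of k] a' by (simp add: Suc a_def b_def c_def)
    have pn: "p (int n) = a * z / c" by (simp add: wq_of_nat a' c_def)
    have R: "Rn (int n) = c / ((1 - t) * (1 + t) * b)"
      using Rn_of_nat_Suc[of k] by (simp add: Suc b_def c_def one_minus_t2(1))
    show ?thesis unfolding P pn R z_def[symmetric]
      using nz t_neq_minus_1 one_minus_t2(3) by (simp add: power2_eq_square frac_eq_eq)
  qed
  have "(a * x) * (a * y) / N = a\<^sup>2 / N * y * x" for a x y N :: complex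
    by (simp add: power2_eq_square)
  note f = this[of "(1 - t * q ^ n) / ((1 - t) * p (int n))" "rogers (int n) X" "rogers (int n) L" "P_norm r u n", unfolded e]
  have "Phi_term r u X L n = r ^ (n\<^sup>2) * u ^ n * ((1 - t * q ^ n) / (1 - t) * Rn (int n) * rogers (int n) L * rogers (int n) X)"
    unfolding Phi_term_def leval_P_poly times_divide_eq_right[symmetric, of "r ^ (n\<^sup>2) * u ^ n"] f ..
  then show ?thesis by (simp add: Phi_summand_def mult_ac flip: power_int_of_nat)
qed

lemma Phi_summand_neg: "n < 0 \<Longrightarrow> Phi_summand X L n = 0"
  by (simp add: Phi_summand_def bracket_def)

lemma Phi_summand_summable: "Phi_summand X L summable_on UNIV"
  unfolding Phi_summand_def mult.assoc[of "r powi _"]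
  by (intro geom_gauss_summable r_norm geom_mult geom_powi geom_Rn geom_rogers)
    (use geom_mult[OF geom_diff[OF geom_const geom_mult[OF geom_const geom_powi]] geom_const[of "1 / (1 - t)"], of 1 t q] in simp)

lemma Phi_summable: "summable (Phi_term r u X L)"
  and Phi_eq_infsum: "Phi r u X L = infsum (Phi_summand X L) UNIV"
proof -
  have e: "Phi_term r u X L = (\<lambda>n. Phi_summand X L (int n))" by (rule ext) (rule Phi_term_eq)
  show "summable (Phi_term r u X L)" unfolding e by (rule infsum_int_eq_suminf(2)[OF Phi_summand_summable Phi_summand_neg])
  show "Phi r u X L = infsum (Phi_summand X L) UNIV"
    unfolding Phi_def e by (rule infsum_int_eq_suminf(1)[OF Phi_summand_summable Phi_summand_neg, symmetric])
qed

text \<open>The double sum over the degree n and the index i of the bracket converges absolutely and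
  is regrouped by the exponent m = n - 2i of X.\<close>

lemma Phi_eq_Phi_coeff:
  assumes X: "X \<noteq> 0" and L: "L \<noteq> 0"
  shows "Phi r u X L = infsum (\<lambda>m. X powi m * r powi (m\<^sup>2) * u powi m * Phi_coeff L m / (1 - t)) UNIV"
proof -
  define g where "g n = u powi n * ((1 - t * q powi n) / (1 - t)) * Rn n * rogers n L" for n
  define F where "F = (\<lambda>(n, i). r powi (n\<^sup>2) * g n * (w i * w (n - i) * X powi (n - 2 * i)))"
  define S where "S n = (\<Sum>i\<in>{0..n}. norm (w i * w (n - i) * X powi (n - 2 * i)))" for n
  define A where "A = Sigma UNIV (\<lambda>n::int. {0..n})"
  define B where "B = Sigma UNIV (\<lambda>m::int. {i. i \<ge> 0 \<and> m + i \<ge> 0})"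
  have gg: "geom g"
    unfolding g_def
    by (intro geom_mult geom_powi geom_Rn geom_rogers)
      (use geom_mult[OF geom_diff[OF geom_const geom_mult[OF geom_const geom_powi]] geom_const[of "1 / (1 - t)"], of 1 t q] in simp)
  have gS: "geom (\<lambda>n. of_real (S n))"
  proof -
    have "(inverse X) powi (2 * i - n) = X powi (n - 2 * i)" for i n
      by (simp add: power_int_inverse flip: power_int_minus)
    then show ?thesis using geom_bracket_abs[of "\<lambda>x y. 1" 1 "inverse X"] by (simp add: S_def)
  qed
  have absF: "F abs_summable_on A"
    unfolding A_def Infinite_Sum.abs_summable_on_Sigma_iff
  proof (intro conjI ballI)
    show "(\<lambda>i. F (n, i)) abs_summable_on {0..n}" for n by simp
    have "infsum (\<lambda>i. norm (F (n, i))) {0..n} = norm (r powi (n\<^sup>2) * (g n * of_real (S n)))" for n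
    proof -
      have "S n \<ge> 0" unfolding S_def by (rule sum_nonneg) simp
      then have "norm (r powi (n\<^sup>2) * (g n * of_real (S n))) = norm (r powi (n\<^sup>2) * g n) * S n"
        by (simp add: norm_mult del: of_real_sum)
      then show ?thesis by (simp add: F_def norm_mult S_def sum_distrib_left mult_ac)
    qed
    then show "(\<lambda>n. infsum (\<lambda>i. norm (F (n, i))) {0..n}) abs_summable_on UNIV"
      using geom_gauss_abs_summable[OF r_norm geom_mult[OF gg gS]] by simp
  qed
  have sF: "F summable_on A" by (rule abs_summable_summable[OF absF])
  have "Phi r u X L = infsum (\<lambda>n. infsum (\<lambda>i. F (n, i)) {0..n}) UNIV"
  proof -
    have "Phi_summand X L n = infsum (\<lambda>i. F (n, i)) {0..n}" for n
    proof -
      have "rogers n X = (\<Sum>i\<in>{0..n}. w i * w (n - i) * X powi (n - 2 * i))"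
        by (subst rogers_inverse[symmetric]) (simp add: bracket_def power_int_inverse flip: power_int_minus)
      then show ?thesis by (simp add: Phi_summand_def F_def g_def sum_distrib_left)
    qed
    then show ?thesis unfolding Phi_eq_infsum by (rule infsum_cong)
  qed
  also have "\<dots> = infsum F A"
    unfolding A_def using infsum_Sigma'_banach[of "\<lambda>n i. F (n, i)" UNIV "\<lambda>n. {0..n}"] sF by (simp add: A_def case_prod_eta)
  also have "\<dots> = infsum (\<lambda>(m, i). F (m + 2 * i, i)) B"
    unfolding A_def B_def by (rule infsum_reindex_bij_witness[of _ "\<lambda>(m, i). (m + 2 * i, i)" "\<lambda>(n, i). (n - 2 * i, i)"]) auto
  also have "\<dots> = infsum (\<lambda>m. infsum (\<lambda>i. F (m + 2 * i, i)) {i. i \<ge> 0 \<and> m + i \<ge> 0}) UNIV"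
  proof -
    have "(\<lambda>(m, i). F (m + 2 * i, i)) summable_on B"
      using sF unfolding A_def B_def
      by (subst (asm) summable_on_reindex_bij_witness[of _ "\<lambda>(m, i). (m + 2 * i, i)" "\<lambda>(n, i). (n - 2 * i, i)" "Sigma UNIV (\<lambda>m::int. {i. i \<ge> 0 \<and> m + i \<ge> 0})" "\<lambda>(m, i). F (m + 2 * i, i)"]) auto
    then show ?thesis
      unfolding B_def using infsum_Sigma'_banach[of "\<lambda>m i. F (m + 2 * i, i)" UNIV "\<lambda>m. {i. i \<ge> 0 \<and> m + i \<ge> 0}"] by simp
  qed
  also have "\<dots> = infsum (\<lambda>m. X powi m * r powi (m\<^sup>2) * u powi m * Phi_coeff L m / (1 - t)) UNIV"
  proof (rule infsum_cong)
    fix m :: int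
    have F: "F (m + 2 * i, i) = X powi m * r powi (m\<^sup>2) * u powi m / (1 - t) * Phi_coeff_term L m i" for i
    proof -
      have "r powi ((m + 2 * i)\<^sup>2) = r powi (m\<^sup>2) * q powi (i\<^sup>2 + m * i)"
        using r_nonzero power_int_add[of r "m\<^sup>2" "4 * (i\<^sup>2 + m * i)"] unfolding r_powi[symmetric]
        by (simp add: power2_eq_square algebra_simps)
      moreover have "u powi (m + 2 * i) = u powi m * t powi i"
        using u_nonzero by (simp add: power_int_add power_int_mult t_eq)
      moreover have "m + 2 * i - i = m + i" "m + 2 * i - 2 * i = m" by simp_all
      ultimately show ?thesis by (simp add: F_def g_def Phi_coeff_term_def bracket_term_def mult_ac add.commute[of m i])
    qed
    have "infsum (\<lambda>i. F (m + 2 * i, i)) {i. i \<ge> 0 \<and> m + i \<ge> 0} = infsum (\<lambda>i. X powi m * r powi (m\<^sup>2) * u powi m / (1 - t) * Phi_coeff_term L m i) UNIV"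
      unfolding F by (rule infsum_cong_neutral) (auto simp: Phi_coeff_term_def bracket_term_def not_le)
    also have "\<dots> = X powi m * r powi (m\<^sup>2) * u powi m / (1 - t) * Phi_coeff L m"
      unfolding Phi_coeff_def by (rule infsum_cmult_right) (use Phi_coeff_term_summable[OF L] in auto)
    finally show "infsum (\<lambda>i. F (m + 2 * i, i)) {i. i \<ge> 0 \<and> m + i \<ge> 0} = X powi m * r powi (m\<^sup>2) * u powi m * Phi_coeff L m / (1 - t)"
      by simp
  qed
  finally show ?thesis .
qed

section \<open>Theta function times hypergeometric series\<close>

definition hyp_term :: "complex \<Rightarrow> complex \<Rightarrow> nat \<Rightarrow> complex" where
  "hyp_term X L j = (q / t) ^ j * X powi (- 2 * int j) * hyp_prod q t L j"

text \<open>The q-products in \<open>hyp_prod\<close> converge and hence stay bounded, so a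
  geometric series with ratio q / (t X^2) dominates. That the ratio has modulus below 1 is exactly
  |X| > |t|^(-1/2) |q|^(1/2).\<close>

lemma hyp_term_abs_summable:
  assumes X: "norm (q / t * X powi (- 2)) < 1" and L: "\<And>k :: int. L\<^sup>2 \<noteq> q powi k"
  shows "summable (\<lambda>j. norm (hyp_term X L j))"
proof -
  obtain M where M: "M > 0" "\<And>i. norm (w i) \<le> M" using wq_bounded[OF q_norm, of t] by auto
  have nz: "qinf q (q * L\<^sup>2) \<noteq> 0" using qinf_neq_0[OF L, of 1] by (simp add: mult.commute)
  have "(\<lambda>j. qpoch q (t * L\<^sup>2) j / qpoch q (q * L\<^sup>2) j) \<longlonglongrightarrow> qinf q (t * L\<^sup>2) / qinf q (q * L\<^sup>2)"
    by (intro tendsto_divide qpoch_LIMSEQ q_norm nz)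
  then have "Bseq (\<lambda>j. qpoch q (t * L\<^sup>2) j / qpoch q (q * L\<^sup>2) j)" by (intro convergent_imp_Bseq convergentI)
  then obtain N where N: "N > 0" "\<And>j. norm (qpoch q (t * L\<^sup>2) j / qpoch q (q * L\<^sup>2) j) \<le> N" by (auto simp: Bseq_def)
  define x where "x = q / t * X powi (- 2)"
  have eq: "hyp_term X L j = x ^ j * hyp_prod q t L j" for j
  proof -
    have "X powi (- 2 * int j) = (X powi (- 2)) ^ j" by (simp only: power_int_mult power_int_of_nat)
    then show ?thesis by (simp add: hyp_term_def x_def power_mult_distrib power_divide)
  qed
  show ?thesis
  proof (rule summable_comparison_test')
    show "summable (\<lambda>j. (M * N) * norm x ^ j)"
      using X by (intro summable_mult summable_geometric) (simp add: x_def)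
    show "norm (norm (hyp_term X L j)) \<le> (M * N) * norm x ^ j" for j
    proof -
      have "norm (hyp_prod q t L j) \<le> M * N" unfolding hyp_prod_eq norm_mult[of "w _"] by (intro mult_mono M N) (use M in auto)
      then have "norm x ^ j * norm (hyp_prod q t L j) \<le> norm x ^ j * (M * N)" by (rule mult_left_mono) simp
      then show ?thesis by (simp add: eq norm_mult norm_power mult_ac)
    qed
  qed
qed

text \<open>The product of the two series is regrouped by m = n - 2j. From (m + 2j)^2 / 4 = m^2 / 4
  + j^2 + m j come the powers q^(j^2) and (q^m)^j of \<open>hyp_sol\<close>, and t^j (q/t)^j = q^j
  supplies the rest.\<close>

lemma theta_hyp_sol_has_sum:
  assumes X: "X \<noteq> 0" "norm (q / t * X powi (- 2)) < 1" and L: "L \<noteq> 0" "\<And>k :: int. L\<^sup>2 \<noteq> q powi k"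
  shows "((\<lambda>m. X powi m * r powi (m\<^sup>2) * u powi m * hyp_sol L m) has_sum (theta r (X * L * u) * suminf (hyp_term X L))) UNIV"
proof -
  define a where "a n = r powi (n\<^sup>2) * (X * L * u) powi n" for n :: int
  define F where "F = (\<lambda>(n, j). a n * hyp_term X L j)"
  have aa: "a abs_summable_on UNIV" unfolding a_def by (intro geom_gauss_abs_summable r_norm geom_powi)
  have sn: "summable (\<lambda>j. norm (hyp_term X L j))" by (rule hyp_term_abs_summable[OF X(2) L(2)])
  have ha: "hyp_term X L abs_summable_on UNIV" using sn by (simp add: summable_on_UNIV_nonneg_real_iff)
  have "F abs_summable_on (UNIV \<times> UNIV)"
    unfolding Infinite_Sum.abs_summable_on_Sigma_iff
  proof (intro conjI ballI)
    show "(\<lambda>j. F (n, j)) abs_summable_on UNIV" for n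
      using summable_on_cmult_right[OF ha, of "norm (a n)"] by (simp add: F_def norm_mult)
    have "infsum (\<lambda>j. norm (F (n, j))) UNIV = norm (a n) * infsum (\<lambda>j. norm (hyp_term X L j)) UNIV" for n
      by (simp add: F_def norm_mult infsum_cmult_right')
    then show "(\<lambda>n. infsum (\<lambda>j. norm (F (n, j))) UNIV) abs_summable_on UNIV"
      using summable_on_cmult_left[OF aa, of "infsum (\<lambda>j. norm (hyp_term X L j)) UNIV"]
      by (simp add: abs_mult infsum_nonneg)
  qed
  then have sF: "F summable_on (UNIV \<times> UNIV)" by (rule abs_summable_summable)
  have hh: "infsum (hyp_term X L) UNIV = suminf (hyp_term X L)"
    using has_sum_imp_sums[OF has_sum_infsum[OF abs_summable_summable[OF ha]]] by (simp add: sums_iff)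
  have v: "infsum F (UNIV \<times> UNIV) = theta r (X * L * u) * suminf (hyp_term X L)"
  proof -
    have "infsum F (UNIV \<times> UNIV) = infsum (\<lambda>n. infsum (\<lambda>j. F (n, j)) UNIV) UNIV"
      using infsum_Sigma'_banach[of "\<lambda>n j. F (n, j)" UNIV "\<lambda>_. UNIV"] sF by (simp add: case_prod_eta)
    also have "\<dots> = infsum (\<lambda>n. a n * suminf (hyp_term X L)) UNIV"
      by (simp add: F_def infsum_cmult_right' hh)
    also have "\<dots> = theta r (X * L * u) * suminf (hyp_term X L)"
      by (simp add: infsum_cmult_left' a_def theta_def)
    finally show ?thesis .
  qed
  have "(F has_sum (theta r (X * L * u) * suminf (hyp_term X L))) (UNIV \<times> UNIV)"
    using sF unfolding v[symmetric] by simp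
  then have 1: "((\<lambda>(m, j). F (m + 2 * int j, j)) has_sum (theta r (X * L * u) * suminf (hyp_term X L))) (UNIV \<times> UNIV)"
    by (rule has_sum_reindex_bij_witness[of _ "\<lambda>(m, j). (m + 2 * int j, j)" "\<lambda>(n, j). (n - 2 * int j, j)", THEN iffD1, rotated -1]) auto
  have F: "F (m + 2 * int j, j) = X powi m * r powi (m\<^sup>2) * u powi m * L powi m * (q ^ (j\<^sup>2 + j) * L ^ (2 * j) * hyp_prod q t L j * (q powi m) ^ j)" for m j
  proof -
    have "r powi ((m + 2 * int j)\<^sup>2) = r powi (m\<^sup>2) * q powi ((int j)\<^sup>2 + m * int j)"
      using r_nonzero power_int_add[of r "m\<^sup>2" "4 * ((int j)\<^sup>2 + m * int j)"] unfolding r_powi[symmetric]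
      by (simp add: power2_eq_square algebra_simps)
    also have "q powi ((int j)\<^sup>2 + m * int j) = q ^ (j\<^sup>2) * (q powi m) ^ j"
      by (simp only: q_powi_add power_int_mult power_int_of_nat) (simp flip: of_nat_power power_int_of_nat)
    finally have r1: "r powi ((m + 2 * int j)\<^sup>2) = r powi (m\<^sup>2) * (q ^ (j\<^sup>2) * (q powi m) ^ j)" .
    have pw: "z powi (m + 2 * int j) = z powi m * z ^ (2 * j)" if "z \<noteq> 0" for z :: complex
      using that power_int_add[of z m "int (2 * j)"] by (simp flip: power_int_of_nat)
    have x1: "X powi (- 2 * int j) * X ^ (2 * j) = 1"
      using X(1) by (simp add: power_int_minus flip: power_int_of_nat)
    have u1: "u ^ (2 * j) = t ^ j" by (simp add: t_eq power_mult)
    have t1: "t ^ j * (q / t) ^ j = q ^ j" using t_nonzero by (simp add: power_divide)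
    have "F (m + 2 * int j, j) = r powi (m\<^sup>2) * (q ^ (j\<^sup>2) * (q powi m) ^ j) *
      ((X powi m * X ^ (2 * j)) * (L powi m * L ^ (2 * j)) * (u powi m * t ^ j)) * ((q / t) ^ j * X powi (- 2 * int j) * hyp_prod q t L j)"
      unfolding F_def a_def hyp_term_def prod.case r1 power_int_mult_distrib pw[OF X(1)] pw[OF L(1)] pw[OF u_nonzero] u1 ..
    also have "\<dots> = r powi (m\<^sup>2) * (q ^ (j\<^sup>2) * (q powi m) ^ j) * (X powi m * L powi m * L ^ (2 * j) * u powi m) *
       (X powi (- 2 * int j) * X ^ (2 * j)) * (t ^ j * (q / t) ^ j) * hyp_prod q t L j"
      by (simp only: mult_ac)
    also have "\<dots> = X powi m * r powi (m\<^sup>2) * u powi m * L powi m * (q ^ (j\<^sup>2 + j) * L ^ (2 * j) * hyp_prod q t L j * (q powi m) ^ j)"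
      unfolding x1 t1 power_add by (simp only: mult_1_left mult_1_right mult_ac)
    finally show ?thesis .
  qed
  show ?thesis
  proof (rule has_sum_SigmaD[OF 1])
    fix m
    have "(\<lambda>(m, j). F (m + 2 * int j, j)) summable_on (UNIV \<times> UNIV)" using 1 by (auto simp: summable_on_def)
    then have s: "(\<lambda>j. F (m + 2 * int j, j)) summable_on UNIV"
      using summable_on_SigmaD1[of "\<lambda>m j. F (m + 2 * int j, j)" UNIV "\<lambda>_. UNIV" m] by auto
    then have "((\<lambda>j. F (m + 2 * int j, j)) has_sum infsum (\<lambda>j. F (m + 2 * int j, j)) UNIV) UNIV" by simp
    moreover have "infsum (\<lambda>j. F (m + 2 * int j, j)) UNIV = X powi m * r powi (m\<^sup>2) * u powi m * hyp_sol L m"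
    proof -
      have "(\<lambda>j. F (m + 2 * int j, j)) sums infsum (\<lambda>j. F (m + 2 * int j, j)) UNIV"
        using s by (intro has_sum_imp_sums) simp
      then have "infsum (\<lambda>j. F (m + 2 * int j, j)) UNIV = suminf (\<lambda>j. F (m + 2 * int j, j))" by (simp add: sums_iff)
      also have "\<dots> = suminf (\<lambda>j. X powi m * r powi (m\<^sup>2) * u powi m * L powi m * (q ^ (j\<^sup>2 + j) * L ^ (2 * j) * hyp_prod q t L j * (q powi m) ^ j))"
        by (simp only: F)
      also have "\<dots> = X powi m * r powi (m\<^sup>2) * u powi m * L powi m * suminf (\<lambda>j. q ^ (j\<^sup>2 + j) * L ^ (2 * j) * hyp_prod q t L j * (q powi m) ^ j)"
      proof (rule suminf_mult)
        have "summable (\<lambda>j. F (m + 2 * int j, j))" using s by (rule summable_on_imp_summable)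
        then show "summable (\<lambda>j. q ^ (j\<^sup>2 + j) * L ^ (2 * j) * hyp_prod q t L j * (q powi m) ^ j)"
          unfolding F using X(1) L(1) r_nonzero u_nonzero by (simp only: summable_cmult_iff mult_eq_0_iff power_int_eq_0_iff simp_thms)
      qed
      finally show ?thesis by (simp add: hyp_sol_def mult_ac)
    qed
    ultimately show "((\<lambda>j. (\<lambda>(m, j). F (m + 2 * int j, j)) (m, j)) has_sum (X powi m * r powi (m\<^sup>2) * u powi m * hyp_sol L m)) UNIV"
      by simp
  qed
qed

lemma inverse_sq_neq:
  assumes "L \<noteq> 0" "\<And>k :: int. L\<^sup>2 \<noteq> q powi k"
  shows "(inverse L)\<^sup>2 \<noteq> q powi k"
proof
  assume "(inverse L)\<^sup>2 = q powi k"
  then have "L\<^sup>2 = q powi (- k)" by (metis power_int_minus power_inverse inverse_inverse_eq)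
  then show False using assms(2) by blast
qed

lemma Phi_formula:
  assumes X: "X \<noteq> 0" "norm (q / t * X powi (- 2)) < 1" and L: "L \<noteq> 0" "\<And>k :: int. L\<^sup>2 \<noteq> q powi k"
  shows "Phi r u X L = mu_ct q t / (1 + t) * (sigma_fn q t (inverse L) * theta r (X * L * u) * suminf (hyp_term X L) +
     sigma_fn q t L * theta r (X * inverse L * u) * suminf (hyp_term X (inverse L)))"
proof -
  note Li = inverse_sq_neq[OF L]
  let ?s1 = "sigma_fn q t (inverse L)" and ?s2 = "sigma_fn q t L"
  have k: "connection_const / (1 - t) = mu_ct q t / (1 + t)"
  proof -
    have "(1 - t) * ((1 + t) * connection_const) = (1 - t) * ((1 - t) * mu_ct q t)"
      using connection_const_eq unfolding one_minus_t2(1) by (simp add: power2_eq_square mult_ac)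
    then have "(1 + t) * connection_const = (1 - t) * mu_ct q t" using one_minus_t2(3) by simp
    then show ?thesis using one_minus_t2(3) t_neq_minus_1 by (simp add: frac_eq_eq mult_ac)
  qed
  have "((\<lambda>m. connection_const / (1 - t) * (?s1 * (X powi m * r powi (m\<^sup>2) * u powi m * hyp_sol L m) +
      ?s2 * (X powi m * r powi (m\<^sup>2) * u powi m * hyp_sol (inverse L) m))) has_sum
    (connection_const / (1 - t) * (?s1 * (theta r (X * L * u) * suminf (hyp_term X L)) + ?s2 * (theta r (X * inverse L * u) * suminf (hyp_term X (inverse L)))))) UNIV"
    by (intro has_sum_cmult_right has_sum_add theta_hyp_sol_has_sum X L Li) (use L in auto)
  then have h: "((\<lambda>m. X powi m * r powi (m\<^sup>2) * u powi m * Phi_coeff L m / (1 - t)) has_sum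
    (connection_const / (1 - t) * (?s1 * (theta r (X * L * u) * suminf (hyp_term X L)) + ?s2 * (theta r (X * inverse L * u) * suminf (hyp_term X (inverse L)))))) UNIV"
  proof (rule has_sum_cong[THEN iffD1, rotated])
    fix m show "connection_const / (1 - t) * (?s1 * (X powi m * r powi (m\<^sup>2) * u powi m * hyp_sol L m) +
      ?s2 * (X powi m * r powi (m\<^sup>2) * u powi m * hyp_sol (inverse L) m)) = X powi m * r powi (m\<^sup>2) * u powi m * Phi_coeff L m / (1 - t)"
    unfolding Phi_coeff_eq[OF L] by (simp add: algebra_simps add_divide_distrib)
  qed
  then have "Phi r u X L = connection_const / (1 - t) * (?s1 * (theta r (X * L * u) * suminf (hyp_term X L)) + ?s2 * (theta r (X * inverse L * u) * suminf (hyp_term X (inverse L))))"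
    unfolding Phi_eq_Phi_coeff[OF X(1) L(1)] by (rule infsumI)
  then show ?thesis unfolding k by (simp add: mult.assoc)
qed

end

subsection \<open>The nonsymmetric function\<close>

lemma has_sum_shift_int:
  fixes f :: "int \<Rightarrow> complex"
  assumes "f summable_on UNIV"
  shows "((\<lambda>i. f (i + a)) has_sum infsum f UNIV) UNIV"
  using summable_on_shift_int[of f a] infsum_shift_int[of f a] assms by (metis has_sum_infsum)

context main_params
begin

text \<open>The counterpart of \<open>Rn\<close> for the nonsymmetric polynomials: the squared
  normalization 1 / p n divided by the norm, which is (q; q)_n / (t^2 q; q)_n.\<close>

definition rho :: "int \<Rightarrow> complex" where
  "rho n = (if n < 0 then 0 else 1 / wq q (t\<^sup>2 * q) n)"

text \<open>From (t^2; q)_(n+1) = (1 - t^2) (t^2 q; q)_n. The factor 1 - t^2 is the source of the 1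
  + t between \<Psi> and \<Phi>.\<close>

lemma rho_Rn:
  assumes "n \<ge> 0"
  shows "rho n * (1 - q powi (n + 1)) = (1 - t\<^sup>2) * Rn (n + 1)" "rho n * (1 - t\<^sup>2 * q powi n) = (1 - t\<^sup>2) * Rn n"
proof -
  obtain k where k: "n = int k" using assms by (metis nonneg_int_cases)
  have n1: "n + 1 = int (Suc k)" using k by simp
  have nz: "qpoch q (t\<^sup>2 * q) k \<noteq> 0" "qpoch q q k \<noteq> 0" "qpoch q q (Suc k) \<noteq> 0" by (rule t2q_nonzero qq_nonzero)+
  have q1: "qpoch q q (Suc k) = qpoch q q k * (1 - q powi (n + 1))"
    unfolding n1 power_int_of_nat by (simp add: qpoch_Suc)
  have rk: "rho n = qpoch q q k / qpoch q (t\<^sup>2 * q) k" by (simp add: rho_def k wq_of_nat)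
  have "Rn (n + 1) = qpoch q q (Suc k) / ((1 - t\<^sup>2) * qpoch q (t\<^sup>2 * q) k)" unfolding n1 by (rule Rn_of_nat_Suc)
  then show 1: "rho n * (1 - q powi (n + 1)) = (1 - t\<^sup>2) * Rn (n + 1)"
    unfolding rk q1 using one_minus_t2(2) by simp
  have "1 - q powi (n + 1) \<noteq> 0" using q1 nz by auto
  moreover have "rho n * (1 - t\<^sup>2 * q powi n) * (1 - q powi (n + 1)) = (1 - t\<^sup>2) * Rn n * (1 - q powi (n + 1))"
    using 1 Rn_rec[OF assms] by algebra
  ultimately show "rho n * (1 - t\<^sup>2 * q powi n) = (1 - t\<^sup>2) * Rn n" by simp
qed

lemma geom_rho: "geom rho"
proof -
  obtain M where M: "M > 0" "\<And>n. norm (Rn n) \<le> M" using Rn_bounded by blast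
  show ?thesis
  proof (rule geom_bounded)
    fix n
    show "norm (rho n) \<le> norm (1 - t\<^sup>2) * M / (1 - norm q)"
    proof (cases "n < 0")
      case True
      then show ?thesis using M q_norm by (simp add: rho_def)
    next
      case False
      have "norm (q powi (n + 1)) \<le> norm q"
        using False q_norm power_decreasing[of 1 "nat (n + 1)" "norm q"] by (simp add: power_int_def norm_power)
      then have 1: "1 - norm q \<le> norm (1 - q powi (n + 1))" using norm_triangle_ineq2[of 1 "q powi (n + 1)"] by simp
      have "norm (rho n) * (1 - norm q) \<le> norm (rho n) * norm (1 - q powi (n + 1))" by (rule mult_left_mono[OF 1]) simp
      also have "\<dots> = norm (1 - t\<^sup>2) * norm (Rn (n + 1))" using rho_Rn(1)[of n] False by (metis norm_mult not_less)
      also have "\<dots> \<le> norm (1 - t\<^sup>2) * M" by (intro mult_left_mono M) simp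
      finally show ?thesis using q_norm by (simp add: pos_le_divide_eq)
    qed
  qed
qed

lemma p_norm_rho: "n \<ge> 0 \<Longrightarrow> 1 / p n * (1 / p n) / nrm n = rho n"
proof -
  assume "n \<ge> 0"
  then obtain k where "n = int k" by (metis nonneg_int_cases)
  then show ?thesis
    using tqq_nonzero[of k] qq_nonzero[of k] t2q_nonzero[of k]
    by (simp add: rho_def nrm_def wq_of_nat power2_eq_square)
qed

text \<open>The half of \<Psi> with indices -n for n \<ge> 0, the conjugate already rewritten as a
  shifted E_(n+1). Through \<open>rho\<close> it vanishes for n < 0, so each half of \<Psi> becomes
  a sum over all integers.\<close>

definition Psi_neg_summand :: "complex \<Rightarrow> complex \<Rightarrow> int \<Rightarrow> complex" where
  "Psi_neg_summand X L n = r powi (n\<^sup>2) * (u powi n * rho n * a_val n X * (inverse L * b_val (n + 1) L))"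

definition Psi_pos_summand :: "complex \<Rightarrow> complex \<Rightarrow> int \<Rightarrow> complex" where
  "Psi_pos_summand X L n = r powi (n\<^sup>2) * (u powi n * rho (n - 1) * b_val n X * (inverse L * a_val (n - 1) L))"

lemma Psi_neg_summand_summable: "Psi_neg_summand X L summable_on UNIV"
  unfolding Psi_neg_summand_def by (intro geom_gauss_summable r_norm geom_mult geom_powi geom_rho geom_const geom_a_val geom_shift[OF geom_b_val])

lemma Psi_pos_summand_summable: "Psi_pos_summand X L summable_on UNIV"
  unfolding Psi_pos_summand_def
  by (intro geom_gauss_summable r_norm geom_mult geom_powi geom_shift_diff[OF geom_rho] geom_const geom_b_val geom_shift_diff[OF geom_a_val])

lemma Psi_term_neg:
  assumes "n \<ge> 0" "L \<noteq> 0"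
  shows "Psi_term r u X L (- n) = Psi_neg_summand X L n"
proof -
  have "a * (1 / x * b * (c * (1 / x * d)) / N) = a * (1 / x * (1 / x) / N) * b * (c * d)" for a b c d x N :: complex
    by simp
  from this[where x = "p n" and N = "nrm n", unfolded p_norm_rho[OF assms(1)]]
  show ?thesis using assms
    by (simp add: Psi_term_def Psi_neg_summand_def E_norm_eq E_star_neg E_poly_neg E_poly_pos leval_lmono_mult leval_lscale leval_a_poly leval_b_poly power_int_minus mult_ac)
qed

lemma Psi_term_pos:
  assumes "n > 0" "L \<noteq> 0"
  shows "Psi_term r u X L n = Psi_pos_summand X L n"
proof -
  have n: "n - 1 \<ge> 0" using assms by simp
  have "a * (1 / x * b * (c * (1 / x * d)) / N) = a * (1 / x * (1 / x) / N) * b * (c * d)" for a b c d x N :: complex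
    by simp
  from this[where x = "p (n - 1)" and N = "nrm (n - 1)", unfolded p_norm_rho[OF n]]
  show ?thesis using assms n E_norm_eq(2)[OF n] E_star_pos[OF n] E_poly_neg[OF n]
    by (simp add: Psi_term_def Psi_pos_summand_def E_poly_pos leval_lmono_mult leval_lscale leval_a_poly leval_b_poly power_int_minus mult_ac)
qed

lemma Psi_has_sum:
  assumes L: "L \<noteq> 0"
  shows "(Psi_term r u X L has_sum (infsum (Psi_neg_summand X L) UNIV + infsum (Psi_pos_summand X L) UNIV)) UNIV"
proof -
  have "(Psi_neg_summand X L has_sum infsum (Psi_neg_summand X L) UNIV) UNIV" using Psi_neg_summand_summable by simp
  then have "(Psi_neg_summand X L has_sum infsum (Psi_neg_summand X L) UNIV) {0..}"
    by (rule has_sum_cong_neutral[THEN iffD1, rotated -1]) (auto simp: Psi_neg_summand_def rho_def)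
  then have 1: "(Psi_term r u X L has_sum infsum (Psi_neg_summand X L) UNIV) {..0}"
    by (rule has_sum_reindex_bij_witness[of _ uminus uminus, THEN iffD1, rotated -1]) (auto simp: Psi_term_neg[OF _ L])
  have "(Psi_pos_summand X L has_sum infsum (Psi_pos_summand X L) UNIV) UNIV" using Psi_pos_summand_summable by simp
  then have "(Psi_term r u X L has_sum infsum (Psi_pos_summand X L) UNIV) {1..}"
    by (rule has_sum_cong_neutral[THEN iffD1, rotated -1]) (auto simp: Psi_pos_summand_def rho_def Psi_term_pos[OF _ L])
  from has_sum_Un_disjoint[OF 1 this] show ?thesis
    by (simp add: disjoint_iff) (metis UNIV_I Un_iff atLeast_iff atMost_iff linorder_le_cases not_less set_eqI zless_imp_add1_zle add_0)
qed

text \<open>The Pieri rule with the weight \<open>Rn\<close> included: the recurrence of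
  \<open>Rn\<close> exchanges the coefficients 1 - q^(n+1) and 1 - t^2 q^n.\<close>

lemma Rn_rogers_rec:
  assumes L: "L \<noteq> 0" and n: "n \<ge> 0"
  shows "(1 - t * q powi n) * (L + inverse L) * (Rn n * rogers n L) =
    (1 - t\<^sup>2 * q powi n) * (Rn (n + 1) * rogers (n + 1) L) + (1 - q powi n) * (Rn (n - 1) * rogers (n - 1) L)"
proof -
  have "rogers (n - 1) L * (Rn n * (1 - t\<^sup>2 * q powi (n - 1))) = rogers (n - 1) L * (Rn (n - 1) * (1 - q powi n))"
    using Rn_rogers[of "n - 1" L] by simp
  then show ?thesis using rogers_pieri[OF L, of n] Rn_rec[OF n] by algebra
qed

text \<open>Both sides are sums over shifts of the same three families; the identity holds level by level.\<close>

lemma Psi_eq_Phi: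
  assumes X: "X \<noteq> 0" and L: "L \<noteq> 0"
  shows "(1 - t * inverse L ^ 2) * Psi r u X L = (1 + t) * (Phi r u X L - r * u * inverse X * inverse L * Phi r u (X / r\<^sup>2) L)"
proof -
  define D where "D n = Rn n * rogers n L" for n
  define l where "l = inverse L"
  define G where "G n = r powi (n\<^sup>2) * u powi n" for n :: int
  have gD: "geom D" unfolding D_def by (intro geom_mult geom_Rn geom_rogers)
  \<comment> \<open>v1 and v2 are the halves of \<Psi> after symmetrization in L. w0 belongs to
    \<Phi>(X, L), while w1 and w2 belong to \<Phi>(q^(-1/2) X, L), with n shifted by one in opposite
    directions.\<close>
  define v1 where "v1 n = r powi (n\<^sup>2) * (u powi n * (l * a_val n X * (D (n + 1) - l * D n)))" for n
  define v2 where "v2 n = r powi (n\<^sup>2) * (u powi n * (l * b_val n X * (D (n - 1) - t * l * D n)))" for n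
  define w0 where "w0 n = r powi (n\<^sup>2) * (u powi n * (D n * (a_val n X + t * b_val n X)))" for n
  define w1 where "w1 n = r powi (n\<^sup>2) * (u powi n * (- l * D (n - 1) * (inverse X * a_val (n - 1) X)))" for n
  define w2 where "w2 n = r powi (n\<^sup>2) * (u powi n * (- l * t * D (n + 1) * (inverse X * b_val (n + 1) X)))" for n
  note gs = geom_gauss_summable[OF r_norm]
  have s: "v1 summable_on UNIV" "v2 summable_on UNIV" "w0 summable_on UNIV" "w1 summable_on UNIV" "w2 summable_on UNIV"
    unfolding v1_def v2_def w0_def w1_def w2_def
    by (intro gs geom_mult geom_add geom_diff geom_powi geom_const geom_a_val geom_b_val gD geom_shift[OF gD] geom_shift_diff[OF gD]
        geom_shift_diff[OF geom_a_val] geom_shift[OF geom_b_val])+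
  have h: "(f has_sum infsum f UNIV) UNIV" if "f summable_on UNIV" for f :: "int \<Rightarrow> complex" using that by simp
  \<comment> \<open>Times 1 - t q^n, all dependence on X reduces to \<open>a_val n X\<close> and
    \<open>b_val n X\<close>; the relation left between D at n - 1, n and n + 1 is the weighted
    Pieri rule.\<close>
  have level: "v1 n + v2 n = w0 n + w1 n + w2 n" for n
  proof (cases "n \<ge> 0")
    case True
    have 1: "(1 - t * q powi n) * (inverse X * a_val (n - 1) X) = (1 - q powi n) * a_val n X - (1 - t) * b_val n X" by (rule a_val_shift[OF X])
    have 2: "(1 - t * q powi n) * (inverse X * b_val (n + 1) X) = (1 - t) * q powi n * a_val n X + (1 - t\<^sup>2 * q powi n) * b_val n X" by (rule b_val_shift[OF X])
    have 3: "(1 - t * q powi n) * (L + l) * D n = (1 - t\<^sup>2 * q powi n) * D (n + 1) + (1 - q powi n) * D (n - 1)"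
      unfolding D_def l_def by (rule Rn_rogers_rec[OF L True])
    have "L * l = 1" using L by (simp add: l_def)
    then have 4: "(1 - t * q powi n) * (1 + l * l) * D n = l * ((1 - t\<^sup>2 * q powi n) * D (n + 1) + (1 - q powi n) * D (n - 1))"
      using 3 by algebra
    have nz: "1 - t * q powi n \<noteq> 0" using tq_powi[of n] t_neq_1 True by (cases "n = 0") auto
    have "(1 - t * q powi n) * (l * a_val n X * (D (n + 1) - l * D n) + l * b_val n X * (D (n - 1) - t * l * D n)) =
      (1 - t * q powi n) * (D n * (a_val n X + t * b_val n X)) - l * D (n - 1) * ((1 - t * q powi n) * (inverse X * a_val (n - 1) X))
       - l * t * D (n + 1) * ((1 - t * q powi n) * (inverse X * b_val (n + 1) X))"
      unfolding 1 2 using 4 by algebra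
    then have "(1 - t * q powi n) * (l * a_val n X * (D (n + 1) - l * D n) + l * b_val n X * (D (n - 1) - t * l * D n)) =
      (1 - t * q powi n) * (D n * (a_val n X + t * b_val n X) + - l * D (n - 1) * (inverse X * a_val (n - 1) X) + - l * t * D (n + 1) * (inverse X * b_val (n + 1) X))"
      by algebra
    then have "l * a_val n X * (D (n + 1) - l * D n) + l * b_val n X * (D (n - 1) - t * l * D n) =
      D n * (a_val n X + t * b_val n X) + - l * D (n - 1) * (inverse X * a_val (n - 1) X) + - l * t * D (n + 1) * (inverse X * b_val (n + 1) X)"
      using nz by (simp only: mult_cancel_left simp_thms)
    then show ?thesis unfolding v1_def v2_def w0_def w1_def w2_def distrib_left[symmetric] by simp
  next
    case False
    \<comment> \<open>At n = -1 the bracket of \<open>b_val\<close> is not empty, but its only term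
      carries 1 - q^0.\<close>
    have "b_val (n + 1) X = 0" using False by (cases "n = - 1") (auto simp: b_val_def bracket_def)
    moreover have "a_val n X = 0" "b_val n X = 0" "a_val (n - 1) X = 0" using False by (simp_all add: a_val_def b_val_def bracket_def)
    ultimately show ?thesis by (simp add: v1_def v2_def w0_def w1_def w2_def)
  qed
  have eq: "infsum v1 UNIV + infsum v2 UNIV = infsum w0 UNIV + infsum w1 UNIV + infsum w2 UNIV"
  proof (rule has_sum_unique)
    show "((\<lambda>n. v1 n + v2 n) has_sum (infsum v1 UNIV + infsum v2 UNIV)) UNIV"
      by (intro has_sum_add h s)
    show "((\<lambda>n. v1 n + v2 n) has_sum (infsum w0 UNIV + infsum w1 UNIV + infsum w2 UNIV)) UNIV"
      unfolding level by (intro has_sum_add h s)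
  qed
  have l2: "inverse L ^ 2 = l * l" by (simp add: l_def power2_eq_square)
  have vA: "(1 - t * inverse L ^ 2) * Psi_neg_summand X L n = (1 + t) * v1 n" for n
  proof (cases "n \<ge> 0")
    case True
    have "(1 - t) * ((1 - t * inverse L ^ 2) * (rho n * b_val (n + 1) L)) = rho n * ((1 - t) * (1 - t * inverse L ^ 2) * b_val (n + 1) L)"
      by algebra
    also have "\<dots> = (rho n * (1 - q powi (n + 1))) * rogers (n + 1) L - (rho n * (1 - t\<^sup>2 * q powi n)) * (l * rogers n L)"
      unfolding b_val_symmetrize[OF L] l_def by algebra
    also have "\<dots> = (1 - t) * ((1 + t) * (D (n + 1) - l * D n))"
      unfolding rho_Rn[OF True] one_minus_t2(1) D_def by algebra
    finally have "(1 - t * inverse L ^ 2) * (rho n * b_val (n + 1) L) = (1 + t) * (D (n + 1) - l * D n)"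
      by (rule cancel_1_minus_t)
    then show ?thesis unfolding Psi_neg_summand_def v1_def l_def[symmetric] by algebra
  next
    case False
    then show ?thesis by (simp add: Psi_neg_summand_def v1_def a_val_def bracket_def)
  qed
  have vB: "(1 - t * inverse L ^ 2) * Psi_pos_summand X L n = (1 + t) * v2 n" for n
  proof (cases "n > 0")
    case True
    then have n: "n - 1 \<ge> 0" by simp
    have "(1 - t) * ((1 - t * inverse L ^ 2) * (rho (n - 1) * a_val (n - 1) L)) = rho (n - 1) * ((1 - t) * (1 - t * inverse L ^ 2) * a_val (n - 1) L)"
      by algebra
    also have "\<dots> = (rho (n - 1) * (1 - t\<^sup>2 * q powi (n - 1))) * rogers (n - 1) L - t * (rho (n - 1) * (1 - q powi (n - 1 + 1))) * (l * rogers (n - 1 + 1) L)"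
      unfolding a_val_symmetrize[OF L] l_def by algebra
    also have "\<dots> = (1 - t) * ((1 + t) * (D (n - 1) - t * l * D n))"
      unfolding rho_Rn[OF n] one_minus_t2(1) D_def by (simp only: diff_add_cancel) algebra
    finally have "(1 - t * inverse L ^ 2) * (rho (n - 1) * a_val (n - 1) L) = (1 + t) * (D (n - 1) - t * l * D n)"
      by (rule cancel_1_minus_t)
    then show ?thesis unfolding Psi_pos_summand_def v2_def l_def[symmetric] by algebra
  next
    case False
    then have "b_val n X = 0" by (cases "n = 0") (auto simp: b_val_def bracket_def)
    then show ?thesis by (simp add: Psi_pos_summand_def v2_def)
  qed
  have "(1 - t * inverse L ^ 2) * infsum (Psi_neg_summand X L) UNIV = (1 + t) * infsum v1 UNIV"
  proof -
    have "(1 - t * inverse L ^ 2) * infsum (Psi_neg_summand X L) UNIV = infsum (\<lambda>n. (1 - t * inverse L ^ 2) * Psi_neg_summand X L n) UNIV"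
      by (rule infsum_cmult_right'[symmetric])
    then show ?thesis unfolding vA by (simp only: infsum_cmult_right')
  qed
  moreover have "(1 - t * inverse L ^ 2) * infsum (Psi_pos_summand X L) UNIV = (1 + t) * infsum v2 UNIV"
  proof -
    have "(1 - t * inverse L ^ 2) * infsum (Psi_pos_summand X L) UNIV = infsum (\<lambda>n. (1 - t * inverse L ^ 2) * Psi_pos_summand X L n) UNIV"
      by (rule infsum_cmult_right'[symmetric])
    then show ?thesis unfolding vB by (simp only: infsum_cmult_right')
  qed
  moreover have "Psi r u X L = infsum (Psi_neg_summand X L) UNIV + infsum (Psi_pos_summand X L) UNIV"
    unfolding Psi_def by (rule infsumI[OF Psi_has_sum[OF L]])
  ultimately have Psi: "(1 - t * inverse L ^ 2) * Psi r u X L = (1 + t) * (infsum v1 UNIV + infsum v2 UNIV)"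
    by (simp only: distrib_left)
  have pt: "Phi_summand Z L n = G n * D n * ((1 - t * q powi n) * rogers n Z) / (1 - t)" for Z n
    by (simp add: Phi_summand_def G_def D_def)
  have W: "Phi_summand X L n + - (r * u * inverse X * inverse L) * Phi_summand (X / r\<^sup>2) L n = w0 n + w1 (n + 1) + w2 (n + - 1)" for n
  proof -
    \<comment> \<open>The factors q^(n/2) and q^(-n/2) of the half shift complete the square to (n +
      1)^2 and (n - 1)^2; the prefactor r u of the relation supplies the missing powers.\<close>
    have g1: "r * u * (G n * r powi (2 * n)) = G (n + 1)"
    proof -
      have "r powi ((n + 1)\<^sup>2) = r powi (n\<^sup>2) * r powi (2 * n) * r"
        using r_nonzero power_int_add[of r "n\<^sup>2" "2 * n"] power_int_add[of r "n\<^sup>2 + (2 * n)" 1]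
        by (simp add: power2_eq_square algebra_simps)
      moreover have "u powi (n + 1) = u powi n * u" using u_nonzero by (simp add: power_int_add)
      ultimately show ?thesis by (simp add: G_def)
    qed
    have g2: "r * u * (G n * r powi (- 2 * n)) = t * G (n + - 1)"
    proof -
      have "r powi ((n + - 1)\<^sup>2) = r powi (n\<^sup>2) * r powi (- 2 * n) * r"
        using r_nonzero power_int_add[of r "n\<^sup>2" "- 2 * n"] power_int_add[of r "n\<^sup>2 + (- 2 * n)" 1]
        by (simp add: power2_eq_square algebra_simps)
      moreover have "u powi n = u powi (n + - 1) * u" using u_nonzero power_int_add[of u "n + - 1" 1] by simp
      ultimately show ?thesis by (simp add: G_def t_eq power2_eq_square)
    qed
    have p1: "Phi_summand X L n = w0 n"
      unfolding pt rogers_eq_a_val_b_val w0_def using one_minus_t2(3) by (simp add: G_def)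
    have "Phi_summand (X / r\<^sup>2) L n = G n * D n * (r powi (2 * n) * a_val n X + r powi (- 2 * n) * b_val n X)"
      unfolding pt rogers_half_shift[OF X] using one_minus_t2(3) by simp
    then have "- (r * u * inverse X * inverse L) * Phi_summand (X / r\<^sup>2) L n =
       - l * inverse X * D n * (r * u * (G n * r powi (2 * n)) * a_val n X + r * u * (G n * r powi (- 2 * n)) * b_val n X)"
      unfolding l_def by (simp only: distrib_left mult_minus_left mult_minus_right mult_ac)
    also have "\<dots> = w1 (n + 1) + w2 (n + - 1)"
      unfolding g1 g2 by (simp add: w1_def w2_def G_def algebra_simps)
    finally show ?thesis unfolding p1 by simp
  qed
  have "Phi r u X L + - (r * u * inverse X * inverse L) * Phi r u (X / r\<^sup>2) L = infsum w0 UNIV + infsum w1 UNIV + infsum w2 UNIV"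
  proof (rule has_sum_unique)
    show "((\<lambda>n. Phi_summand X L n + - (r * u * inverse X * inverse L) * Phi_summand (X / r\<^sup>2) L n) has_sum
       (Phi r u X L + - (r * u * inverse X * inverse L) * Phi r u (X / r\<^sup>2) L)) UNIV"
      unfolding Phi_eq_infsum by (intro has_sum_add has_sum_cmult_right h Phi_summand_summable)
    show "((\<lambda>n. Phi_summand X L n + - (r * u * inverse X * inverse L) * Phi_summand (X / r\<^sup>2) L n) has_sum
       (infsum w0 UNIV + infsum w1 UNIV + infsum w2 UNIV)) UNIV"
      unfolding W by (intro has_sum_add h s has_sum_shift_int)
  qed
  then show ?thesis unfolding Psi eq by simp
qed

lemma hyp_term_half_shift: "X \<noteq> 0 \<Longrightarrow> hyp_term (X / r\<^sup>2) L j = q ^ j * hyp_term X L j"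
proof -
  assume X: "X \<noteq> 0"
  have "(r\<^sup>2) powi (- 2 * int j) = inverse (q ^ j)"
  proof -
    have "- 2 * int j = - int (2 * j)" by simp
    moreover have "(r\<^sup>2) ^ (2 * j) = q ^ j" unfolding q_eq by (simp only: power_mult[symmetric]) simp
    ultimately show ?thesis by (simp only: power_int_minus power_int_of_nat)
  qed
  then have "(X / r\<^sup>2) powi (- 2 * int j) = X powi (- 2 * int j) * q ^ j"
    unfolding power_int_divide_distrib by (simp add: divide_inverse)
  then show ?thesis by (simp only: hyp_term_def mult_ac)
qed

text \<open>Quasi-periodicity returns \<Phi>(q^(-1/2) X, \<Lambda>) to the same two theta functions,
  with factors t and t \<Lambda>^-2, and puts q^j into the series. The differences 1 - t q^j and 1 -
  t \<Lambda>^-2 q^j, over 1 - t \<Lambda>^-2, are the extra factors in the two \<Xi>.\<close>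

lemma Psi_formula:
  assumes X: "X \<noteq> 0" "norm (q / t * X powi (- 2)) < 1" and L: "L \<noteq> 0" "\<And>k :: int. L\<^sup>2 \<noteq> q powi k" and Lt: "L\<^sup>2 \<noteq> t"
  shows "Psi r u X L = mu_ct q t * (sigma_fn q t (inverse L) * theta r (X * L * u) * Xi_minus q t X L +
             sigma_fn q t L * theta r (X * inverse L * u) * Xi_plus q t X (inverse L))"
proof -
  note Li = inverse_sq_neq[OF L]
  define c where "c = 1 - t * inverse L ^ 2"
  have c0: "c \<noteq> 0"
    using Lt L(1) by (auto simp: c_def field_simps)
  \<comment> \<open>The shifted argument q^(-1/2) X has larger modulus, so the condition for
    convergence is inherited.\<close>
  have X': "X / r\<^sup>2 \<noteq> 0" "norm (q / t * (X / r\<^sup>2) powi (- 2)) < 1"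
  proof -
    show "X / r\<^sup>2 \<noteq> 0" using X r_nonzero by simp
    have "(X / r\<^sup>2) powi (- 2) = q * X powi (- 2)"
      unfolding q_eq by (simp add: power_int_minus power_mult_distrib power_inverse divide_inverse flip: power_mult)
    then have "norm (q / t * (X / r\<^sup>2) powi (- 2)) = norm q * norm (q / t * X powi (- 2))" by (simp add: norm_mult norm_divide)
    also have "\<dots> \<le> 1 * norm (q / t * X powi (- 2))" using q_norm by (intro mult_right_mono) auto
    finally show "norm (q / t * (X / r\<^sup>2) powi (- 2)) < 1" using X(2) by simp
  qed
  have th1: "r * u * inverse X * inverse L * theta r (X / r\<^sup>2 * L * u) = t * theta r (X * L * u)"
  proof -
    have "theta r (X / r\<^sup>2 * L * u) = inverse r * (X * L * u) * theta r (X * L * u)"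
      using theta_quasi_periodic[OF r_norm r_nonzero, of "X * L * u"] X L u_nonzero by simp
    then have "r * u * inverse X * inverse L * theta r (X / r\<^sup>2 * L * u) =
        (r * inverse r) * (X * inverse X) * (L * inverse L) * u\<^sup>2 * theta r (X * L * u)"
      by (simp only: power2_eq_square mult_ac)
    then show ?thesis using X(1) L(1) r_nonzero by (simp add: t_eq)
  qed
  have th2: "r * u * inverse X * inverse L * theta r (X / r\<^sup>2 * inverse L * u) = t * inverse L ^ 2 * theta r (X * inverse L * u)"
  proof -
    have "theta r (X / r\<^sup>2 * inverse L * u) = inverse r * (X * inverse L * u) * theta r (X * inverse L * u)"
      using theta_quasi_periodic[OF r_norm r_nonzero, of "X * inverse L * u"] X L u_nonzero by simp
    then have "r * u * inverse X * inverse L * theta r (X / r\<^sup>2 * inverse L * u) =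
        (r * inverse r) * (X * inverse X) * u\<^sup>2 * inverse L ^ 2 * theta r (X * inverse L * u)"
      by (simp only: power2_eq_square mult_ac)
    then show ?thesis using X(1) r_nonzero by (simp add: t_eq)
  qed
  have sm: "summable (\<lambda>j. hyp_term X Z j)" "summable (\<lambda>j. q ^ j * hyp_term X Z j)" if Z: "\<And>k :: int. Z\<^sup>2 \<noteq> q powi k" for Z
    using summable_norm_cancel[OF hyp_term_abs_summable[OF X(2) Z]] summable_norm_cancel[OF hyp_term_abs_summable[OF X'(2) Z]]
    by (simp_all add: hyp_term_half_shift[OF X(1)])
  \<comment> \<open>Applied with b = t and with b = t \<Lambda>^-2. The term j = 0 is split off
    because the \<Xi> are written that way; in the second case it equals 1.\<close>
  have comb: "suminf (hyp_term X Z) - b * suminf (hyp_term (X / r\<^sup>2) Z) = c * ((1 - b) / c + suminf (\<lambda>i. (1 - b * q ^ Suc i) / c * hyp_term X Z (Suc i)))"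
    if Z: "\<And>k :: int. Z\<^sup>2 \<noteq> q powi k" for Z b
  proof -
    have s1: "(\<lambda>j. hyp_term X Z j - b * (q ^ j * hyp_term X Z j)) sums (suminf (hyp_term X Z) - b * suminf (hyp_term (X / r\<^sup>2) Z))"
      unfolding hyp_term_half_shift[OF X(1), abs_def] using sm[OF Z] by (intro sums_diff sums_mult summable_sums) auto
    have s2: "(\<lambda>j. (1 - b * q ^ j) / c * hyp_term X Z j) sums ((suminf (hyp_term X Z) - b * suminf (hyp_term (X / r\<^sup>2) Z)) / c)"
    proof -
      have "(hyp_term X Z j - b * (q ^ j * hyp_term X Z j)) / c = (1 - b * q ^ j) / c * hyp_term X Z j" for j by (simp add: algebra_simps)
      from sums_divide[OF s1, of c, unfolded this] show ?thesis .
    qed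
    have "suminf (\<lambda>i. (1 - b * q ^ Suc i) / c * hyp_term X Z (Suc i)) = (suminf (hyp_term X Z) - b * suminf (hyp_term (X / r\<^sup>2) Z)) / c - (1 - b * q ^ 0) / c * hyp_term X Z 0"
      using sums_Suc_iff[of "\<lambda>j. (1 - b * q ^ j) / c * hyp_term X Z j"] s2 by (intro sums_unique[symmetric]) (simp add: sums_Suc_iff)
    then show ?thesis using c0 by (simp add: hyp_term_def hyp_prod_def)
  qed
  have xm: "Xi_minus q t X L = (1 - t) / c + suminf (\<lambda>i. (1 - t * q ^ Suc i) / c * hyp_term X L (Suc i))"
  proof -
    have "L powi (- 2) = inverse L ^ 2" by (simp add: power_int_minus power_inverse)
    then show ?thesis by (simp only: Xi_minus_def Let_def hyp_term_def c_def mult.assoc)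
  qed
  have xp: "Xi_plus q t X (inverse L) = (1 - t * inverse L ^ 2) / c + suminf (\<lambda>i. (1 - t * inverse L ^ 2 * q ^ Suc i) / c * hyp_term X (inverse L) (Suc i))"
    unfolding Xi_plus_def c_def[symmetric] using c0 by (simp add: hyp_term_def Let_def mult_ac)
  have P1: "(1 + t) * Phi r u Z L = mu_ct q t * (sigma_fn q t (inverse L) * theta r (Z * L * u) * suminf (hyp_term Z L) +
     sigma_fn q t L * theta r (Z * inverse L * u) * suminf (hyp_term Z (inverse L)))"
    if "Z \<noteq> 0" "norm (q / t * Z powi (- 2)) < 1" for Z
    unfolding Phi_formula[OF that L] using t_neq_minus_1 by simp
  have "c * Psi r u X L = (1 + t) * Phi r u X L - r * u * inverse X * inverse L * ((1 + t) * Phi r u (X / r\<^sup>2) L)"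
    unfolding c_def Psi_eq_Phi[OF X(1) L(1)] by (simp only: right_diff_distrib mult_ac)
  also have "\<dots> = mu_ct q t * (sigma_fn q t (inverse L) * (theta r (X * L * u) * suminf (hyp_term X L) - (r * u * inverse X * inverse L * theta r (X / r\<^sup>2 * L * u)) * suminf (hyp_term (X / r\<^sup>2) L)) +
     sigma_fn q t L * (theta r (X * inverse L * u) * suminf (hyp_term X (inverse L)) - (r * u * inverse X * inverse L * theta r (X / r\<^sup>2 * inverse L * u)) * suminf (hyp_term (X / r\<^sup>2) (inverse L))))"
    unfolding P1[OF X] P1[OF X'] by algebra
  also have "\<dots> = mu_ct q t * (sigma_fn q t (inverse L) * theta r (X * L * u) * (suminf (hyp_term X L) - t * suminf (hyp_term (X / r\<^sup>2) L)) +
     sigma_fn q t L * theta r (X * inverse L * u) * (suminf (hyp_term X (inverse L)) - t * inverse L ^ 2 * suminf (hyp_term (X / r\<^sup>2) (inverse L))))"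
    unfolding th1 th2 by algebra
  also have "\<dots> = c * (mu_ct q t * (sigma_fn q t (inverse L) * theta r (X * L * u) * Xi_minus q t X L +
             sigma_fn q t L * theta r (X * inverse L * u) * Xi_plus q t X (inverse L)))"
    unfolding comb[OF L(2)] comb[OF Li] xm[symmetric] xp[symmetric] by algebra
  finally show ?thesis using c0 by simp
qed

end

subsection \<open>The case $t = 1$\<close>

text \<open>The term 0 is kept apart since \<Phi> has no factor 2 there: for t = 1 the norm of P_n
  is 1 at n = 0 and 2 otherwise.\<close>

lemma has_sum_int_fold:
  fixes f :: "int \<Rightarrow> complex"
  assumes "(f has_sum S) UNIV"
  shows "(\<lambda>n. if n = 0 then f 0 else f (int n) + f (- int n)) sums S"
proof -
  have s: "f summable_on A" for A by (rule summable_on_subset_banach[of f UNIV]) (use assms in \<open>auto simp: summable_on_def\<close>)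
  have p: "((\<lambda>n. f (int n)) has_sum infsum f {0..}) UNIV"
    using has_sum_infsum[OF s[of "{0..}"]] by (rule has_sum_reindex_bij_witness[of _ int nat, THEN iffD1, rotated -1]) auto
  have n: "((\<lambda>n. f (- int (Suc n))) has_sum infsum f {..<0}) UNIV"
    using has_sum_infsum[OF s[of "{..<0}"]]
    by (rule has_sum_reindex_bij_witness[of _ "\<lambda>n. - int (Suc n)" "\<lambda>i. nat (- i - 1)", THEN iffD1, rotated -1]) auto
  have "(f has_sum (infsum f {0..} + infsum f {..<0})) ({0..} \<union> {..<0})"
    by (intro has_sum_Un_disjoint has_sum_infsum s) auto
  moreover have "{0..} \<union> {..<0} = (UNIV :: int set)" by auto
  ultimately have "S = infsum f {0..} + infsum f {..<0}" using assms by (metis has_sum_unique)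
  moreover have "(\<lambda>n. if n = 0 then 0 else f (- int n)) sums infsum f {..<0}"
    using has_sum_imp_sums[OF n] sums_Suc_iff[of "\<lambda>n. if n = 0 then 0 else f (- int n)" "infsum f {..<0}"] by simp
  ultimately have "(\<lambda>n. f (int n) + (if n = 0 then 0 else f (- int n))) sums S"
    using sums_add[OF has_sum_imp_sums[OF p]] by simp
  then show ?thesis by (rule sums_cong[THEN iffD1, rotated]) simp
qed

text \<open>For j > 0 the factor with s = 1 contains 1 - t = 0, so the hypergeometric series shrink
  to their first term.\<close>

lemma hyp_prod_1: "hyp_prod q 1 L j = (if j = 0 then 1 else 0)"
proof (cases "j = 0")
  case False
  then show ?thesis unfolding hyp_prod_def by (subst prod.remove[of _ 1]) auto
qed (simp add: hyp_prod_def)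

lemma suminf_hyp_1: "suminf (\<lambda>j. f j * hyp_prod q 1 L j) = f 0"
  by (subst suminf_finite[of "{0}"]) (auto simp: hyp_prod_1)

lemma Xi_minus_1: "Xi_minus q 1 X L = 0"
  by (simp add: Xi_minus_def hyp_prod_1 Let_def)

lemma Xi_plus_1: "Xi_plus q 1 X L = 1"
  by (simp add: Xi_plus_def hyp_prod_1 Let_def)

lemma sigma_fn_1: "(\<And>j. q ^ j * L\<^sup>2 \<noteq> 1) \<Longrightarrow> sigma_fn q 1 L = 1"
  by (simp add: sigma_fn_def)

locale trivial_params = generic_params +
  assumes r_norm: "norm r < 1" and t_1: "t = 1"
begin

text \<open>At t = 1 the relation between p and w reads 0 = (1 - q^i) w i.\<close>

lemma w_1: "w i = (if i = 0 then 1 else 0)"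
  using wq_shift[of 1 q i] q_powi_eq_1_iff[of i] by (auto simp: t_1)

lemma p_1: "p i = (if i \<ge> 0 then 1 else 0)"
proof (cases "i \<ge> 0")
  case True
  then show ?thesis using qq_nonzero[of "nat i"] wq_of_nat[of q "t * q" "nat i"] by (simp add: t_1)
qed simp

lemma nrm_1: "nrm n = 1"
  using qq_nonzero[of "nat n"] unfolding nrm_def unfolding t_1 by (simp add: power2_eq_square)

lemma mu_ct_1: "mu_ct q t = 1"
proof -
  have "1 - q ^ Suc j \<noteq> 0" for j using q_power[of "Suc j"] by auto
  then show ?thesis unfolding mu_ct_def t_1 by (simp add: power2_eq_square)
qed

lemma leval_a_poly_1: "n \<ge> 0 \<Longrightarrow> leval (a_poly n) z = z powi (- n)"
  unfolding a_poly_def leval_lpb w_1 p_1 by (subst sum.remove[of _ 0]) auto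

lemma leval_b_poly_1: "n > 0 \<Longrightarrow> leval (b_poly n) z = z powi n"
  unfolding b_poly_def leval_lpb w_1 p_1 by (subst sum.remove[of _ n]) auto

lemma u_sq: "u * u = 1" using t_eq t_1 by (simp add: power2_eq_square)

text \<open>As u is its own inverse, the weight u^|n| in \<Psi> may be replaced by u^n, as in the
  theta series.\<close>

lemma u_powi_minus: "u powi (- n) = u powi n"
proof -
  have "inverse u = u" using u_sq by (rule inverse_unique)
  then show ?thesis by (metis power_int_inverse power_int_minus)
qed

lemma leval_P_poly_1: "leval (P_poly r u n) z = (if n = 0 then 1 else z powi int n + z powi (- int n))"
proof (cases "n = 0")
  case True
  have "leval 1 z = 1" using leval_lpb[of 0 "\<lambda>i. 1" z] by (simp add: lpb_def)
  then show ?thesis using True by (simp add: P_poly_0)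
next
  case False
  then have n: "n > 0" "int n \<ge> 0" "int n > 0" by simp_all
  show ?thesis
    unfolding P_poly_eq[OF n(1)] c_lpb leval_lscale leval_add leval_a_poly_1[OF n(2)] leval_b_poly_1[OF n(3)] p_1 unfolding t_1
    using n(1) by simp
qed

lemma P_norm_1: "P_norm r u n = (if n = 0 then 1 else 2)"
proof (cases n)
  case (Suc k)
  then show ?thesis using P_norm_eq[of k] qq_nonzero[of k] qq_nonzero[of "Suc k"] by (simp add: t_1)
qed (simp add: P_norm_0)

lemma Psi_term_1:
  assumes L: "L \<noteq> 0"
  shows "Psi_term r u X L n = r powi (n\<^sup>2) * (X * inverse L * u) powi n"
proof -
  have *: "(X * inverse L * u) powi n = X powi n * L powi (- n) * u powi n"
    by (simp add: power_int_mult_distrib power_int_inverse power_int_minus)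
  show ?thesis
  proof (cases "n > 0")
    case True
    then have n: "n - 1 \<ge> 0" by simp
    have "L powi (- 1) * L powi (- (n - 1)) = L powi (- n)" using power_int_add[of L "- 1" "- (n - 1)"] L by simp
    then show ?thesis unfolding *
      using True n E_norm_eq(2)[OF n] E_star_pos[OF n] E_poly_neg[OF n] L
      by (simp add: Psi_term_def E_poly_pos leval_lmono_mult leval_lscale leval_a_poly_1 leval_b_poly_1 p_1 nrm_1 del: minus_diff_eq)
  next
    case False
    define m where "m = - n"
    have m: "m \<ge> 0" "n = - m" using False by (simp_all add: m_def)
    have "L powi (- 1) * L powi (m + 1) = L powi m" using power_int_add[of L "- 1" "m + 1"] L by simp
    then show ?thesis unfolding * unfolding m(2)
      using m(1) L E_norm_eq(1)[OF m(1)] E_star_neg[OF m(1)] E_poly_neg[OF m(1)] u_powi_minus[of m]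
      by (simp add: Psi_term_def E_poly_pos leval_lmono_mult leval_lscale leval_a_poly_1 leval_b_poly_1 p_1 nrm_1)
  qed
qed

lemma Psi_has_sum_1: "L \<noteq> 0 \<Longrightarrow> (Psi_term r u X L has_sum theta r (X * inverse L * u)) UNIV"
  using theta_has_sum[OF r_norm, of "X * inverse L * u"] Psi_term_1[of L X] by (subst has_sum_cong) auto

text \<open>Pairing n with -n in the half sum of the two theta series produces (X^n + X^-n) (L^n +
  L^-n) / 2, the product of two P_n divided by the norm 2.\<close>

lemma Phi_sums_1:
  assumes L: "L \<noteq> 0"
  shows "Phi_term r u X L sums (theta r (X * L * u) / 2 + theta r (X * inverse L * u) / 2)"
proof -
  define f where "f n = 1 / 2 * (r powi (n\<^sup>2) * (X * L * u) powi n) + 1 / 2 * (r powi (n\<^sup>2) * (X * inverse L * u) powi n)" for n :: int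
  have f: "f n = r powi (n\<^sup>2) * (u powi n * (X powi n * (L powi n + L powi (- n)))) / 2" for n
    by (simp add: f_def power_int_mult_distrib power_int_inverse power_int_minus algebra_simps add_divide_distrib)
  have "(f has_sum (1 / 2 * theta r (X * L * u) + 1 / 2 * theta r (X * inverse L * u))) UNIV"
    unfolding f_def by (intro has_sum_add has_sum_cmult_right theta_has_sum r_norm)
  from has_sum_int_fold[OF this]
  have "(\<lambda>n. if n = 0 then f 0 else f (int n) + f (- int n)) sums (theta r (X * L * u) / 2 + theta r (X * inverse L * u) / 2)" by simp
  moreover have "(if n = 0 then f 0 else f (int n) + f (- int n)) = Phi_term r u X L n" for n
  proof (cases "n = 0")
    case True
    then show ?thesis by (simp add: f Phi_term_def leval_P_poly_1 P_norm_1)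
  next
    case False
    have "u powi (- int n) = u ^ n" unfolding u_powi_minus by simp
    moreover have "r powi ((int n)\<^sup>2) = r ^ (n\<^sup>2)" by (metis of_nat_power power_int_of_nat)
    ultimately show ?thesis using False
      by (simp add: f Phi_term_def leval_P_poly_1 P_norm_1 algebra_simps add_divide_distrib)
  qed
  ultimately show ?thesis by simp
qed

end

text \<open>The singularities to be avoided are made explicit: L^2 = q^k covers the poles of the two
  \<sigma> and of the hypergeometric terms, and L^2 = t is the zero of the denominator 1 - t
  \<Lambda>^-2 in the formula for \<Psi>.\<close>

theorem theorem1p1:
  fixes q t r u X :: complex
  assumes "q \<noteq> 0" and "t \<noteq> 0" and "r ^ 4 = q" and "u ^ 2 = t"
    and "generic r u"
    and "norm q < 1"
    and "norm X > norm t powr (- 1 / 2) * norm q powr (1 / 2)"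
  shows
    "(\<forall>L. L \<noteq> 0 \<longrightarrow> Psi_term r u X L summable_on UNIV \<and> summable (Phi_term r u X L)) \<and>
     (\<forall>L. L \<noteq> 0 \<longrightarrow> theta r X \<noteq> 0 \<longrightarrow> theta r L \<noteq> 0 \<longrightarrow> theta r u \<noteq> 0 \<longrightarrow>
        Psi r u X L = theta r X * theta r L / theta r u * G_global r u X L) \<and>
     (\<forall>L. norm L < 1 \<longrightarrow>
        (\<lambda>i. L ^ (2 * Suc i) * (\<Prod>s=1..Suc i. (1 - t * q ^ (s - 1)) / (1 - q ^ s)))
          sums (sigma_fn q t L - 1)) \<and>
     (\<forall>L. L \<noteq> 0 \<longrightarrow> (\<forall>k::int. L ^ 2 \<noteq> q powi k) \<longrightarrow> L ^ 2 \<noteq> t \<longrightarrow>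
        Psi r u X L =
          mu_ct q t *
            (sigma_fn q t (inverse L) * theta r (X * L * u) * Xi_minus q t X L +
             sigma_fn q t L * theta r (X * inverse L * u) * Xi_plus q t X (inverse L))) \<and>
     (\<forall>L. L \<noteq> 0 \<longrightarrow> (\<forall>k::int. L ^ 2 \<noteq> q powi k) \<longrightarrow>
        Phi r u X L =
          mu_ct q t * sigma_fn q t (inverse L) * (theta r (X * L * u) / (1 + t)) *
            suminf (\<lambda>j. (q / t) ^ j * X powi (- 2 * int j) * hyp_prod q t L j) +
          mu_ct q t * sigma_fn q t L * (theta r (X * inverse L * u) / (1 + t)) *
            suminf (\<lambda>j. (q / t) ^ j * X powi (- 2 * int j) * hyp_prod q t (inverse L) j))"
proof -
  have params: "macdonald_params r u q t"
    by (rule generic_imp_params) (use assms in auto)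
  have gp: "generic_params r u q t"
    using params assms(5) by (simp add: generic_params_def generic_params_axioms_def)
  have r_norm: "norm r < 1"
  proof -
    have "norm r ^ 4 < 1" using assms(6) by (simp add: norm_power flip: assms(3))
    then show ?thesis by (simp add: power_less_one_iff)
  qed
  have X: "X \<noteq> 0" "norm (q / t * X powi (- 2)) < 1"
  proof -
    let ?b = "norm t powr (- 1 / 2) * norm q powr (1 / 2)"
    have b: "?b > 0" using assms(1,2) by simp
    then show X0: "X \<noteq> 0" using assms(7) by auto
    have "(norm t powr (- 1 / 2))\<^sup>2 = inverse (norm t)" "(norm q powr (1 / 2))\<^sup>2 = norm q"
      unfolding power2_eq_square powr_add[symmetric] by (simp_all add: powr_minus)
    then have "?b\<^sup>2 = norm q / norm t" by (simp only: power_mult_distrib divide_inverse mult.commute)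
    moreover have "?b\<^sup>2 < (norm X)\<^sup>2" using assms(7) b by (intro power_strict_mono) auto
    ultimately have "norm q / norm t < (norm X)\<^sup>2" by simp
    then show "norm (q / t * X powi (- 2)) < 1"
      using X0 assms(2) by (simp add: norm_mult norm_divide power_int_minus norm_inverse norm_power field_simps)
  qed
  have G: "Psi r u X L = theta r X * theta r L / theta r u * G_global r u X L"
    if "theta r X \<noteq> 0" "theta r L \<noteq> 0" "theta r u \<noteq> 0" for L
    using that by (simp add: G_global_def)
  have S: "(\<lambda>i. L ^ (2 * Suc i) * (\<Prod>s=1..Suc i. (1 - t * q ^ (s - 1)) / (1 - q ^ s))) sums (sigma_fn q t L - 1)"
    if "norm L < 1" for L
    using sigma_fn_series[OF assms(6) that] .
  have "(Psi_term r u X L summable_on UNIV \<and> summable (Phi_term r u X L)) \<and>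
    ((\<forall>k::int. L ^ 2 \<noteq> q powi k) \<longrightarrow> L ^ 2 \<noteq> t \<longrightarrow>
        Psi r u X L =
          mu_ct q t *
            (sigma_fn q t (inverse L) * theta r (X * L * u) * Xi_minus q t X L +
             sigma_fn q t L * theta r (X * inverse L * u) * Xi_plus q t X (inverse L))) \<and>
    ((\<forall>k::int. L ^ 2 \<noteq> q powi k) \<longrightarrow>
        Phi r u X L =
          mu_ct q t * sigma_fn q t (inverse L) * (theta r (X * L * u) / (1 + t)) *
            suminf (\<lambda>j. (q / t) ^ j * X powi (- 2 * int j) * hyp_prod q t L j) +
          mu_ct q t * sigma_fn q t L * (theta r (X * inverse L * u) / (1 + t)) *
            suminf (\<lambda>j. (q / t) ^ j * X powi (- 2 * int j) * hyp_prod q t (inverse L) j))"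
    if L: "L \<noteq> 0" for L
  proof (cases "t = 1")
    case True
    interpret trivial_params r u q t
      using gp r_norm True by (simp add: trivial_params_def trivial_params_axioms_def)
    have sg: "sigma_fn q t L = 1" "sigma_fn q t (inverse L) = 1" if k: "\<forall>k::int. L ^ 2 \<noteq> q powi k"
    proof -
      have "q ^ j * L\<^sup>2 \<noteq> 1" for j
      proof
        assume "q ^ j * L\<^sup>2 = 1"
        then have "L\<^sup>2 = q powi (- int j)" using assms(1) by (simp add: power_int_minus field_simps)
        then show False using k by blast
      qed
      then show "sigma_fn q t L = 1" unfolding t_1 by (rule sigma_fn_1)
      have "q ^ j * (inverse L)\<^sup>2 \<noteq> 1" for j
      proof
        assume "q ^ j * (inverse L)\<^sup>2 = 1"
        then have "L\<^sup>2 = q powi (int j)" using L by (simp add: field_simps)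
        then show False using k by blast
      qed
      then show "sigma_fn q t (inverse L) = 1" unfolding t_1 by (rule sigma_fn_1)
    qed
    have "Psi r u X L = theta r (X * inverse L * u)"
      unfolding Psi_def by (rule infsumI[OF Psi_has_sum_1[OF L]])
    moreover have "Phi r u X L = theta r (X * L * u) / 2 + theta r (X * inverse L * u) / 2"
      unfolding Phi_def by (rule sums_unique[OF Phi_sums_1[OF L], symmetric])
    moreover have "Psi_term r u X L summable_on UNIV" using Psi_has_sum_1[OF L] by (auto simp: summable_on_def)
    moreover have "summable (Phi_term r u X L)" using Phi_sums_1[OF L] by (rule sums_summable)
    ultimately show ?thesis using sg by (simp add: mu_ct_1[unfolded t_1] t_1 suminf_hyp_1 Xi_minus_1 Xi_plus_1)
  next
    case False
    interpret main_params r u q t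
      using gp assms(6) False by (simp add: main_params_def main_params_axioms_def)
    have ps: "Psi_term r u X L summable_on UNIV" using Psi_has_sum[OF L] by (auto simp: summable_on_def)
    have phi: "Phi r u X L =
          mu_ct q t * sigma_fn q t (inverse L) * (theta r (X * L * u) / (1 + t)) *
            suminf (\<lambda>j. (q / t) ^ j * X powi (- 2 * int j) * hyp_prod q t L j) +
          mu_ct q t * sigma_fn q t L * (theta r (X * inverse L * u) / (1 + t)) *
            suminf (\<lambda>j. (q / t) ^ j * X powi (- 2 * int j) * hyp_prod q t (inverse L) j)"
      if "\<forall>k::int. L ^ 2 \<noteq> q powi k"
    proof -
      have "m / (1 + t) * (a * b * c + d * e * g) = m * a * (b / (1 + t)) * c + m * d * (e / (1 + t)) * g" for m a b c d e g :: complex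
        by (simp add: algebra_simps)
      then show ?thesis using Phi_formula[OF X L] that unfolding hyp_term_def by presburger
    qed
    show ?thesis
      by (intro conjI impI ps Phi_summable phi Psi_formula[OF X L]) (simp_all only: simp_thms)
  qed
  then show ?thesis using G S by blast
qed


end
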